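(* Let $F$ be a field of positive characteristic $p$ and let $L$ be a finite-dimensional, $p$-nilpotent, nonabelian restricted Lie algebra over $F$. If $L$ is powerful, then its restricted enveloping algebra $u(L)$ does not have a filtered multiplicative basis.
   Context: A restricted Lie algebra $L$ over a field $F$ of characteristic $p>0$ is a Lie algebra with a $p$-map $x\mapsto x^{[p]}$; write $x^{[p]^n}$ for the $n$-fold iterate of the $p$-map applied to $x$. $L$ is $p$-nilpotent if for every $x\in L$ there is $n\ge 1$ with $x^{[p]^n}=0$. The restricted enveloping algebra $u(L)$ is the quotient of the universal enveloping algebra $U(L)$ by the ideal generated by all $x^p-x^{[p]}$, $x\in L$. A restricted subalgebra is a Lie subalgebra closed under the $p$-map. Powerful: let $L'=[L,L]$ be the derived subalgebra and let $L^{[p]^i}$ denote the restricted subalgebra of $L$ generated by the elements $x^{[p]^i}$, $x\in L$ (with $L^{[p]}=L^{[p]^1}$). A finite-dimensional $p$-nilpotent restricted Lie algebra $L$ is powerful if $p=2$ and $L'\subseteq L^{[p]^2}$, or $p>2$ and $L'\subseteq L^{[p]}$. Filtered multiplicative basis: let $A$ be a finite-dimensional associative algebra over $F$ with Jacobson radical $\mathrm{rad}(A)$. An $F$-basis $\mathfrak{B}$ of $A$ is a filtered multiplicative basis of $A$ if (i) for all $b_1,b_2\in\mathfrak{B}$, either $b_1b_2=0$ or $b_1b_2\in\mathfrak{B}$; and (ii) $\mathfrak{B}\cap\mathrm{rad}(A)$ is an $F$-basis of $\mathrm{rad}(A)$. *)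

theory Defs
  imports
    "Jordan_Normal_Form.VS_Connect"
    "HOL-Algebra.QuotRing"
    "HOL-Library.Poly_Mapping"
    "HOL-Computational_Algebra.Polynomial"
begin

section \<open>Restricted Lie algebras\<close>

locale lie_algebra = vector_space scale
  for scale :: "'f::field \<Rightarrow> 'l::ab_group_add \<Rightarrow> 'l" +
  fixes bracket :: "'l \<Rightarrow> 'l \<Rightarrow> 'l"
  assumes bracket_add_left: "bracket (x + y) z = bracket x z + bracket y z"
    and bracket_add_right: "bracket x (y + z) = bracket x y + bracket x z"
    and bracket_scale_left: "bracket (scale a x) y = scale a (bracket x y)"
    and bracket_scale_right: "bracket x (scale a y) = scale a (bracket x y)"
    and bracket_self: "bracket x x = 0"
    and jacobi: "bracket x (bracket y z) + bracket y (bracket z x) + bracket z (bracket x y) = 0"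
begin

definition abelian :: bool where
  "abelian \<longleftrightarrow> (\<forall>x y. bracket x y = 0)"

definition derived_subalgebra :: "'l set" where
  "derived_subalgebra = span {bracket x y | x y. True}"

text \<open>
  The elements of \<open>L \<otimes> F[t]\<close> are represented as polynomials in \<open>t\<close> with coefficients
  in \<open>L\<close>; \<open>ad_linear x y\<close> is the map \<open>ad (t x + y)\<close> on them. For
  \<open>1 \<le> i < p\<close>, \<open>i s\<^sub>i(x, y)\<close> is the coefficient of \<open>t\<close> to the power \<open>i - 1\<close> in
  \<open>(ad (t x + y))\<close> to the power \<open>p - 1\<close> applied to \<open>x\<close>, as in Jacobson's definition
  of a \<open>p\<close>-map.
\<close>

definition ad_linear :: "'l \<Rightarrow> 'l \<Rightarrow> 'l poly \<Rightarrow> 'l poly" where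
  "ad_linear x y v = pCons 0 (map_poly (bracket x) v) + map_poly (bracket y) v"

definition jacobson_s :: "nat \<Rightarrow> 'l \<Rightarrow> 'l \<Rightarrow> 'l" where
  "jacobson_s i x y =
    scale (inverse (of_nat i)) (poly.coeff ((ad_linear x y ^^ (CHAR('f) - 1)) [:x:]) (i - 1))"

end

locale restricted_lie_algebra = lie_algebra scale bracket
  for scale :: "'f::field \<Rightarrow> 'l::ab_group_add \<Rightarrow> 'l" and bracket +
  fixes pmap :: "'l \<Rightarrow> 'l"
  assumes char_pos: "CHAR('f) > 0"
    and pmap_ad: "bracket (pmap x) y = (bracket x ^^ CHAR('f)) y"
    and pmap_scale: "pmap (scale a x) = scale (a ^ CHAR('f)) (pmap x)"
    and pmap_add: "pmap (x + y) = pmap x + pmap y + (\<Sum>i = 1..<CHAR('f). jacobson_s i x y)"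
begin

definition p_nilpotent :: bool where
  "p_nilpotent \<longleftrightarrow> (\<forall>x. \<exists>n\<ge>1. (pmap ^^ n) x = 0)"

definition restricted_subalgebra :: "'l set \<Rightarrow> bool" where
  "restricted_subalgebra S \<longleftrightarrow>
    subspace S \<and> (\<forall>x\<in>S. \<forall>y\<in>S. bracket x y \<in> S) \<and> (\<forall>x\<in>S. pmap x \<in> S)"

definition pmap_subalgebra :: "nat \<Rightarrow> 'l set" where
  "pmap_subalgebra i = restricted_subalgebra hull range (pmap ^^ i)"

definition powerful :: bool where
  "powerful \<longleftrightarrow>
    (CHAR('f) = 2 \<and> derived_subalgebra \<subseteq> pmap_subalgebra 2) \<or>
    (CHAR('f) > 2 \<and> derived_subalgebra \<subseteq> pmap_subalgebra 1)"

end


section \<open>Quotients of associative algebras\<close>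

definition quotient_algebra ::
  "('f, 'a, 'm) module_scheme \<Rightarrow> 'a set \<Rightarrow> ('f, 'a set) module" where
  "quotient_algebra A I =
    ring.extend (A Quot I) (module.fields (\<lambda>c X. \<Union>x\<in>X. I +>\<^bsub>A\<^esub> (c \<odot>\<^bsub>A\<^esub> x)))"

text \<open>
  The locale \<^locale>\<open>algebra\<close> of the library is restricted to commutative algebras.
\<close>

definition assoc_algebra :: "('f, 'k) ring_scheme \<Rightarrow> ('f, 'a, 'm) module_scheme \<Rightarrow> bool" where
  "assoc_algebra K A \<longleftrightarrow> vectorspace K A \<and> ring A \<and>
    (\<forall>c\<in>carrier K. \<forall>x\<in>carrier A. \<forall>y\<in>carrier A.
      c \<odot>\<^bsub>A\<^esub> (x \<otimes>\<^bsub>A\<^esub> y) = (c \<odot>\<^bsub>A\<^esub> x) \<otimes>\<^bsub>A\<^esub> y \<and>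
      c \<odot>\<^bsub>A\<^esub> (x \<otimes>\<^bsub>A\<^esub> y) = x \<otimes>\<^bsub>A\<^esub> (c \<odot>\<^bsub>A\<^esub> y))"

lemma quotient_algebra_simps [simp]:
  "carrier (quotient_algebra A I) = carrier (A Quot I)"
  "mult (quotient_algebra A I) = mult (A Quot I)"
  "one (quotient_algebra A I) = one (A Quot I)"
  "zero (quotient_algebra A I) = zero (A Quot I)"
  "add (quotient_algebra A I) = add (A Quot I)"
  "smult (quotient_algebra A I) = (\<lambda>c X. \<Union>x\<in>X. I +>\<^bsub>A\<^esub> (c \<odot>\<^bsub>A\<^esub> x))"
  by (simp_all add: quotient_algebra_def ring.extend_def module.fields_def)

lemma ring_cong_fields:
  assumes "ring R" "carrier R' = carrier R" "mult R' = mult R" "one R' = one R"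
    "zero R' = zero R" "add R' = add R"
  shows "ring R'"
proof -
  interpret ring R by fact
  show ?thesis
    apply (rule ringI)
    subgoal by (rule abelian_groupI) (auto simp: assms a_ac intro: l_neg a_inv_closed)
    subgoal by (rule monoidI) (auto simp: assms m_assoc)
    by (auto simp: assms l_distr r_distr)
qed

lemma assoc_algebra_quotient:
  assumes A: "assoc_algebra K A" and I: "ideal I A"
  shows "assoc_algebra K (quotient_algebra A I)"
proof -
  interpret vectorspace K A using A by (simp add: assoc_algebra_def)
  interpret ideal I A by fact
  have compat: "c \<odot>\<^bsub>A\<^esub> (x \<otimes>\<^bsub>A\<^esub> y) = (c \<odot>\<^bsub>A\<^esub> x) \<otimes>\<^bsub>A\<^esub> y"
     "c \<odot>\<^bsub>A\<^esub> (x \<otimes>\<^bsub>A\<^esub> y) = x \<otimes>\<^bsub>A\<^esub> (c \<odot>\<^bsub>A\<^esub> y)"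
    if "c \<in> carrier K" "x \<in> carrier A" "y \<in> carrier A" for c x y
    using A that unfolding assoc_algebra_def by blast+
  let ?Q = "quotient_algebra A I"
  have rQ: "ring ?Q"
    by (rule ring_cong_fields[OF quotient_is_ring]) simp_all
  have carr: "carrier ?Q = (\<lambda>x. I +>\<^bsub>A\<^esub> x) ` carrier A"
    by (auto simp: FactRing_def A_RCOSETS_def')
  have smI: "c \<odot>\<^bsub>A\<^esub> x \<in> I" if "c \<in> carrier K" "x \<in> I" for c x
  proof -
    have x: "x \<in> carrier A" using that a_Hcarr by blast
    have "c \<odot>\<^bsub>A\<^esub> x = (c \<odot>\<^bsub>A\<^esub> \<one>\<^bsub>A\<^esub>) \<otimes>\<^bsub>A\<^esub> x"
      using compat(1)[OF that(1) _ x, of "\<one>\<^bsub>A\<^esub>"] x by simp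
    then show ?thesis using I_l_closed[OF that(2)] that(1) by simp
  qed
  have sm: "c \<odot>\<^bsub>?Q\<^esub> (I +>\<^bsub>A\<^esub> x) = I +>\<^bsub>A\<^esub> (c \<odot>\<^bsub>A\<^esub> x)" if c: "c \<in> carrier K" and x: "x \<in> carrier A" for c x
  proof -
    have *: "I +>\<^bsub>A\<^esub> (c \<odot>\<^bsub>A\<^esub> y) = I +>\<^bsub>A\<^esub> (c \<odot>\<^bsub>A\<^esub> x)" if y: "y \<in> I +>\<^bsub>A\<^esub> x" for y
    proof -
      obtain h where h: "h \<in> I" "y = h \<oplus>\<^bsub>A\<^esub> x" using y by (auto simp: a_r_coset_def r_coset_def)
      have "c \<odot>\<^bsub>A\<^esub> y = c \<odot>\<^bsub>A\<^esub> h \<oplus>\<^bsub>A\<^esub> c \<odot>\<^bsub>A\<^esub> x"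
        using h c x a_Hcarr by (simp add: smult_r_distr)
      then have "c \<odot>\<^bsub>A\<^esub> y \<in> I +>\<^bsub>A\<^esub> (c \<odot>\<^bsub>A\<^esub> x)"
        using smI[OF c h(1)] by (auto simp: a_r_coset_def r_coset_def)
      then show ?thesis using a_repr_independence c x by (metis smult_closed a_repr_independence')
    qed
    have "I +>\<^bsub>A\<^esub> x \<noteq> {}" using a_rcos_self[OF x] by blast
    then show ?thesis
      unfolding quotient_algebra_simps by (rule SUP_eq_const) (rule *)
  qed
  have addQ: "(I +>\<^bsub>A\<^esub> x) \<oplus>\<^bsub>?Q\<^esub> (I +>\<^bsub>A\<^esub> y) = I +>\<^bsub>A\<^esub> (x \<oplus>\<^bsub>A\<^esub> y)" if "x \<in> carrier A" "y \<in> carrier A" for x y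
    using a_rcos_sum[OF that] by (simp add: FactRing_def)
  have mulQ: "(I +>\<^bsub>A\<^esub> x) \<otimes>\<^bsub>?Q\<^esub> (I +>\<^bsub>A\<^esub> y) = I +>\<^bsub>A\<^esub> (x \<otimes>\<^bsub>A\<^esub> y)" if "x \<in> carrier A" "y \<in> carrier A" for x y
    using rcoset_mult_add[OF that] by (simp add: FactRing_def)
  interpret Q: ring ?Q by fact
  note [simp del] = quotient_algebra_simps(1,2,5,6)
  have mod: "Module.module K ?Q"
    by (rule moduleI[OF R.cring_axioms Q.abelian_group_axioms])
      (auto simp: carr sm addQ smult_l_distr smult_r_distr smult_assoc1)
  have "vectorspace K ?Q" using mod by (rule vectorspace.intro) (rule field_axioms)
  moreover have "(I +>\<^bsub>A\<^esub> (c \<odot>\<^bsub>A\<^esub> (x \<otimes>\<^bsub>A\<^esub> y))) = I +>\<^bsub>A\<^esub> ((c \<odot>\<^bsub>A\<^esub> x) \<otimes>\<^bsub>A\<^esub> y)"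
    "(I +>\<^bsub>A\<^esub> (c \<odot>\<^bsub>A\<^esub> (x \<otimes>\<^bsub>A\<^esub> y))) = I +>\<^bsub>A\<^esub> (x \<otimes>\<^bsub>A\<^esub> (c \<odot>\<^bsub>A\<^esub> y))"
    if "c \<in> carrier K" "x \<in> carrier A" "y \<in> carrier A" for c x y
    by (simp_all only: compat(1)[OF that, symmetric] compat(2)[OF that, symmetric])
  ultimately show ?thesis unfolding assoc_algebra_def carr ball_simps using rQ
    by (intro conjI ballI) (simp_all add: sm mulQ)
qed


section \<open>The restricted enveloping algebra\<close>

text \<open>
  Finitely supported functions on the free monoid over \<open>'l\<close>, multiplied by convolution,
  form the free associative unital algebra on the set \<open>'l\<close>.
\<close>

datatype 'a free_monoid = Word "'a list"

instantiation free_monoid :: (type) monoid_add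
begin

definition zero_free_monoid :: "'a free_monoid" where
  "0 = Word []"

fun plus_free_monoid :: "'a free_monoid \<Rightarrow> 'a free_monoid \<Rightarrow> 'a free_monoid" where
  "Word u + Word v = Word (u @ v)"

instance
proof
  fix a b c :: "'a free_monoid"
  show "a + b + c = a + (b + c)" by (cases a; cases b; cases c) simp
  show "0 + a = a" by (cases a) (simp add: zero_free_monoid_def)
  show "a + 0 = a" by (cases a) (simp add: zero_free_monoid_def)
qed

end

type_synonym ('l, 'f) free_alg = "'l free_monoid \<Rightarrow>\<^sub>0 'f"

definition free_algebra :: "('f::field, ('l, 'f) free_alg) module" where
  "free_algebra =
    \<lparr>carrier = UNIV, mult = (*), one = 1, zero = 0, add = (+),
     smult = (\<lambda>c. Poly_Mapping.map ((*) c))\<rparr>"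

definition gen :: "'l \<Rightarrow> ('l, 'f::field) free_alg" where
  "gen x = Poly_Mapping.single (Word [x]) 1"

lemma map_smult_conv_mult: "Poly_Mapping.map ((*) c) f = Poly_Mapping.single 0 c * f"
  for f :: "('l, 'f::field) free_alg"
  by (rule mult_map_scale_conv_mult)

lemma assoc_algebra_free_algebra:
  "assoc_algebra (class_ring :: 'f ring) (free_algebra :: ('f::field, ('l, 'f) free_alg) module)"
proof -
  let ?A = "free_algebra :: ('f::field, ('l, 'f) free_alg) module"
  have "ring ?A"
    by (rule ring_cong_fields[OF class_ring.ring_axioms]) (simp_all add: free_algebra_def)
  then interpret ring ?A .
  have comm: "Poly_Mapping.single 0 c * f = f * Poly_Mapping.single 0 c" for c and f :: "('l,'f) free_alg"
  proof (induction f rule: update_induct)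
    case (update f a b)
    have "Poly_Mapping.update a b f = f + Poly_Mapping.single a b"
      using update(1) by (intro poly_mapping_eqI)
        (auto simp: lookup_update lookup_add lookup_single when_def in_keys_iff)
    then show ?case using update(3) by (simp add: algebra_simps mult_single)
  qed simp
  have mod: "Module.module (class_ring :: 'f ring) ?A"
  proof (rule moduleI[OF class_cring.cring_axioms abelian_group_axioms])
    fix c d :: 'f and x y :: "('l, 'f) free_alg"
    have carr: "carrier ?A = UNIV" by (simp add: free_algebra_def)
    show "c \<odot>\<^bsub>?A\<^esub> x \<in> carrier ?A" unfolding carr by (rule UNIV_I)
    have "Poly_Mapping.single 0 (c * d) * x
        = Poly_Mapping.single 0 c * (Poly_Mapping.single 0 d * x)"
      unfolding mult.assoc[symmetric] mult_single by simp
    then show "(c \<otimes>\<^bsub>class_ring\<^esub> d) \<odot>\<^bsub>?A\<^esub> x = c \<odot>\<^bsub>?A\<^esub> (d \<odot>\<^bsub>?A\<^esub> x)"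
      unfolding free_algebra_def module.simps ring.simps monoid.simps map_smult_conv_mult .
    show "(c \<oplus>\<^bsub>class_ring\<^esub> d) \<odot>\<^bsub>?A\<^esub> x = c \<odot>\<^bsub>?A\<^esub> x \<oplus>\<^bsub>?A\<^esub> d \<odot>\<^bsub>?A\<^esub> x"
      unfolding free_algebra_def module.simps ring.simps map_smult_conv_mult single_add distrib_right ..
    show "c \<odot>\<^bsub>?A\<^esub> (x \<oplus>\<^bsub>?A\<^esub> y) = c \<odot>\<^bsub>?A\<^esub> x \<oplus>\<^bsub>?A\<^esub> c \<odot>\<^bsub>?A\<^esub> y"
      unfolding free_algebra_def module.simps ring.simps map_smult_conv_mult distrib_left ..
    show "\<one>\<^bsub>class_ring\<^esub> \<odot>\<^bsub>?A\<^esub> x = x"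
      unfolding free_algebra_def module.simps monoid.simps map_smult_conv_mult single_one mult_1_left ..
  qed
  have vs: "vectorspace class_ring ?A"
    using mod by (rule vectorspace.intro) (rule class_field.field_axioms)
  have l: "c \<odot>\<^bsub>?A\<^esub> (x \<otimes>\<^bsub>?A\<^esub> y) = (c \<odot>\<^bsub>?A\<^esub> x) \<otimes>\<^bsub>?A\<^esub> y" for c x y
    unfolding free_algebra_def module.simps monoid.simps map_smult_conv_mult mult.assoc ..
  have r: "c \<odot>\<^bsub>?A\<^esub> (x \<otimes>\<^bsub>?A\<^esub> y) = x \<otimes>\<^bsub>?A\<^esub> (c \<odot>\<^bsub>?A\<^esub> y)" for c x y
    unfolding free_algebra_def module.simps monoid.simps map_smult_conv_mult
    unfolding mult.assoc[symmetric] comm[of c x] ..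
  show ?thesis
    unfolding assoc_algebra_def by (intro conjI ballI vs ring_axioms l r)
qed

context lie_algebra
begin

text \<open>
  The first two families of relations make the generators depend linearly on the elements
  of \<open>L\<close>, so that dividing by them alone gives the tensor algebra of \<open>L\<close>.
\<close>

definition enveloping_relations :: "('l, 'f) free_alg set" where
  "enveloping_relations =
    {gen (x + y) - (gen x + gen y) | x y. True} \<union>
    {gen (scale c x) - Poly_Mapping.map ((*) c) (gen x) | c x. True} \<union>
    {gen x * gen y - gen y * gen x - gen (bracket x y) | x y. True}"

definition enveloping_ideal :: "('l, 'f) free_alg set" where
  "enveloping_ideal = Idl\<^bsub>(free_algebra :: ('f, ('l, 'f) free_alg) module)\<^esub> enveloping_relations"

definition enveloping_algebra :: "('f, ('l, 'f) free_alg set) module" where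
  "enveloping_algebra = quotient_algebra free_algebra enveloping_ideal"

definition enveloping_map :: "'l \<Rightarrow> ('l, 'f) free_alg set" where
  "enveloping_map x = enveloping_ideal +>\<^bsub>(free_algebra :: ('f, ('l, 'f) free_alg) module)\<^esub> gen x"

end

context restricted_lie_algebra
begin

definition restricted_relations :: "('l, 'f) free_alg set set" where
  "restricted_relations =
    {enveloping_map x [^]\<^bsub>enveloping_algebra\<^esub> CHAR('f) \<ominus>\<^bsub>enveloping_algebra\<^esub> enveloping_map (pmap x)
      | x. True}"

definition restricted_enveloping_algebra :: "('f, ('l, 'f) free_alg set set) module" where
  "restricted_enveloping_algebra =
    quotient_algebra enveloping_algebra (Idl\<^bsub>enveloping_algebra\<^esub> restricted_relations)"

lemma assoc_algebra_restricted_enveloping_algebra: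
  "assoc_algebra (class_ring :: 'f ring) restricted_enveloping_algebra"
proof -
  let ?T = "free_algebra :: ('f, ('l, 'f) free_alg) module"
  have T: "assoc_algebra (class_ring :: 'f ring) ?T" by (rule assoc_algebra_free_algebra)
  then interpret T: ring ?T by (simp add: assoc_algebra_def)
  have U: "assoc_algebra (class_ring :: 'f ring) enveloping_algebra"
    unfolding enveloping_algebra_def enveloping_ideal_def
    by (rule assoc_algebra_quotient[OF T], rule T.genideal_ideal) (simp add: free_algebra_def)
  then interpret U: ring enveloping_algebra by (simp add: assoc_algebra_def)
  have g: "enveloping_map x \<in> carrier enveloping_algebra" for x
    unfolding enveloping_algebra_def by (auto simp: enveloping_map_def FactRing_def A_RCOSETS_def' free_algebra_def)
  show ?thesis unfolding restricted_enveloping_algebra_def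
    by (rule assoc_algebra_quotient[OF U], rule U.genideal_ideal) (auto simp: restricted_relations_def g)
qed

end


section \<open>Filtered multiplicative bases\<close>

definition left_ideal :: "'a set \<Rightarrow> ('a, 'm) ring_scheme \<Rightarrow> bool" where
  "left_ideal I A \<longleftrightarrow>
    additive_subgroup I A \<and> (\<forall>a\<in>carrier A. \<forall>x\<in>I. a \<otimes>\<^bsub>A\<^esub> x \<in> I)"

definition maximal_left_ideal :: "'a set \<Rightarrow> ('a, 'm) ring_scheme \<Rightarrow> bool" where
  "maximal_left_ideal M A \<longleftrightarrow>
    left_ideal M A \<and> M \<noteq> carrier A \<and>
    (\<forall>J. left_ideal J A \<and> M \<subseteq> J \<longrightarrow> J = M \<or> J = carrier A)"

definition jacobson_radical :: "('a, 'm) ring_scheme \<Rightarrow> 'a set" where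
  "jacobson_radical A = carrier A \<inter> \<Inter>{M. maximal_left_ideal M A}"

definition filtered_multiplicative_basis ::
  "('f, 'k) ring_scheme \<Rightarrow> ('f, 'a, 'm) module_scheme \<Rightarrow> 'a set \<Rightarrow> bool" where
  "filtered_multiplicative_basis K A B \<longleftrightarrow>
    vectorspace.basis K A B \<and>
    (\<forall>b\<^sub>1\<in>B. \<forall>b\<^sub>2\<in>B. b\<^sub>1 \<otimes>\<^bsub>A\<^esub> b\<^sub>2 = \<zero>\<^bsub>A\<^esub> \<or> b\<^sub>1 \<otimes>\<^bsub>A\<^esub> b\<^sub>2 \<in> B) \<and>
    vectorspace.basis K (A\<lparr>carrier := jacobson_radical A\<rparr>) (B \<inter> jacobson_radical A)"

end

theory Submission
  imports Defs "HOL-Library.Function_Algebras" "HOL-Library.Product_Plus"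
begin

text \<open>
  Let \<open>\<omega>\<close> be the augmentation ideal of \<open>u(L)\<close>; it is nilpotent by Engel's theorem, hence equal to
  the radical. If \<open>L\<close> is powerful, then \<open>[x, y] \<in> \<omega>\<^sup>3\<close> for \<open>x, y \<in> L\<close>, so \<open>\<omega>\<close> is commutative modulo
  \<open>\<omega>\<^sup>3\<close>. Let \<open>b \<noteq> b'\<close> be elements of a filtered multiplicative basis that lie in \<open>\<omega>\<close> but not in
  \<open>\<omega>\<^sup>2\<close>. The products \<open>b b'\<close> and \<open>b' b\<close> are zero or basis elements and agree modulo \<open>\<omega>\<^sup>3\<close>, which is
  spanned by basis elements; so they are equal or both lie in \<open>\<omega>\<^sup>3\<close>. The latter is excluded by a
  homomorphism \<open>u(L) \<rightarrow> F[s, t]/(s\<^sup>2, t\<^sup>2)\<close> built from the coordinate functionals of \<open>b\<close> and \<open>b'\<close>.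
  Since such elements generate \<open>\<omega>\<close>, the algebra \<open>u(L)\<close> is commutative, and then \<open>L\<close> is abelian:
  the adjoint representation shows that \<open>L\<close> has nilpotency class at most two, and such an \<open>L\<close> has a
  faithful representation, obtained by repeatedly inducing from restricted ideals of codimension one.
\<close>

section \<open>Rings of additive endomorphisms\<close>

text \<open>The obstacle is to show that something does not vanish in \<open>u(L)\<close>, and no
  PBW basis is set up for this. Elements of \<open>u(L)\<close> are handled as noncommutative
  polynomials modulo \<open>ker\<close>: the relations put elements into \<open>ker\<close>, and
  whatever has to stay outside is kept out by a concrete representation. The trivial one makes the
  augmentation ideal proper, the quadratic one separates products of generators, and the last two
  recover brackets of \<open>L\<close>. The adjoint one does not suffice for that, since it cannot
  see the center: it only shows that all brackets are central. In this class-two situation all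
  values of the p-map are central and Jacobson's correction terms vanish except for
  \<open>p = 2\<close>, so the induced modules have an explicit formula. Inducing from codimension
  one turns a module \<open>V\<close> into \<open>p\<close> copies of \<open>V\<close>. To let the
  induction run inside one type, every module has the carrier \<open>nat \<Rightarrow> 'f\<close>,
  which is isomorphic to \<open>p\<close> copies of itself.\<close>

class nontrivial_ab_group_add = ab_group_add +
  assumes ex_nonzero: "\<exists>x. x \<noteq> 0"

instance "fun" :: (type, nontrivial_ab_group_add) nontrivial_ab_group_add
proof
  obtain c :: 'b where "c \<noteq> 0" using ex_nonzero by blast
  then have "(\<lambda>_::'a. c) \<noteq> 0" by (auto simp: fun_eq_iff)
  then show "\<exists>x::'a \<Rightarrow> 'b. x \<noteq> 0" by blast
qed

instance prod :: (ab_group_add, nontrivial_ab_group_add) nontrivial_ab_group_add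
proof
  obtain c :: 'b where "c \<noteq> 0" using ex_nonzero by blast
  then have "(0 :: 'a, c) \<noteq> 0" by (auto simp: zero_prod_def)
  then show "\<exists>x::'a \<times> 'b. x \<noteq> 0" by blast
qed

instance field \<subseteq> nontrivial_ab_group_add
  by standard (metis one_neq_zero)

text \<open>Maps are only required to be additive, so scalars are themselves elements of the ring. A
  representation then consists of two maps into one ring, and linearity becomes a commutation
  rule.\<close>

typedef (overloaded) ('v::ab_group_add) endo = "{h :: 'v \<Rightarrow> 'v. \<forall>x y. h (x + y) = h x + h y}"
  morphisms app Endo
  by (rule exI[of _ "\<lambda>x. x"]) simp

setup_lifting type_definition_endo

lemma app_add [simp]: "app h (x + y) = app h x + app h y"
  using app[of h] by simp

lemma app_zero [simp]: "app h 0 = 0"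
  using app_add[of h 0 0] by simp

lemma app_minus [simp]: "app h (- x) = - app h x"
  using app_add[of h x "- x"] by (simp add: minus_unique del: app_add)

lemma app_diff [simp]: "app h (x - y) = app h x - app h y"
  using app_add[of h x "- y"] by simp

lemma endo_eqI: "(\<And>v. app g v = app h v) \<Longrightarrow> g = h"
  by (metis app_inject ext)

text \<open>\<open>ring_1\<close> demands that zero and one differ, which fails for endomorphisms of
  the zero group; hence the class of nontrivial groups.\<close>

instantiation endo :: (nontrivial_ab_group_add) ring_1
begin

lift_definition zero_endo :: "'a endo" is "\<lambda>_. 0" by simp
lift_definition one_endo :: "'a endo" is "\<lambda>x. x" by simp
lift_definition plus_endo :: "'a endo \<Rightarrow> 'a endo \<Rightarrow> 'a endo" is "\<lambda>g h x. g x + h x"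
  by simp
lift_definition minus_endo :: "'a endo \<Rightarrow> 'a endo \<Rightarrow> 'a endo" is "\<lambda>g h x. g x - h x"
  by simp
lift_definition uminus_endo :: "'a endo \<Rightarrow> 'a endo" is "\<lambda>h x. - h x"
  by simp
lift_definition times_endo :: "'a endo \<Rightarrow> 'a endo \<Rightarrow> 'a endo" is "\<lambda>g h x. g (h x)"
  by simp

instance
proof
  show "(0 :: 'a endo) \<noteq> 1"
  proof
    assume "(0 :: 'a endo) = 1"
    then have "app (0 :: 'a endo) x = app 1 x" for x by simp
    then show False using ex_nonzero[where 'a = 'a] by (simp add: zero_endo.rep_eq one_endo.rep_eq)
  qed
qed (transfer; simp add: fun_eq_iff algebra_simps)+

end

lemma app_ring [simp]:
  "app 0 v = 0" "app 1 v = v" "app (g + h) v = app g v + app h v" "app (- g) v = - app g v"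
  "app (g - h) v = app g v - app h v" "app (g * h) v = app g (app h v)"
  for v :: "'v::nontrivial_ab_group_add"
  by (simp_all add: zero_endo.rep_eq one_endo.rep_eq plus_endo.rep_eq uminus_endo.rep_eq
      minus_endo.rep_eq times_endo.rep_eq)

lemma app_Endo: "(\<And>x y. h (x + y) = h x + h y) \<Longrightarrow> app (Endo h) = h"
  by (simp add: Endo_inverse)

section \<open>Evaluation of noncommutative polynomials\<close>

abbreviation scl :: "'f \<Rightarrow> ('l, 'f::field) free_alg" where
  "scl c \<equiv> Poly_Mapping.single 0 c"

abbreviation word :: "'l list \<Rightarrow> ('l, 'f::field) free_alg" where
  "word xs \<equiv> Poly_Mapping.single (Word xs) 1"

lemma word_Nil: "word [] = 1"
  by (simp add: zero_free_monoid_def flip: single_one)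

lemma word_append: "word (xs @ ys) = word xs * (word ys :: ('l, 'f::field) free_alg)"
  by (simp add: mult_single)

lemma word_Cons: "word (x # xs) = gen x * (word xs :: ('l, 'f::field) free_alg)"
  by (simp add: mult_single gen_def)

lemma word_replicate: "word (replicate n x) = (gen x :: ('l, 'f::field) free_alg) ^ n"
  by (induction n) (simp_all add: word_Nil word_Cons)

lemma scl_commute: "scl c * f = f * scl c" for f :: "('l, 'f::field) free_alg"
proof -
  have "\<forall>f g :: ('l, 'f) free_alg. Poly_Mapping.map ((*) c) (f * g) = f * Poly_Mapping.map ((*) c) g" for c :: 'f
    using assoc_algebra_free_algebra[where 'f = 'f and 'l = 'l]
    unfolding assoc_algebra_def
    by (simp only: free_algebra_def partial_object.simps monoid.simps ring.simps module.simps) blast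
  then have "scl c * (f * 1) = f * (scl c * 1)"
    unfolding map_smult_conv_mult by blast
  then show ?thesis by simp
qed

lemma scl_mult: "scl (a * b) = scl a * (scl b :: ('l, 'f::field) free_alg)"
  by (simp add: mult_single)

lemma scl_word: "scl c * word xs = (Poly_Mapping.single (Word xs) c :: ('l, 'f::field) free_alg)"
  by (simp add: mult_single zero_free_monoid_def)

lemma free_alg_induct [case_names zero add]:
  fixes f :: "('l, 'f::field) free_alg"
  assumes "P 0" and "\<And>c xs f. P f \<Longrightarrow> P (scl c * word xs + f)"
  shows "P f"
proof (induction f rule: update_induct)
  case const then show ?case by (rule assms(1))
next
  case (update f a b)
  obtain xs where a: "a = Word xs" by (cases a)
  have "Poly_Mapping.update a b f = Poly_Mapping.single a b + f"
    using update(1) by (intro poly_mapping_eqI)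
      (auto simp: lookup_update lookup_add lookup_single when_def in_keys_iff)
  then show ?case using assms(2)[OF update(3), of b xs] by (simp add: a scl_word)
qed

text \<open>Scalars need not be central in the target ring. For \<open>eval\<close> to be
  multiplicative it is enough that they commute with the images of the generators.\<close>

locale evaluation =
  fixes \<sigma> :: "'f::field \<Rightarrow> 'r::ring_1" and \<rho> :: "'l \<Rightarrow> 'r"
  assumes scalar_one: "\<sigma> 1 = 1"
    and scalar_add: "\<sigma> (a + b) = \<sigma> a + \<sigma> b"
    and scalar_mult: "\<sigma> (a * b) = \<sigma> a * \<sigma> b"
    and scalar_commute: "\<sigma> a * \<rho> x = \<rho> x * \<sigma> a"
begin

definition eval :: "('l, 'f) free_alg \<Rightarrow> 'r" where
  "eval f = (\<Sum>w \<in> Poly_Mapping.keys f. \<sigma> (Poly_Mapping.lookup f w) * (case w of Word xs \<Rightarrow> prod_list (map \<rho> xs)))"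

lemma scalar_zero: "\<sigma> 0 = 0"
  using scalar_add[of 0 0] by simp

lemma eval_zero [simp]: "eval 0 = 0"
  by (simp add: eval_def)

lemma eval_superset:
  assumes "finite A" "Poly_Mapping.keys f \<subseteq> A"
  shows "eval f = (\<Sum>w\<in>A. \<sigma> (Poly_Mapping.lookup f w) * (case w of Word xs \<Rightarrow> prod_list (map \<rho> xs)))"
  unfolding eval_def using assms
  by (intro sum.mono_neutral_left) (auto simp: in_keys_iff scalar_zero)

lemma eval_add [simp]: "eval (f + g) = eval f + eval g"
proof -
  let ?A = "Poly_Mapping.keys f \<union> Poly_Mapping.keys g"
  have "Poly_Mapping.keys (f + g) \<subseteq> ?A" by (rule Poly_Mapping.keys_add)
  then show ?thesis
    by (simp add: eval_superset[of ?A] lookup_add scalar_add distrib_right sum.distrib)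
qed

lemma eval_minus [simp]: "eval (- f) = - eval f"
  using eval_add[of f "- f"] by (simp add: minus_unique del: eval_add)

lemma eval_diff [simp]: "eval (f - g) = eval f - eval g"
  using eval_add[of f "- g"] by simp

lemma eval_single: "eval (Poly_Mapping.single (Word xs) c) = \<sigma> c * prod_list (map \<rho> xs)"
  by (simp add: eval_def scalar_zero)

lemma eval_word [simp]: "eval (word xs) = prod_list (map \<rho> xs)"
  by (simp add: eval_single scalar_one)

lemma eval_scl [simp]: "eval (scl c) = \<sigma> c"
  by (simp add: zero_free_monoid_def eval_single)

lemma eval_gen [simp]: "eval (gen x) = \<rho> x"
  by (simp add: gen_def)

lemma eval_one [simp]: "eval 1 = 1"
  using eval_scl[of 1] by (simp add: scalar_one del: eval_scl)

lemma scalar_commute_prod: "\<sigma> a * prod_list (map \<rho> xs) = prod_list (map \<rho> xs) * \<sigma> a"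
  by (induction xs) (simp_all, metis mult.assoc scalar_commute)

lemma eval_mult_single: "eval (Poly_Mapping.single (Word xs) c * Poly_Mapping.single (Word ys) d) =
   eval (Poly_Mapping.single (Word xs) c) * eval (Poly_Mapping.single (Word ys) d)"
proof -
  have "\<sigma> d * prod_list (map \<rho> xs) = prod_list (map \<rho> xs) * \<sigma> d" by (rule scalar_commute_prod)
  then show ?thesis
    by (simp add: mult_single eval_single scalar_mult) (metis mult.assoc)
qed

lemma eval_mult [simp]: "eval (f * g) = eval f * eval g"
proof (induction f rule: free_alg_induct)
  case (add c xs f)
  have "eval (Poly_Mapping.single (Word xs) c * g) = eval (Poly_Mapping.single (Word xs) c) * eval g"
    by (induction g rule: free_alg_induct)
      (simp_all add: scl_word distrib_left eval_mult_single)
  with add show ?case by (simp add: scl_word distrib_right)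
qed simp

lemma eval_power [simp]: "eval (f ^ n) = eval f ^ n"
  by (induction n) simp_all

end

section \<open>The projection onto the restricted enveloping algebra\<close>

lemma coset_ring_hom:
  assumes "ideal I A"
  shows "(\<lambda>x. I +>\<^bsub>A\<^esub> x) \<in> Ring.ring_hom A (quotient_algebra A I)"
  using ideal.rcos_ring_hom[OF assms] by (simp add: Ring.ring_hom_def)

lemma coset_eq_zero_iff:
  assumes "ideal I A" "x \<in> carrier A"
  shows "I +>\<^bsub>A\<^esub> x = \<zero>\<^bsub>quotient_algebra A I\<^esub> \<longleftrightarrow> x \<in> I"
proof -
  interpret ideal I A by fact
  show ?thesis using rcos_const_imp_mem[OF assms(2)] a_rcos_zero[OF assms(1)]
    by (auto simp: FactRing_def)
qed

lemma carrier_quotient_algebra: "carrier (quotient_algebra A I) = (\<lambda>x. I +>\<^bsub>A\<^esub> x) ` carrier A"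
  by (auto simp: FactRing_def A_RCOSETS_def')

lemma coset_smult:
  assumes A: "assoc_algebra K A" and I: "ideal I A" and c: "c \<in> carrier K" and x: "x \<in> carrier A"
  shows "c \<odot>\<^bsub>quotient_algebra A I\<^esub> (I +>\<^bsub>A\<^esub> x) = I +>\<^bsub>A\<^esub> (c \<odot>\<^bsub>A\<^esub> x)"
proof -
  let ?Q = "quotient_algebra A I"
  interpret ideal I A by fact
  interpret A: vectorspace K A using A by (simp add: assoc_algebra_def)
  interpret Q: vectorspace K ?Q using assoc_algebra_quotient[OF A I] by (simp add: assoc_algebra_def)
  have "I +>\<^bsub>A\<^esub> x \<in> carrier ?Q" using x by (simp only: carrier_quotient_algebra) blast
  then have "c \<odot>\<^bsub>?Q\<^esub> (I +>\<^bsub>A\<^esub> x) \<in> carrier ?Q" using c by (rule Q.smult_closed[rotated])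
  then obtain z where z: "z \<in> carrier A" "c \<odot>\<^bsub>?Q\<^esub> (I +>\<^bsub>A\<^esub> x) = I +>\<^bsub>A\<^esub> z"
    unfolding carrier_quotient_algebra by blast
  have "c \<odot>\<^bsub>A\<^esub> x \<in> carrier A" using c x by simp
  \<comment> \<open>The scalar multiple of a coset is defined as a union of cosets. It has just been
    shown to be a single coset, so one common element identifies it.\<close>
  moreover have "c \<odot>\<^bsub>A\<^esub> x \<in> c \<odot>\<^bsub>?Q\<^esub> (I +>\<^bsub>A\<^esub> x)"
    using a_rcos_self[OF x] a_rcos_self[OF calculation] by auto
  ultimately show ?thesis using z a_repr_independence' by metis
qed

context restricted_lie_algebra
begin

abbreviation free_alg_module :: "('f, ('l, 'f) free_alg) module" where
  "free_alg_module \<equiv> free_algebra"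

text \<open>The composite of the two quotient maps. It allows computations in \<open>u(L)\<close> to
  take place in the free algebra modulo \<open>ker\<close>.\<close>

definition proj :: "('l, 'f) free_alg \<Rightarrow> ('l, 'f) free_alg set set" where
  "proj t = (Idl\<^bsub>enveloping_algebra\<^esub> restricted_relations) +>\<^bsub>enveloping_algebra\<^esub>
     (enveloping_ideal +>\<^bsub>free_alg_module\<^esub> t)"

definition ker :: "('l, 'f) free_alg set" where
  "ker = {t. proj t = \<zero>\<^bsub>restricted_enveloping_algebra\<^esub>}"

lemma assoc_T: "assoc_algebra (class_ring :: 'f ring) free_alg_module"
  by (rule assoc_algebra_free_algebra)

lemma ring_T: "ring free_alg_module"
  using assoc_T by (simp add: assoc_algebra_def)

lemma T_simps:
  "carrier free_alg_module = UNIV" "a \<otimes>\<^bsub>free_alg_module\<^esub> b = a * b"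
  "a \<oplus>\<^bsub>free_alg_module\<^esub> b = a + b" "\<one>\<^bsub>free_alg_module\<^esub> = 1" "\<zero>\<^bsub>free_alg_module\<^esub> = 0"
  "c \<odot>\<^bsub>free_alg_module\<^esub> a = scl c * a"
  by (simp_all add: free_algebra_def map_smult_conv_mult)

lemma ideal_enveloping: "ideal enveloping_ideal free_alg_module"
  unfolding enveloping_ideal_def by (rule ring.genideal_ideal[OF ring_T]) (simp add: T_simps)

lemma assoc_U1: "assoc_algebra (class_ring :: 'f ring) enveloping_algebra"
  unfolding enveloping_algebra_def by (rule assoc_algebra_quotient[OF assoc_T ideal_enveloping])

lemma ring_U1: "ring enveloping_algebra"
  using assoc_U1 by (simp add: assoc_algebra_def)

lemma enveloping_map_closed: "enveloping_map x \<in> carrier enveloping_algebra"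
  unfolding enveloping_algebra_def enveloping_map_def carrier_quotient_algebra by (auto simp: T_simps)

lemma restricted_relations_closed: "restricted_relations \<subseteq> carrier enveloping_algebra"
proof -
  interpret ring enveloping_algebra by (rule ring_U1)
  show ?thesis by (auto simp: restricted_relations_def enveloping_map_closed)
qed

lemma ideal_restricted: "ideal (Idl\<^bsub>enveloping_algebra\<^esub> restricted_relations) enveloping_algebra"
  by (rule ring.genideal_ideal[OF ring_U1 restricted_relations_closed])

lemma assoc_U: "assoc_algebra (class_ring :: 'f ring) restricted_enveloping_algebra"
  by (rule assoc_algebra_restricted_enveloping_algebra)

lemma ring_U: "ring restricted_enveloping_algebra"
  using assoc_U by (simp add: assoc_algebra_def)

lemma quot1_hom: "(\<lambda>t. enveloping_ideal +>\<^bsub>free_alg_module\<^esub> t) \<in> Ring.ring_hom free_alg_module enveloping_algebra"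
  unfolding enveloping_algebra_def by (rule coset_ring_hom[OF ideal_enveloping])

lemma proj_hom: "proj \<in> Ring.ring_hom free_alg_module restricted_enveloping_algebra"
proof -
  have "(\<lambda>x. (Idl\<^bsub>enveloping_algebra\<^esub> restricted_relations) +>\<^bsub>enveloping_algebra\<^esub> x)
      \<in> Ring.ring_hom enveloping_algebra restricted_enveloping_algebra"
    unfolding restricted_enveloping_algebra_def by (rule coset_ring_hom[OF ideal_restricted])
  with quot1_hom show ?thesis
    unfolding proj_def by (auto simp: Ring.ring_hom_def Pi_def)
qed

lemma carrier_U: "carrier restricted_enveloping_algebra = range proj"
  unfolding restricted_enveloping_algebra_def carrier_quotient_algebra
  unfolding enveloping_algebra_def carrier_quotient_algebra T_simps image_image
  unfolding proj_def enveloping_algebra_def by (rule refl)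

lemma proj_add: "proj (a + b) = proj a \<oplus>\<^bsub>restricted_enveloping_algebra\<^esub> proj b"
  using Ring.ring_hom_add[OF proj_hom, of a b] by (simp add: T_simps)

lemma proj_mult: "proj (a * b) = proj a \<otimes>\<^bsub>restricted_enveloping_algebra\<^esub> proj b"
  using Ring.ring_hom_mult[OF proj_hom, of a b] by (simp add: T_simps)

lemma proj_closed: "proj a \<in> carrier restricted_enveloping_algebra"
  by (simp add: carrier_U)

lemma proj_zero: "proj 0 = \<zero>\<^bsub>restricted_enveloping_algebra\<^esub>"
  using Ring.ring_hom_zero[OF proj_hom ring_T ring_U] by (simp add: T_simps)

lemma proj_scl: "proj (scl c * a) = c \<odot>\<^bsub>restricted_enveloping_algebra\<^esub> proj a"
proof -
  have c: "c \<in> carrier (class_ring :: 'f ring)" by simp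
  have 1: "enveloping_ideal +>\<^bsub>free_alg_module\<^esub> a \<in> carrier enveloping_algebra"
    unfolding enveloping_algebra_def carrier_quotient_algebra by (auto simp: T_simps)
  have "c \<odot>\<^bsub>restricted_enveloping_algebra\<^esub> proj a =
    (Idl\<^bsub>enveloping_algebra\<^esub> restricted_relations) +>\<^bsub>enveloping_algebra\<^esub>
     (c \<odot>\<^bsub>enveloping_algebra\<^esub> (enveloping_ideal +>\<^bsub>free_alg_module\<^esub> a))"
    unfolding proj_def restricted_enveloping_algebra_def
    by (rule coset_smult[OF assoc_U1 ideal_restricted c 1])
  also have "c \<odot>\<^bsub>enveloping_algebra\<^esub> (enveloping_ideal +>\<^bsub>free_alg_module\<^esub> a)
     = enveloping_ideal +>\<^bsub>free_alg_module\<^esub> (c \<odot>\<^bsub>free_alg_module\<^esub> a)"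
    unfolding enveloping_algebra_def
    by (rule coset_smult[OF assoc_T ideal_enveloping c]) (simp add: T_simps)
  finally show ?thesis by (simp add: proj_def T_simps)
qed

lemma proj_minus: "proj (- a) = \<ominus>\<^bsub>restricted_enveloping_algebra\<^esub> proj a"
proof -
  interpret U: ring restricted_enveloping_algebra by (rule ring_U)
  show ?thesis using proj_add[of "- a" a] by (simp add: proj_zero U.minus_equality proj_closed)
qed

lemma proj_diff_eq_zero: "proj (a - b) = \<zero>\<^bsub>restricted_enveloping_algebra\<^esub> \<longleftrightarrow> proj a = proj b"
proof -
  interpret U: ring restricted_enveloping_algebra by (rule ring_U)
  have "proj (a - b) = proj a \<ominus>\<^bsub>restricted_enveloping_algebra\<^esub> proj b"
    using proj_add[of a "- b"] by (simp add: proj_minus a_minus_def)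
  then show ?thesis by (simp add: proj_closed)
qed

lemma proj_eq_iff: "proj a = proj b \<longleftrightarrow> a - b \<in> ker"
  by (simp add: ker_def proj_diff_eq_zero)

lemma ker_zero [simp]: "0 \<in> ker"
  by (simp add: ker_def proj_zero)

lemma ker_add: "a \<in> ker \<Longrightarrow> b \<in> ker \<Longrightarrow> a + b \<in> ker"
proof -
  interpret U: ring restricted_enveloping_algebra by (rule ring_U)
  show "a \<in> ker \<Longrightarrow> b \<in> ker \<Longrightarrow> a + b \<in> ker" by (simp add: ker_def proj_add)
qed

lemma ker_mult_left: "b \<in> ker \<Longrightarrow> a * b \<in> ker"
proof -
  interpret U: ring restricted_enveloping_algebra by (rule ring_U)
  show "b \<in> ker \<Longrightarrow> a * b \<in> ker" by (simp add: ker_def proj_mult proj_closed)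
qed

lemma ker_mult_right: "a \<in> ker \<Longrightarrow> a * b \<in> ker"
proof -
  interpret U: ring restricted_enveloping_algebra by (rule ring_U)
  show "a \<in> ker \<Longrightarrow> a * b \<in> ker" by (simp add: ker_def proj_mult proj_closed)
qed

lemma ker_minus: "a \<in> ker \<Longrightarrow> - a \<in> ker"
  using ker_mult_left[of a "- 1"] by simp

lemma ker_diff: "a \<in> ker \<Longrightarrow> b \<in> ker \<Longrightarrow> a - b \<in> ker"
  using ker_add[of a "- b"] by (simp add: ker_minus)

lemma enveloping_ideal_ker: "t \<in> enveloping_ideal \<Longrightarrow> t \<in> ker"
proof -
  assume "t \<in> enveloping_ideal"
  then have "enveloping_ideal +>\<^bsub>free_alg_module\<^esub> t = \<zero>\<^bsub>enveloping_algebra\<^esub>"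
    using coset_eq_zero_iff[OF ideal_enveloping, of t] by (simp add: T_simps enveloping_algebra_def)
  then show "t \<in> ker"
    using coset_eq_zero_iff[OF ideal_restricted, of "\<zero>\<^bsub>enveloping_algebra\<^esub>"]
      ring.ring_simprules(2)[OF ring_U1]
      additive_subgroup.zero_closed[OF ideal.axioms(1)[OF ideal_restricted]]
    by (simp add: ker_def proj_def restricted_enveloping_algebra_def)
qed

lemma enveloping_relations_ker: "t \<in> enveloping_relations \<Longrightarrow> t \<in> ker"
  using ring.genideal_self[OF ring_T, of enveloping_relations] enveloping_ideal_ker
  by (auto simp: enveloping_ideal_def T_simps)

lemma gen_add_ker: "gen (x + y) - (gen x + gen y) \<in> ker"
  by (rule enveloping_relations_ker) (auto simp: enveloping_relations_def)

lemma gen_scale_ker: "gen (scale c x) - scl c * gen x \<in> ker"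
  by (rule enveloping_relations_ker) (auto simp: enveloping_relations_def map_smult_conv_mult)

lemma gen_bracket_ker: "gen x * gen y - gen y * gen x - gen (bracket x y) \<in> ker"
  by (rule enveloping_relations_ker) (auto simp: enveloping_relations_def)

lemma quot1_power:
  "enveloping_ideal +>\<^bsub>free_alg_module\<^esub> (t ^ n) =
   (enveloping_ideal +>\<^bsub>free_alg_module\<^esub> t) [^]\<^bsub>enveloping_algebra\<^esub> n"
proof (induction n)
  case 0
  show ?case using Ring.ring_hom_one[OF quot1_hom] by (simp add: T_simps nat_pow_def)
next
  case (Suc n)
  interpret monoid enveloping_algebra by (rule ring.is_monoid[OF ring_U1])
  show ?case using Ring.ring_hom_mult[OF quot1_hom, of "t ^ n" t] Suc
    by (simp add: T_simps power_commutes)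
qed

lemma quot1_minus:
  "enveloping_ideal +>\<^bsub>free_alg_module\<^esub> (s - t) =
   (enveloping_ideal +>\<^bsub>free_alg_module\<^esub> s) \<ominus>\<^bsub>enveloping_algebra\<^esub> (enveloping_ideal +>\<^bsub>free_alg_module\<^esub> t)"
proof -
  let ?q = "\<lambda>t. enveloping_ideal +>\<^bsub>free_alg_module\<^esub> t"
  interpret U1: ring enveloping_algebra by (rule ring_U1)
  have c: "?q u \<in> carrier enveloping_algebra" for u
    using Ring.ring_hom_closed[OF quot1_hom, of u] by (simp add: T_simps)
  have "?q s = ?q (s - t) \<oplus>\<^bsub>enveloping_algebra\<^esub> ?q t"
    using Ring.ring_hom_add[OF quot1_hom, of "s - t" t] by (simp add: T_simps)
  then show ?thesis using c by (simp add: U1.minus_eq U1.a_assoc U1.r_neg)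
qed

lemma gen_pmap_ker: "gen x ^ CHAR('f) - gen (pmap x) \<in> ker"
proof -
  let ?t = "gen x ^ CHAR('f) - (gen (pmap x) :: ('l, 'f) free_alg)"
  have "enveloping_ideal +>\<^bsub>free_alg_module\<^esub> ?t \<in> restricted_relations"
    unfolding quot1_minus quot1_power restricted_relations_def enveloping_map_def by blast
  then have "enveloping_ideal +>\<^bsub>free_alg_module\<^esub> ?t \<in> Idl\<^bsub>enveloping_algebra\<^esub> restricted_relations"
    using ring.genideal_self[OF ring_U1 restricted_relations_closed] by blast
  moreover have "enveloping_ideal +>\<^bsub>free_alg_module\<^esub> ?t \<in> carrier enveloping_algebra"
    using Ring.ring_hom_closed[OF quot1_hom, of ?t] by (simp add: T_simps)
  ultimately show ?thesis
    using coset_eq_zero_iff[OF ideal_restricted] by (simp add: ker_def proj_def restricted_enveloping_algebra_def)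
qed

end

section \<open>The universal property of the restricted enveloping algebra\<close>

locale restricted_evaluation =
  restricted_lie_algebra scale bracket pmap + evaluation \<sigma> \<rho>
  for scale :: "'f::field \<Rightarrow> 'l::ab_group_add \<Rightarrow> 'l" and bracket pmap
    and \<sigma> :: "'f \<Rightarrow> 'r::ring_1" and \<rho> :: "'l \<Rightarrow> 'r" +
  assumes rep_add: "\<rho> (x + y) = \<rho> x + \<rho> y"
    and rep_scale: "\<rho> (scale c x) = \<sigma> c * \<rho> x"
    and rep_bracket: "\<rho> (bracket x y) = \<rho> x * \<rho> y - \<rho> y * \<rho> x"
    and rep_pmap: "\<rho> (pmap x) = \<rho> x ^ CHAR('f)"
begin

lemma eval_enveloping_ideal:
  assumes "t \<in> enveloping_ideal"
  shows "eval t = 0"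
proof -
  have "ideal {t. eval t = 0} free_alg_module"
  proof (intro idealI ring_T)
    show "subgroup {t. eval t = 0} (add_monoid free_alg_module)"
    proof (rule group.subgroupI[OF abelian_group.a_group])
      show "abelian_group free_alg_module" using ring_T by (rule ring.is_abelian_group)
      fix a assume a: "a \<in> {t. eval t = 0}"
      have "\<ominus>\<^bsub>free_alg_module\<^esub> a = - a"
        using abelian_group.minus_equality[OF ring.is_abelian_group[OF ring_T], of "- a" a]
        by (simp add: T_simps)
      then show "inv\<^bsub>add_monoid free_alg_module\<^esub> a \<in> {t. eval t = 0}"
        using a by (simp add: a_inv_def)
    qed (auto simp: T_simps intro: exI[of _ 0])
  qed (auto simp: T_simps)
  moreover have "enveloping_relations \<subseteq> {t. eval t = 0}"
    by (auto simp: enveloping_relations_def map_smult_conv_mult rep_add rep_scale rep_bracket)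
  ultimately show ?thesis
    using ring.genideal_minimal[OF ring_T] assms unfolding enveloping_ideal_def by blast
qed

text \<open>A representation that respects the p-map factors through \<open>u(L)\<close>. Its main
  use is contrapositive: an element acting nontrivially is outside \<open>ker\<close>.\<close>

lemma eval_ker:
  assumes "t \<in> ker"
  shows "eval t = 0"
proof -
  let ?U1 = "enveloping_algebra"
  let ?q = "\<lambda>t. enveloping_ideal +>\<^bsub>free_alg_module\<^esub> t"
  \<comment> \<open>The restricted relations live in \<open>U(L)\<close>, while \<open>eval\<close>
    is defined on the free algebra. Its kernel is therefore pushed forward to an ideal of
    \<open>U(L)\<close>.\<close>
  let ?I = "{?q t | t. eval t = 0}"
  interpret U1: ring ?U1 by (rule ring_U1)
  have q: "?q a \<oplus>\<^bsub>?U1\<^esub> ?q b = ?q (a + b)" "?q a \<otimes>\<^bsub>?U1\<^esub> ?q b = ?q (a * b)"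
    "?q a \<in> carrier ?U1" for a b
    using Ring.ring_hom_add[OF quot1_hom, of a b] Ring.ring_hom_mult[OF quot1_hom, of a b]
      Ring.ring_hom_closed[OF quot1_hom, of a] by (simp_all add: T_simps)
  have surj: "carrier ?U1 = range ?q"
    unfolding enveloping_algebra_def carrier_quotient_algebra T_simps by (rule refl)
  have q0: "?q 0 = \<zero>\<^bsub>?U1\<^esub>"
    using Ring.ring_hom_zero[OF quot1_hom ring_T ring_U1] by (simp add: T_simps)
  have "ideal ?I ?U1"
  proof (intro idealI ring_U1)
    show "subgroup ?I (add_monoid ?U1)"
    proof (rule group.subgroupI[OF abelian_group.a_group[OF U1.is_abelian_group]])
      show "?I \<noteq> {}" by (auto intro: exI[of _ 0])
    next
      fix a assume "a \<in> ?I"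
      then obtain t where t: "a = ?q t" "eval t = 0" by blast
      have "\<ominus>\<^bsub>?U1\<^esub> ?q t = ?q (- t)"
        using U1.minus_equality[of "?q (- t)" "?q t"] by (simp add: q q0)
      then show "inv\<^bsub>add_monoid ?U1\<^esub> a \<in> ?I" using t by (auto simp: a_inv_def intro!: exI[of _ "- t"])
    next
      fix a b assume "a \<in> ?I" "b \<in> ?I"
      then obtain s t where "a = ?q s" "b = ?q t" "eval s = 0" "eval t = 0" by blast
      then show "a \<otimes>\<^bsub>add_monoid ?U1\<^esub> b \<in> ?I" by (auto simp: q intro!: exI[of _ "s + t"])
    qed (auto simp: q)
  next
    fix a x assume "a \<in> ?I" "x \<in> carrier ?U1"
    then obtain t s where *: "a = ?q t" "x = ?q s" "eval t = 0" using surj by blast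
    show "x \<otimes>\<^bsub>?U1\<^esub> a \<in> ?I" using * by (auto simp: q intro!: exI[of _ "s * t"])
    show "a \<otimes>\<^bsub>?U1\<^esub> x \<in> ?I" using * by (auto simp: q intro!: exI[of _ "t * s"])
  qed
  moreover have "restricted_relations \<subseteq> ?I"
  proof
    fix r assume "r \<in> restricted_relations"
    then obtain x where "r = enveloping_map x [^]\<^bsub>?U1\<^esub> CHAR('f) \<ominus>\<^bsub>?U1\<^esub> enveloping_map (pmap x)"
      unfolding restricted_relations_def by blast
    then have "r = ?q (gen x ^ CHAR('f) - gen (pmap x))"
      by (simp add: quot1_minus quot1_power enveloping_map_def)
    then show "r \<in> ?I" by (auto simp: rep_pmap intro!: exI[of _ "gen x ^ CHAR('f) - gen (pmap x)"])
  qed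
  ultimately have "Idl\<^bsub>?U1\<^esub> restricted_relations \<subseteq> ?I" by (rule U1.genideal_minimal)
  moreover have "?q t \<in> Idl\<^bsub>?U1\<^esub> restricted_relations"
    using assms coset_eq_zero_iff[OF ideal_restricted, of "?q t"] q(3)
    by (simp add: ker_def proj_def restricted_enveloping_algebra_def)
  \<comment> \<open>The coset of \<open>t\<close> has some representative killed by
    \<open>eval\<close>; since \<open>eval\<close> vanishes on the enveloping ideal,
    \<open>t\<close> is killed as well.\<close>
  ultimately obtain s where s: "?q t = ?q s" "eval s = 0" by blast
  then have "?q (t - s) = \<zero>\<^bsub>?U1\<^esub>" by (simp add: quot1_minus q(3) U1.minus_eq U1.r_neg)
  then have "t - s \<in> enveloping_ideal"
    using coset_eq_zero_iff[OF ideal_enveloping, of "t - s"] by (simp add: T_simps enveloping_algebra_def)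
  then have "eval (t - s) = 0" by (rule eval_enveloping_ideal)
  then show ?thesis using s by simp
qed

end

section \<open>Nilpotency of the augmentation ideal\<close>

context restricted_lie_algebra
begin

section \<open>Bracket identities and the adjoint representation\<close>

lemma bracket_zero_right [simp]: "bracket x 0 = 0"
  using bracket_add_right[of x 0 0] by simp

lemma bracket_minus_right: "bracket x (- y) = - bracket x y"
  using bracket_add_right[of x "- y" y] by (simp add: eq_neg_iff_add_eq_0)

lemma bracket_anticomm: "bracket y x = - bracket x y"
proof -
  have "bracket (x + y) (x + y) = 0" by (rule bracket_self)
  then have "bracket x y + bracket y x = 0"
    unfolding bracket_add_left bracket_add_right by (simp add: bracket_self add.commute)
  then show ?thesis by (simp add: eq_neg_iff_add_eq_0 add.commute)
qed

lemma ad_bracket: "bracket (bracket x y) z = bracket x (bracket y z) - bracket y (bracket x z)"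
  using jacobi[of x y z] bracket_anticomm[of z "bracket x y"] bracket_anticomm[of z x]
  by (simp add: bracket_minus_right algebra_simps add_eq_0_iff2)

text \<open>The adjoint module is enlarged by a copy of \<open>'f\<close> on which \<open>L\<close>
  acts as zero. This keeps the carrier nontrivial even if \<open>'l\<close> has only one
  element.\<close>

definition ad_scalar :: "'f \<Rightarrow> ('l \<times> 'f) endo" where
  "ad_scalar c = Endo (\<lambda>(v, a). (scale c v, c * a))"

definition ad_rep :: "'l \<Rightarrow> ('l \<times> 'f) endo" where
  "ad_rep x = Endo (\<lambda>(v, a). (bracket x v, 0))"

lemma app_ad_scalar: "app (ad_scalar c) (v, a) = (scale c v, c * a)"
  unfolding ad_scalar_def by (subst app_Endo) (auto simp: algebra_simps scale_right_distrib)

lemma app_ad_rep: "app (ad_rep x) (v, a) = (bracket x v, 0)"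
  unfolding ad_rep_def by (subst app_Endo) (auto simp: bracket_add_right)

lemma app_ad_rep_power: "n > 0 \<Longrightarrow> app (ad_rep x ^ n) (v, a) = ((bracket x ^^ n) v, 0)"
proof (induction n)
  case (Suc n)
  then show ?case by (cases "n = 0") (simp_all add: app_ad_rep)
qed simp

lemma restricted_evaluation_ad: "restricted_evaluation scale bracket pmap ad_scalar ad_rep"
proof
  fix a b c :: 'f and x y :: 'l
  show "ad_scalar 1 = 1" by (rule endo_eqI) (auto simp: app_ad_scalar)
  show "ad_scalar (a + b) = ad_scalar a + ad_scalar b"
    by (rule endo_eqI) (auto simp: app_ad_scalar algebra_simps scale_left_distrib)
  show "ad_scalar (a * b) = ad_scalar a * ad_scalar b"
    by (rule endo_eqI) (auto simp: app_ad_scalar)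
  show "ad_scalar a * ad_rep x = ad_rep x * ad_scalar a"
    by (rule endo_eqI) (auto simp: app_ad_scalar app_ad_rep bracket_scale_right)
  show "ad_rep (x + y) = ad_rep x + ad_rep y"
    by (rule endo_eqI) (auto simp: app_ad_rep bracket_add_left)
  show "ad_rep (scale c x) = ad_scalar c * ad_rep x"
    by (rule endo_eqI) (auto simp: app_ad_rep app_ad_scalar bracket_scale_left)
  show "ad_rep (bracket x y) = ad_rep x * ad_rep y - ad_rep y * ad_rep x"
    by (rule endo_eqI) (auto simp: app_ad_rep ad_bracket)
  show "ad_rep (pmap x) = ad_rep x ^ CHAR('f)"
    by (rule endo_eqI) (auto simp: app_ad_rep app_ad_rep_power char_pos pmap_ad)
qed

lemma app_ad_rep_prod:
  "app (prod_list (map ad_rep xs)) (v, 0) = (foldr bracket xs v, 0)"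
  by (induction xs) (simp_all add: app_ad_rep)

text \<open>Carries the vanishing of words in \<open>u(L)\<close> back to iterated brackets in
  \<open>L\<close>; Engel's argument finds its normalizing element this way.\<close>

lemma foldr_bracket_ker:
  assumes "(word xs :: ('l, 'f) free_alg) \<in> ker"
  shows "foldr bracket xs v = 0"
proof -
  interpret ad: restricted_evaluation scale bracket pmap ad_scalar ad_rep
    by (rule restricted_evaluation_ad)
  show ?thesis using ad.eval_ker[OF assms] app_ad_rep_prod[of xs v] by (simp add: zero_prod_def)
qed

section \<open>Powers and words modulo the kernel\<close>

lemma proj_power_cong: "proj a = proj b \<Longrightarrow> proj (a ^ n) = proj (b ^ n)"
  by (induction n) (simp_all add: proj_mult)

lemma gen_power_ker: "gen x ^ (CHAR('f) ^ n) - gen ((pmap ^^ n) x) \<in> ker"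
proof (induction n)
  case (Suc n)
  have "proj (gen x ^ CHAR('f) ^ Suc n) = proj ((gen x ^ CHAR('f) ^ n) ^ CHAR('f))"
    by (simp add: power_mult[symmetric] mult.commute)
  also have "\<dots> = proj (gen ((pmap ^^ n) x) ^ CHAR('f))"
    by (rule proj_power_cong) (use Suc in \<open>simp add: proj_eq_iff\<close>)
  also have "\<dots> = proj (gen (pmap ((pmap ^^ n) x)))"
    using gen_pmap_ker by (simp add: proj_eq_iff)
  finally show ?case by (simp add: proj_eq_iff)
qed simp

lemma gen_zero_ker: "gen 0 \<in> ker"
  using gen_scale_ker[of 0 0] by simp

text \<open>The right ideal of \<open>u(L)\<close> generated by the words of length \<open>m\<close>
  over \<open>S\<close>, pulled back to the free algebra.\<close>

inductive_set word_ideal :: "'l set \<Rightarrow> nat \<Rightarrow> ('l, 'f) free_alg set" for S m where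
  ker: "t \<in> ker \<Longrightarrow> t \<in> word_ideal S m"
| word: "set ss \<subseteq> S \<Longrightarrow> length ss = m \<Longrightarrow> word ss * t \<in> word_ideal S m"
| add: "s \<in> word_ideal S m \<Longrightarrow> t \<in> word_ideal S m \<Longrightarrow> s + t \<in> word_ideal S m"

lemma word_ideal_subset_ker:
  assumes "\<And>ss. set ss \<subseteq> S \<Longrightarrow> length ss = m \<Longrightarrow> word ss \<in> ker" "t \<in> word_ideal S m"
  shows "t \<in> ker"
  using assms(2) by induction (auto intro: assms(1) ker_mult_right ker_add)

lemma word_ideal_gen: "t \<in> word_ideal S m \<Longrightarrow> s \<in> S \<Longrightarrow> gen s * t \<in> word_ideal S (Suc m)"
proof (induction rule: word_ideal.induct)
  case (word ss t)
  then show ?case using word_ideal.word[of "s # ss" S "Suc m" t]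
    by (simp add: word_Cons mult.assoc)
qed (auto intro: word_ideal.ker word_ideal.add ker_mult_left simp: distrib_left)

lemma word_ideal_mono: "t \<in> word_ideal S (Suc m) \<Longrightarrow> t \<in> word_ideal S m"
proof (induction rule: word_ideal.induct)
  case (word ss t)
  then obtain us s where ss: "ss = us @ [s]" by (metis length_Suc_conv_rev)
  then show ?case using word word_ideal.word[of us S m "gen s * t"]
    by (simp add: word_append word_Cons word_Nil mult.assoc)
qed (auto intro: word_ideal.intros)

text \<open>Moving \<open>x\<close> to the right past a letter \<open>s\<close> costs the letter
  \<open>bracket x s\<close>, which is again in \<open>S\<close>, so the number of letters from
  \<open>S\<close> never drops.\<close>

lemma word_ideal_normalizer:
  assumes x: "\<And>s. s \<in> S \<Longrightarrow> bracket x s \<in> S"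
  shows "t \<in> word_ideal S m \<Longrightarrow> gen x * t \<in> word_ideal S m"
proof (induction rule: word_ideal.induct)
  case (word ss t)
  have "gen x * (word ss * t) \<in> word_ideal S (length ss)" if "set ss \<subseteq> S" for ss
    using that
  proof (induction ss)
    case Nil
    then show ?case using word_ideal.word[of "[]" S 0 "gen x * t"] by (simp add: word_Nil)
  next
    case (Cons s ss)
    let ?w = "word ss * t"
    have "gen x * (word (s # ss) * t) = gen s * (gen x * ?w) + word (bracket x s # ss) * t
        + (gen x * gen s - gen s * gen x - gen (bracket x s)) * ?w"
      by (simp add: word_Cons algebra_simps)
    moreover have "gen s * (gen x * ?w) \<in> word_ideal S (length (s # ss))"
      using word_ideal_gen[OF Cons.IH] Cons.prems by simp
    moreover have "word (bracket x s # ss) * t \<in> word_ideal S (length (s # ss))"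
      using Cons.prems x by (intro word_ideal.word) auto
    moreover have "(gen x * gen s - gen s * gen x - gen (bracket x s)) * ?w \<in> word_ideal S (length (s # ss))"
      by (intro word_ideal.ker ker_mult_right gen_bracket_ker)
    ultimately show ?case by (metis word_ideal.add)
  qed
  then show ?case using word by blast
qed (auto intro: word_ideal.ker word_ideal.add ker_mult_left simp: distrib_left)

text \<open>Cut the word into blocks of length \<open>q\<close>. A block is either the vanishing
  power of \<open>x\<close> or contains a letter from \<open>S\<close>, which raises the exponent by
  one; its other letters do not lower it. Thus \<open>m\<close> blocks yield exponent
  \<open>m\<close>.\<close>

lemma word_ideal_insert:
  assumes x: "\<And>s. s \<in> S \<Longrightarrow> bracket x s \<in> S" and q: "gen x ^ q \<in> ker"
  shows "set xs \<subseteq> insert x S \<Longrightarrow> length xs \<ge> m * q \<Longrightarrow> word xs \<in> word_ideal S m"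
proof (induction m arbitrary: xs)
  case 0
  then show ?case using word_ideal.word[of "[]" S 0 "word xs"] by (simp add: word_Nil)
next
  case (Suc m)
  define ys zs where "ys = take q xs" and "zs = drop q xs"
  have xs: "word xs = word ys * word zs" by (simp add: ys_def zs_def flip: word_append)
  have ys: "set ys \<subseteq> insert x S" using Suc.prems(1) set_take_subset[of q xs] by (auto simp: ys_def)
  have len: "length ys = q" using Suc.prems(2) by (simp add: ys_def)
  have zs: "word zs \<in> word_ideal S m"
  proof (rule Suc.IH)
    show "set zs \<subseteq> insert x S" using Suc.prems(1) set_drop_subset[of q xs] by (auto simp: zs_def)
  qed (use Suc.prems(2) in \<open>simp add: zs_def\<close>)
  show ?case
  proof (cases "set ys \<subseteq> {x}")
    case True
    then have "ys = replicate q x" using len by (intro replicate_eqI) auto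
    then show ?thesis using q unfolding xs
      by (intro word_ideal.ker ker_mult_right) (simp add: word_replicate)
  next
    case False
    have weak: "word us * t \<in> word_ideal S k" if "set us \<subseteq> insert x S" "t \<in> word_ideal S k" for us t k
      using that
    proof (induction us)
      case (Cons u us)
      then have "word us * t \<in> word_ideal S k" by simp
      then show ?case using Cons.prems(1) word_ideal_normalizer[OF x] word_ideal_mono[OF word_ideal_gen]
        by (auto simp: word_Cons mult.assoc)
    qed (simp add: word_Nil)
    obtain s where s: "s \<in> set ys" "s \<noteq> x" using False by blast
    then obtain us vs where uv: "ys = us @ s # vs" by (meson split_list)
    have "word us * (gen s * (word vs * word zs)) \<in> word_ideal S (Suc m)"
    proof (intro weak word_ideal_gen zs)
      show "set us \<subseteq> insert x S" "set vs \<subseteq> insert x S" "s \<in> S" using ys s uv by auto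
    qed
    then show ?thesis by (simp add: xs uv word_append word_Cons mult.assoc)
  qed
qed

text \<open>Words are multilinear in their letters modulo \<open>ker\<close>. The letters are
  replaced from left to right: \<open>ys\<close> collects those already in
  \<open>insert x S\<close>, while \<open>zs\<close> is still arbitrary in the span.\<close>

lemma word_span_insert:
  assumes S: "subspace S" and w: "\<And>xs. set xs \<subseteq> insert x S \<Longrightarrow> length xs = k \<Longrightarrow> word xs \<in> ker"
  shows "set xs \<subseteq> span (insert x S) \<Longrightarrow> length xs = k \<Longrightarrow> word xs \<in> ker"
proof -
  have "word (ys @ zs) \<in> ker"
    if "set ys \<subseteq> insert x S" "set zs \<subseteq> span (insert x S)" "length ys + length zs = k" for ys zs
    using that
  proof (induction zs arbitrary: ys)
    case Nil
    then show ?case using w by simp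
  next
    case (Cons z zs)
    have "z \<in> span (insert x S)" using Cons.prems by simp
    then obtain c where c: "z - scale c x \<in> S"
      using S by (auto simp: span_insert span_eq_iff[THEN iffD2])
    let ?s = "z - scale c x"
    have 1: "word ((ys @ [?s]) @ zs) \<in> ker" using Cons.prems c by (intro Cons.IH) auto
    have 2: "word ((ys @ [x]) @ zs) \<in> ker" using Cons.prems by (intro Cons.IH) auto
    have "gen z - (gen ?s + gen (scale c x)) \<in> ker" using gen_add_ker[of ?s "scale c x"] by simp
    then have z: "gen z - (gen ?s + scl c * gen x) \<in> ker"
      using ker_add[OF _ gen_scale_ker[of c x], of "gen z - (gen ?s + gen (scale c x))"]
      by (simp add: algebra_simps)
    have "word (ys @ z # zs) = word ys * (gen z - (gen ?s + scl c * gen x)) * word zs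
      + word ys * gen ?s * word zs + scl c * (word ys * gen x * word zs)"
      using scl_commute[of c "word ys"]
      by (simp add: word_append word_Cons algebra_simps) (simp flip: mult.assoc)
    moreover have "word ys * (gen z - (gen ?s + scl c * gen x)) * word zs \<in> ker"
      by (intro ker_mult_right ker_mult_left z)
    moreover have "word ys * gen ?s * word zs \<in> ker" "scl c * (word ys * gen x * word zs) \<in> ker"
      using 1 2 ker_mult_left by (simp_all add: word_append word_Cons word_Nil mult.assoc)
    ultimately show ?case by (simp only: ker_add)
  qed
  from this[of "[]"] show "set xs \<subseteq> span (insert x S) \<Longrightarrow> length xs = k \<Longrightarrow> word xs \<in> ker" by simp
qed

end

section \<open>Engel's theorem\<close>

locale p_nilpotent_lie_algebra = restricted_lie_algebra scale bracket pmap
  for scale :: "'f::field \<Rightarrow> 'l::ab_group_add \<Rightarrow> 'l" and bracket pmap +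
  fixes Basis
  assumes fin_dim: "finite_dimensional_vector_space scale Basis"
    and nilpotent: p_nilpotent
begin

sublocale finite_dimensional_vector_space scale Basis by (rule fin_dim)

text \<open>In \<open>u(L)\<close> the ordinary power of \<open>x\<close> with exponent
  \<open>p^n\<close> is the \<open>n\<close>-fold p-map of \<open>x\<close>, so p-nilpotency makes
  every generator nilpotent.\<close>

lemma gen_nilpotent: "\<exists>q. gen x ^ q \<in> ker"
proof -
  obtain n where "(pmap ^^ n) x = 0" using nilpotent by (auto simp: p_nilpotent_def)
  then have "gen x ^ (CHAR('f) ^ n) - gen 0 \<in> ker" using gen_power_ker[of x n] by simp
  then have "gen x ^ (CHAR('f) ^ n) \<in> ker" using ker_add[OF _ gen_zero_ker] by fastforce
  then show ?thesis by blast
qed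

lemma dim_span_insert_gt:
  assumes "subspace S" "x \<notin> S"
  shows "dim (span (insert x S)) > dim S"
  using assms by (simp add: dim_insert span_eq_iff[THEN iffD2])

text \<open>By finite dimension there is a subspace with \<open>P\<close> of greatest dimension, and
  it cannot be proper. The rule \<open>ext\<close> may choose the new direction \<open>x\<close>, as
  Engel's argument requires.\<close>

lemma subspace_induct [consumes 1, case_names ext]:
  assumes base: "subspace S\<^sub>0" "P S\<^sub>0"
    and ext: "\<And>S. subspace S \<Longrightarrow> P S \<Longrightarrow> S \<noteq> UNIV \<Longrightarrow> \<exists>x. x \<notin> S \<and> P (span (insert x S))"
  shows "P UNIV"
proof -
  obtain S where S: "subspace S \<and> P S" and max: "\<And>S'. subspace S' \<and> P S' \<Longrightarrow> dim S' \<le> dim S"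
    using ex_has_greatest_nat[of "\<lambda>S. subspace S \<and> P S" S\<^sub>0 dim "Suc dimension"] base
    by (metis dim_subset_UNIV le_imp_less_Suc)
  have "S = UNIV"
  proof (rule ccontr)
    assume "S \<noteq> UNIV"
    then obtain x where x: "x \<notin> S" "P (span (insert x S))" using ext S by blast
    then have "dim (span (insert x S)) \<le> dim S" by (intro max) simp
    then show False using dim_span_insert_gt S x by fastforce
  qed
  then show ?thesis using S by simp
qed

text \<open>Engel's theorem, in Jacobson's form: words over a proper subspace \<open>S\<close> vanish from some
  length on, so some \<open>x \<notin> S\<close> normalizes \<open>S\<close>, and then letters \<open>x\<close> can be moved
  past letters from \<open>S\<close>.\<close>

theorem words_nilpotent: "\<exists>k. \<forall>xs. length xs = k \<longrightarrow> word xs \<in> ker"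
proof -
  let ?P = "\<lambda>S. \<exists>k. \<forall>xs. set xs \<subseteq> S \<and> length xs = k \<longrightarrow> word xs \<in> ker"
  have "?P UNIV"
  proof (rule subspace_induct)
    show "?P {0}"
    proof (intro exI[of _ 1] allI impI, elim conjE)
      fix xs :: "'l list" assume "set xs \<subseteq> {0}" "length xs = 1"
      then have "xs = [0]" by (cases xs) auto
      then show "word xs \<in> ker" using gen_zero_ker by (simp add: gen_def)
    qed
  next
    fix S assume S: "subspace S" "?P S" "S \<noteq> UNIV"
    then obtain k where k: "\<And>xs. set xs \<subseteq> S \<Longrightarrow> length xs = k \<Longrightarrow> word xs \<in> ker" by blast
    obtain y where y: "y \<notin> S" using S(3) by blast
    have short: "length ss < k" if "set ss \<subseteq> S" "foldr bracket ss y \<notin> S" for ss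
    proof (rule ccontr)
      assume "\<not> length ss < k"
      then have "word (take k ss) \<in> ker" using that(1) set_take_subset[of k ss] by (intro k) auto
      then have "foldr bracket (take k ss) (foldr bracket (drop k ss) y) = 0" by (rule foldr_bracket_ker)
      then have "foldr bracket ss y = 0" by (metis append_take_drop_id foldr_append comp_apply)
      then show False using that(2) subspace_0[OF S(1)] by simp
    qed
    \<comment> \<open>Take an iterated bracket of \<open>y\<close> with elements of \<open>S\<close>
      that is still outside \<open>S\<close> and has the greatest length; one more bracket then
      falls into \<open>S\<close>.\<close>
    obtain ss where ss: "set ss \<subseteq> S" "foldr bracket ss y \<notin> S"
      and ss_max: "\<And>ts. set ts \<subseteq> S \<and> foldr bracket ts y \<notin> S \<Longrightarrow> length ts \<le> length ss"
      using ex_has_greatest_nat[of "\<lambda>ss. set ss \<subseteq> S \<and> foldr bracket ss y \<notin> S" "[]" length k] short y by auto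
    define x where "x = foldr bracket ss y"
    have norm: "bracket x s \<in> S" if "s \<in> S" for s
    proof -
      have "bracket s x \<in> S" using ss_max[of "s # ss"] ss(1) that by (auto simp: x_def)
      then show ?thesis using bracket_anticomm[of x s] subspace_neg[OF S(1)] by simp
    qed
    obtain q where q: "gen x ^ q \<in> ker" using gen_nilpotent by blast
    have "word xs \<in> ker" if "set xs \<subseteq> insert x S" "length xs = k * q" for xs
      using word_ideal_subset_ker[OF k, of S] word_ideal_insert[OF norm q that(1), of k] that(2) by simp
    then have "?P (span (insert x S))" using word_span_insert[OF S(1), of x "k * q"] by blast
    then show "\<exists>x. x \<notin> S \<and> ?P (span (insert x S))" using ss(2) x_def by blast
  qed (simp add: subspace_def)
  then show ?thesis by simp
qed

end

section \<open>Powers of a sum in a Heisenberg-like ring\<close>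

text \<open>\<open>ordered_power a b n\<close> is \<open>(a + b)\<^sup>n\<close> expanded with all factors \<open>a\<close> moved to the left
  of all factors \<open>b\<close> as if they commuted.\<close>

fun ordered_power :: "'r::ring_1 \<Rightarrow> 'r \<Rightarrow> nat \<Rightarrow> 'r" where
  "ordered_power a b 0 = 1"
| "ordered_power a b (Suc n) = a * ordered_power a b n + ordered_power a b n * b"

lemma mult_of_nat_left_commute: "a * (of_nat n * b) = of_nat n * (a * b)" for a b :: "'r::ring_1"
  by (metis mult.assoc mult_of_nat_commute)

lemma ordered_power_binomial:
  "ordered_power a b n = (\<Sum>k\<le>n. of_nat (n choose k) * (a ^ k * b ^ (n - k)))"
proof (induction n)
  case (Suc n)
  let ?G = "\<lambda>k. a ^ Suc k * b ^ (n - k)"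
  have 1: "a * ordered_power a b n = (\<Sum>k\<le>n. of_nat (n choose k) * ?G k)"
    unfolding Suc sum_distrib_left mult_of_nat_left_commute power_Suc mult.assoc by (rule refl)
  have "ordered_power a b n * b = (\<Sum>k\<le>n. of_nat (n choose k) * (a ^ k * b ^ (Suc n - k)))"
    unfolding Suc sum_distrib_right
    by (intro sum.cong refl) (simp add: Suc_diff_le mult.assoc power_commutes)
  also have "\<dots> = (\<Sum>k\<le>Suc n. of_nat (n choose k) * (a ^ k * b ^ (Suc n - k)))"
    by (simp add: binomial_eq_0)
  also have "\<dots> = b ^ Suc n + (\<Sum>k\<le>n. of_nat (n choose Suc k) * ?G k)"
    unfolding sum.atMost_Suc_shift by simp
  finally have 2: "ordered_power a b n * b = b ^ Suc n + (\<Sum>k\<le>n. of_nat (n choose Suc k) * ?G k)" .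
  have "(\<Sum>k\<le>Suc n. of_nat (Suc n choose k) * (a ^ k * b ^ (Suc n - k)))
    = b ^ Suc n + (\<Sum>k\<le>n. of_nat ((n choose k) + (n choose Suc k)) * ?G k)"
    unfolding sum.atMost_Suc_shift by (simp del: of_nat_add)
  also have "(\<Sum>k\<le>n. of_nat ((n choose k) + (n choose Suc k)) * ?G k)
    = (\<Sum>k\<le>n. of_nat (n choose k) * ?G k) + (\<Sum>k\<le>n. of_nat (n choose Suc k) * ?G k)"
    by (simp only: of_nat_add distrib_right sum.distrib)
  finally show ?case unfolding ordered_power.simps 1 2 by (simp only: add.left_commute)
qed simp

lemma ordered_power_prime:
  fixes a b :: "'r::ring_1"
  assumes p: "prime p" and char: "of_nat p = (0 :: 'r)"
  shows "ordered_power a b p = a ^ p + b ^ p"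
proof -
  have p0: "p > 0" using p prime_gt_0_nat by blast
  have "of_nat (p choose k) = (0 :: 'r)" if "k \<in> {..p} - {0, p}" for k
  proof -
    have "p dvd (p choose k)" using that by (intro dvd_choose_prime p) auto
    then show ?thesis using char by (auto elim!: dvdE)
  qed
  then have "ordered_power a b p = (\<Sum>k\<in>{0, p}. of_nat (p choose k) * (a ^ k * b ^ (p - k)))"
    unfolding ordered_power_binomial by (intro sum.mono_neutral_right) auto
  then show ?thesis using p0 by simp
qed

text \<open>As \<open>e\<close> commutes with both \<open>a\<close> and \<open>b\<close>, the
  commutator with \<open>b\<close> acts on ordered expressions as \<open>e\<close> times the
  derivative in \<open>a\<close>, and that derivative of the ordered power is \<open>n\<close> times
  the preceding one. For \<open>n = 0\<close> the coefficient hides the truncated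
  \<open>n - 1\<close>.\<close>

lemma mult_ordered_power:
  assumes "b * a = a * b + e" "e * a = a * e" "e * b = b * e"
  shows "(a + b) * ordered_power a b n
    = ordered_power a b (Suc n) + of_nat n * (e * ordered_power a b (n - 1))"
proof -
  let ?N = "ordered_power a b"
  have "b * ?N n = ?N n * b + of_nat n * (e * ?N (n - 1))"
  proof (induction n)
    case (Suc n)
    have shift: "of_nat n * (e * (a * ?N (n - 1))) + of_nat n * (e * (?N (n - 1) * b)) = of_nat n * (e * ?N n)"
      by (cases n) (simp_all add: distrib_left mult.assoc)
    have "b * ?N (Suc n) = b * a * ?N n + b * ?N n * b"
      by (simp add: distrib_left mult.assoc)
    also have "\<dots> = a * (b * ?N n) + e * ?N n + b * ?N n * b"
      by (simp add: assms(1) distrib_right mult.assoc)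
    also have "\<dots> = a * (?N n * b) + of_nat n * (e * (a * ?N (n - 1))) + e * ?N n + ?N n * b * b
       + of_nat n * (e * (?N (n - 1) * b))"
    proof -
      have "a * (of_nat n * (e * ?N (n - 1))) = of_nat n * (e * (a * ?N (n - 1)))"
        unfolding mult_of_nat_left_commute by (metis assms(2) mult.assoc)
      then show ?thesis by (simp add: Suc distrib_left distrib_right mult.assoc)
    qed
    also have "\<dots> = ?N (Suc n) * b + (e * ?N n + of_nat n * (e * ?N n))"
      unfolding shift[symmetric] by (simp add: distrib_right mult.assoc)
    finally show ?case by (simp add: distrib_right)
  qed simp
  then show ?thesis by (simp add: distrib_right)
qed

text \<open>\<open>n! / (2\<^sup>k k! (n - 2k)!)\<close>, the number of ways to choose \<open>k\<close> disjoint pairs among \<open>n\<close> factors.\<close>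

fun pairings :: "nat \<Rightarrow> nat \<Rightarrow> nat" where
  "pairings 0 0 = 1"
| "pairings 0 (Suc k) = 0"
| "pairings (Suc n) 0 = pairings n 0"
| "pairings (Suc n) (Suc k) = pairings n (Suc k) + (n - 2 * k) * pairings n k"

lemma pairings_zero: "2 * k > n \<Longrightarrow> pairings n k = 0"
  by (induction n k rule: pairings.induct) auto

lemma pairings_zero_right [simp]: "pairings n 0 = 1"
  by (induction n) auto

lemma pairings_fact: "2 * k \<le> n \<Longrightarrow> pairings n k * (2 ^ k * fact k * fact (n - 2 * k)) = fact n"
proof (induction n k rule: pairings.induct)
  case (4 n k)
  define m where "m = Suc n - 2 * Suc k"
  have nk: "n - 2 * k = Suc m" using 4(3) by (simp add: m_def)
  have IH2: "pairings n k * (2 ^ k * fact k * fact (n - 2 * k)) = fact n" using 4 by simp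
  have second: "(n - 2 * k) * pairings n k * (2 ^ Suc k * fact (Suc k) * fact (Suc n - 2 * Suc k))
     = 2 * Suc k * fact n"
    unfolding IH2[symmetric] unfolding nk m_def[symmetric] by (simp add: algebra_simps)
  have first: "pairings n (Suc k) * (2 ^ Suc k * fact (Suc k) * fact (Suc n - 2 * Suc k))
     = (Suc n - 2 * Suc k) * fact n"
  proof (cases "2 * Suc k \<le> n")
    case True
    then have "Suc n - 2 * Suc k = Suc (n - 2 * Suc k)" by simp
    then have "pairings n (Suc k) * (2 ^ Suc k * fact (Suc k) * fact (Suc n - 2 * Suc k))
      = (Suc n - 2 * Suc k) * (pairings n (Suc k) * (2 ^ Suc k * fact (Suc k) * fact (n - 2 * Suc k)))"
      by (simp only: fact_Suc of_nat_id ac_simps)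
    also have "\<dots> = (Suc n - 2 * Suc k) * fact n" using 4(1)[OF True] by simp
    finally show ?thesis .
  next
    case False
    then have "pairings n (Suc k) = 0" "Suc n - 2 * Suc k = 0" by (simp_all add: pairings_zero)
    then show ?thesis by (simp only: mult_0)
  qed
  have "pairings (Suc n) (Suc k) * (2 ^ Suc k * fact (Suc k) * fact (Suc n - 2 * Suc k))
    = (Suc n - 2 * Suc k) * fact n + 2 * Suc k * fact n"
    unfolding pairings.simps distrib_right first second by (rule refl)
  also have "\<dots> = (Suc n - 2 * Suc k + 2 * Suc k) * fact n" by (simp only: distrib_right)
  also have "Suc n - 2 * Suc k + 2 * Suc k = Suc n" using 4(3) by simp
  also have "Suc n * fact n = fact (Suc n)" by simp
  finally show ?case .
qed auto

text \<open>A further factor \<open>a + b\<close> either enlarges the ordered power or pairs with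
  one of its \<open>n - 2 * k\<close> factors and leaves an \<open>e\<close>. This is the recursion
  of \<open>pairings\<close>.\<close>

lemma power_add_ordered_power:
  assumes "b * a = a * b + e" "e * a = a * e" "e * b = b * e"
  shows "(a + b) ^ n = (\<Sum>k\<le>n. of_nat (pairings n k) * (e ^ k * ordered_power a b (n - 2 * k)))"
proof (induction n)
  case (Suc n)
  let ?N = "ordered_power a b"
  have eab: "(a + b) * e ^ k = e ^ k * (a + b)" for k
    using assms by (intro power_commuting_commutes[symmetric]) (simp add: algebra_simps)
  have term1: "(a + b) * (of_nat (pairings n k) * (e ^ k * ?N (n - 2 * k)))
     = of_nat (pairings n k) * (e ^ k * ?N (Suc n - 2 * k))
      + of_nat ((n - 2 * k) * pairings n k) * (e ^ Suc k * ?N (Suc n - 2 * Suc k))" for k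
  proof (cases "2 * k \<le> n")
    case True
    have "(a + b) * (of_nat (pairings n k) * (e ^ k * ?N (n - 2 * k)))
       = of_nat (pairings n k) * (e ^ k * ((a + b) * ?N (n - 2 * k)))"
      unfolding mult_of_nat_left_commute by (metis eab mult.assoc)
    also have "(a + b) * ?N (n - 2 * k)
       = ?N (Suc n - 2 * k) + of_nat (n - 2 * k) * (e * ?N (Suc n - 2 * Suc k))"
      using mult_ordered_power[OF assms, of "n - 2 * k"] True by (simp add: Suc_diff_le del: ordered_power.simps)
    also have "e ^ k * (?N (Suc n - 2 * k) + of_nat (n - 2 * k) * (e * ?N (Suc n - 2 * Suc k)))
       = e ^ k * ?N (Suc n - 2 * k) + of_nat (n - 2 * k) * (e ^ Suc k * ?N (Suc n - 2 * Suc k))"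
    proof -
      have "e ^ k * (of_nat (n - 2 * k) * (e * t)) = of_nat (n - 2 * k) * (e ^ Suc k * t)" for t
        unfolding mult_of_nat_left_commute power_Suc2 mult.assoc by (rule refl)
      then show ?thesis by (simp only: distrib_left)
    qed
    also have "of_nat (pairings n k) * (e ^ k * ?N (Suc n - 2 * k)
          + of_nat (n - 2 * k) * (e ^ Suc k * ?N (Suc n - 2 * Suc k)))
        = of_nat (pairings n k) * (e ^ k * ?N (Suc n - 2 * k))
          + of_nat ((n - 2 * k) * pairings n k) * (e ^ Suc k * ?N (Suc n - 2 * Suc k))"
    proof -
      have "of_nat (pairings n k) * (of_nat (n - 2 * k) * t) = of_nat ((n - 2 * k) * pairings n k) * t" for t :: 'a
        by (metis mult.assoc mult.commute of_nat_mult)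
      then show ?thesis by (simp only: distrib_left)
    qed
    finally show ?thesis .
  qed (simp add: pairings_zero)
  have "(a + b) ^ Suc n = (\<Sum>k\<le>n. of_nat (pairings n k) * (e ^ k * ?N (Suc n - 2 * k)))
      + (\<Sum>k\<le>n. of_nat ((n - 2 * k) * pairings n k) * (e ^ Suc k * ?N (Suc n - 2 * Suc k)))"
    unfolding power_Suc Suc sum_distrib_left term1 sum.distrib by (rule refl)
  \<comment> \<open>The upper limit can be raised because \<open>pairings n (Suc n)\<close> is zero;
    afterwards the sum can be shifted.\<close>
  also have "(\<Sum>k\<le>n. of_nat (pairings n k) * (e ^ k * ?N (Suc n - 2 * k)))
    = (\<Sum>k\<le>Suc n. of_nat (pairings n k) * (e ^ k * ?N (Suc n - 2 * k)))"
    by (simp add: pairings_zero)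
  also have "\<dots> = ?N (Suc n) + (\<Sum>k\<le>n. of_nat (pairings n (Suc k)) * (e ^ Suc k * ?N (Suc n - 2 * Suc k)))"
    unfolding sum.atMost_Suc_shift by simp
  also have "?N (Suc n) + (\<Sum>k\<le>n. of_nat (pairings n (Suc k)) * (e ^ Suc k * ?N (Suc n - 2 * Suc k)))
     + (\<Sum>k\<le>n. of_nat ((n - 2 * k) * pairings n k) * (e ^ Suc k * ?N (Suc n - 2 * Suc k)))
     = ?N (Suc n) + (\<Sum>k\<le>n. of_nat (pairings (Suc n) (Suc k)) * (e ^ Suc k * ?N (Suc n - 2 * Suc k)))"
    unfolding pairings.simps of_nat_add distrib_right sum.distrib by (simp only: add.assoc)
  also have "\<dots> = (\<Sum>k\<le>Suc n. of_nat (pairings (Suc n) k) * (e ^ k * ?N (Suc n - 2 * k)))"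
    unfolding sum.atMost_Suc_shift by simp
  finally show ?case .
qed simp

text \<open>In the closed form with factorials, \<open>p\<close> divides the numerator but not the
  denominator. For \<open>p = 2\<close> this breaks down: \<open>pairings 2 1\<close> is one, which
  is why characteristic two keeps a commutator term.\<close>

lemma prime_dvd_pairings:
  assumes "prime p" "p \<noteq> 2" "0 < k" "2 * k \<le> p"
  shows "p dvd pairings p k"
proof -
  have p2: "p > 2" using assms prime_ge_2_nat[of p] by simp
  have "p dvd pairings p k * (2 ^ k * fact k * fact (p - 2 * k))"
    unfolding pairings_fact[OF assms(4)] using assms(1) by (simp add: prime_dvd_fact_iff)
  moreover have "\<not> p dvd 2 ^ k" using assms(1) p2 by (metis nat_dvd_not_less prime_dvd_power pos2)
  moreover have "\<not> p dvd fact k" "\<not> p dvd fact (p - 2 * k)"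
    using assms p2 by (simp_all add: prime_dvd_fact_iff)
  ultimately show ?thesis using assms(1) by (simp add: prime_dvd_mult_iff)
qed

lemma power_add_prime_odd:
  fixes a b :: "'r::ring_1"
  assumes p: "prime p" "p \<noteq> 2" and char: "of_nat p = (0 :: 'r)"
    and e: "b * a = a * b + e" "e * a = a * e" "e * b = b * e"
  shows "(a + b) ^ p = a ^ p + b ^ p"
proof -
  have "of_nat (pairings p k) = (0 :: 'r)" if "k \<in> {..p} - {0}" for k
  proof (cases "2 * k \<le> p")
    case True
    then have "p dvd pairings p k" using that p by (intro prime_dvd_pairings) auto
    then show ?thesis using char by (auto elim!: dvdE)
  qed (simp add: pairings_zero)
  then have "(a + b) ^ p = (\<Sum>k\<in>{0}. of_nat (pairings p k) * (e ^ k * ordered_power a b (p - 2 * k)))"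
    unfolding power_add_ordered_power[OF e] by (intro sum.mono_neutral_right) auto
  then show ?thesis by (simp add: ordered_power_prime[OF p(1) char])
qed

lemma power_add_prime_commuting:
  fixes a b :: "'r::ring_1"
  assumes p: "prime p" and char: "of_nat p = (0 :: 'r)" and ab: "a * b = b * a"
  shows "(a + b) ^ p = a ^ p + b ^ p"
proof -
  have "(a + b) ^ n = ordered_power a b n" for n
    using mult_ordered_power[of b a 0] ab by (induction n) auto
  then show ?thesis by (simp add: ordered_power_prime[OF p char])
qed

section \<open>Truncated polynomials over a representation\<close>

text \<open>
  A sequence over \<open>F\<close> encodes \<open>p\<close> sequences, its slices, by the remainder of the index modulo \<open>p\<close>.
  With the slices as coefficients, it stands for \<open>\<Sum>\<^sub>k X\<^sup>k v\<^sub>k\<close> subject to \<open>X\<^sup>p = c\<close>; then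
  \<open>slice_shift c\<close> is multiplication by \<open>X\<close>, \<open>slice_deriv\<close> the derivative with respect to \<open>X\<close>.
\<close>

definition slice :: "nat \<Rightarrow> (nat \<Rightarrow> 'f::field) \<Rightarrow> nat \<Rightarrow> 'f" where
  "slice k f = (\<lambda>q. f (q * CHAR('f) + k))"

definition slicewise :: "(nat \<Rightarrow> 'f::field) endo \<Rightarrow> (nat \<Rightarrow> 'f) endo" where
  "slicewise A = Endo (\<lambda>f n. app A (slice (n mod CHAR('f)) f) (n div CHAR('f)))"

text \<open>At the last index of a block, \<open>f (Suc n)\<close> already belongs to the next
  block, but its factor is then \<open>p\<close>, which is zero in the field. So no case distinction
  is required.\<close>

definition slice_deriv :: "(nat \<Rightarrow> 'f::field) endo" where
  "slice_deriv = Endo (\<lambda>f n. of_nat (Suc (n mod CHAR('f))) * f (Suc n))"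

definition slice_shift :: "(nat \<Rightarrow> 'f::field) endo \<Rightarrow> (nat \<Rightarrow> 'f) endo" where
  "slice_shift c = Endo (\<lambda>f n. if n mod CHAR('f) = 0 then app c (slice (CHAR('f) - 1) f) (n div CHAR('f))
     else f (n - 1))"

definition seq_scalar :: "'f::field \<Rightarrow> (nat \<Rightarrow> 'f) endo" where
  "seq_scalar a = Endo (\<lambda>f n. a * f n)"

lemma slice_add [simp]: "slice k (f + g) = slice k f + slice k g"
  by (simp add: slice_def fun_eq_iff)

lemma slice_zero [simp]: "slice k 0 = 0"
  by (simp add: slice_def fun_eq_iff)

lemma slice_minus [simp]: "slice k (f - g) = slice k f - slice k g"
  by (simp add: slice_def fun_eq_iff)

lemma app_seq_scalar [simp]: "app (seq_scalar a) f = (\<lambda>n. a * f n)"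
  unfolding seq_scalar_def by (subst app_Endo) (auto simp: fun_eq_iff algebra_simps)

lemma slice_seq_scalar: "slice k (app (seq_scalar a) f) = app (seq_scalar a) (slice k f)"
  by (simp add: slice_def)

lemma seq_scalar_zero [simp]: "seq_scalar 0 = 0"
  by (rule endo_eqI) (simp add: fun_eq_iff)

lemma seq_scalar_one [simp]: "seq_scalar 1 = 1"
  by (rule endo_eqI) simp

lemma seq_scalar_add: "seq_scalar (a + b) = seq_scalar a + seq_scalar b"
  by (rule endo_eqI) (simp add: fun_eq_iff algebra_simps)

lemma seq_scalar_mult: "seq_scalar (a * b) = seq_scalar a * seq_scalar b"
  by (rule endo_eqI) (simp add: fun_eq_iff algebra_simps)

lemma seq_scalar_power: "seq_scalar (a ^ n) = seq_scalar a ^ n"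
  by (induction n) (simp_all add: seq_scalar_mult)

lemma seq_scalar_of_nat: "seq_scalar (of_nat n) = of_nat n"
  by (induction n) (simp_all add: seq_scalar_add)

lemma app_of_nat: "app (of_nat n) f = (\<lambda>i. of_nat n * f i)" for f :: "nat \<Rightarrow> 'f::field"
  using app_seq_scalar[of "of_nat n" f] by (simp only: seq_scalar_of_nat)

lemma of_nat_CHAR_endo: "of_nat CHAR('f) = (0 :: (nat \<Rightarrow> 'f::field) endo)"
  by (metis of_nat_CHAR seq_scalar_of_nat seq_scalar_zero)

context
  assumes char_pos: "CHAR('f::field) > 0"
begin

lemma slices_eqI:
  fixes f g :: "nat \<Rightarrow> 'f"
  assumes "\<And>k. k < CHAR('f) \<Longrightarrow> slice k f = slice k g"
  shows "f = g"
proof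
  fix n
  have "slice (n mod CHAR('f)) f (n div CHAR('f)) = slice (n mod CHAR('f)) g (n div CHAR('f))"
    using assms char_pos by simp
  then show "f n = g n" by (simp add: slice_def)
qed

lemma slice_slicewise:
  fixes f :: "nat \<Rightarrow> 'f"
  assumes "k < CHAR('f)"
  shows "slice k (app (slicewise A) f) = app A (slice k f)"
  using assms char_pos unfolding slicewise_def
  by (subst app_Endo) (auto simp: fun_eq_iff slice_def[where k = k])

lemma slice_slice_deriv:
  fixes f :: "nat \<Rightarrow> 'f"
  assumes "k < CHAR('f)"
  shows "slice k (app slice_deriv f) = app (of_nat (Suc k)) (slice (Suc k) f)"
  using assms unfolding slice_deriv_def
  by (subst app_Endo) (auto simp: fun_eq_iff slice_def app_of_nat distrib_left simp del: of_nat_Suc)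

lemma slice_slice_deriv_last:
  fixes f :: "nat \<Rightarrow> 'f"
  shows "slice (CHAR('f) - 1) (app slice_deriv f) = 0"
  using slice_slice_deriv[of "CHAR('f) - 1" f] char_pos by (simp add: of_nat_CHAR_endo del: of_nat_Suc)

lemma slice_slice_shift:
  fixes f :: "nat \<Rightarrow> 'f"
  assumes "k < CHAR('f)"
  shows "slice k (app (slice_shift c) f) =
    (if k = 0 then app c (slice (CHAR('f) - 1) f) else slice (k - 1) f)"
proof -
  have "app (slice_shift c) f n = (if n mod CHAR('f) = 0 then app c (slice (CHAR('f) - 1) f) (n div CHAR('f))
     else f (n - 1))" for n
    unfolding slice_shift_def by (subst app_Endo) (simp_all add: fun_eq_iff)
  note app = this
  have *: "(q * CHAR('f) + k) mod CHAR('f) = k" "(q * CHAR('f) + k) div CHAR('f) = q" for q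
    using assms by simp_all
  show ?thesis
  proof (rule ext)
    fix q
    have 1: "slice k (app (slice_shift c) f) q
      = (if k = 0 then app c (slice (CHAR('f) - 1) f) q else f (q * CHAR('f) + k - 1))"
      unfolding slice_def[of k] app * by (rule refl)
    show "slice k (app (slice_shift c) f) q
      = (if k = 0 then app c (slice (CHAR('f) - 1) f) else slice (k - 1) f) q"
    proof (cases "k = 0")
      case False
      then have "q * CHAR('f) + k - 1 = q * CHAR('f) + (k - 1)" by linarith
      then have "f (q * CHAR('f) + k - 1) = slice (k - 1) f q" unfolding slice_def by (simp only:)
      then show ?thesis using 1 False by (simp only: if_False)
    next
      case True
      with 1 show ?thesis by (simp only: if_True simp_thms)
    qed
  qed
qed

lemmas slice_ops = slice_slicewise slice_slice_deriv slice_slice_shift slice_seq_scalar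

lemma endo_slices_eqI:
  fixes A B :: "(nat \<Rightarrow> 'f) endo"
  assumes "\<And>k f. k < CHAR('f) \<Longrightarrow> slice k (app A f) = slice k (app B f)"
  shows "A = B"
  by (rule endo_eqI, rule slices_eqI, rule assms)

lemma slicewise_ring_hom:
  fixes A B :: "(nat \<Rightarrow> 'f) endo"
  shows "slicewise (A + B) = slicewise A + slicewise B"
    "slicewise (A - B) = slicewise A - slicewise B"
    "slicewise (A * B) = slicewise A * slicewise B"
    "slicewise 0 = (0 :: (nat \<Rightarrow> 'f) endo)"
    "slicewise 1 = (1 :: (nat \<Rightarrow> 'f) endo)"
    "slicewise (seq_scalar a) = (seq_scalar a :: (nat \<Rightarrow> 'f) endo)"
  by (rule endo_slices_eqI; simp add: slice_ops del: app_seq_scalar)+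

lemma slicewise_power: "slicewise (A ^ n) = slicewise (A :: (nat \<Rightarrow> 'f) endo) ^ n"
  by (induction n) (simp_all add: slicewise_ring_hom)

lemma slice_deriv_slicewise:
  "slice_deriv * slicewise A = slicewise (A :: (nat \<Rightarrow> 'f) endo) * slice_deriv"
proof (rule endo_slices_eqI)
  fix k and f :: "nat \<Rightarrow> 'f" assume k: "k < CHAR('f)"
  show "slice k (app (slice_deriv * slicewise A) f) = slice k (app (slicewise A * slice_deriv) f)"
  proof (cases "Suc k < CHAR('f)")
    case True
    have "app (of_nat (Suc k) * A) (slice (Suc k) f) = app (A * of_nat (Suc k)) (slice (Suc k) f)"
      by (simp only: mult_of_nat_commute)
    with True k show ?thesis by (simp add: slice_ops del: of_nat_Suc)
  next
    case False
    then have "k = CHAR('f) - 1" using k by simp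
    then show ?thesis using k slice_slice_deriv_last by (simp add: slice_slicewise)
  qed
qed

lemma slice_deriv_scalar: "slice_deriv * seq_scalar (a :: 'f) = seq_scalar a * slice_deriv"
  using slice_deriv_slicewise[of "seq_scalar a"] by (simp only: slicewise_ring_hom)

text \<open>The coefficient at slice \<open>k\<close> after \<open>j\<close> derivatives is the
  product of the numbers from \<open>k + 1\<close> to \<open>k + j\<close>, which contains the
  factor \<open>p\<close> as soon as \<open>k + j\<close> reaches \<open>p\<close>.\<close>

lemma slice_deriv_power_CHAR: "slice_deriv ^ CHAR('f) = (0 :: (nat \<Rightarrow> 'f) endo)"
proof -
  have "slice k (app (slice_deriv ^ j) f) = 0" if "k < CHAR('f)" "k + j \<ge> CHAR('f)" for j k and f :: "nat \<Rightarrow> 'f"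
    using that
  proof (induction j arbitrary: k)
    case (Suc j)
    show ?case
    proof (cases "Suc k < CHAR('f)")
      case True
      then show ?thesis using Suc by (simp add: slice_slice_deriv app_of_nat fun_eq_iff del: of_nat_Suc)
    next
      case False
      then have "k = CHAR('f) - 1" using Suc by simp
      then show ?thesis using slice_slice_deriv_last by simp
    qed
  qed simp
  then show ?thesis by (intro endo_slices_eqI) simp
qed

lemma slice_shift_power_CHAR: "slice_shift c ^ CHAR('f) = slicewise (c :: (nat \<Rightarrow> 'f) endo)"
proof -
  have "slice k (app (slice_shift c ^ j) f) =
      (if j \<le> k then slice (k - j) f else app c (slice (k + CHAR('f) - j) f))"
    if "k < CHAR('f)" "j \<le> CHAR('f)" for j k and f :: "nat \<Rightarrow> 'f"
    using that
  proof (induction j arbitrary: k)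
    case (Suc j)
    show ?case
    proof (cases k)
      case 0
      moreover have "j \<le> CHAR('f) - Suc 0" using Suc.prems by simp
      ultimately show ?thesis using Suc by (simp add: slice_slice_shift)
    next
      case (Suc k')
      then show ?thesis using Suc.prems Suc.IH[of k'] by (simp add: slice_slice_shift)
    qed
  qed simp
  then show ?thesis by (intro endo_slices_eqI) (simp add: slice_slicewise)
qed

lemma slice_shift_slicewise:
  fixes A c :: "(nat \<Rightarrow> 'f) endo"
  assumes "A * c = c * A"
  shows "slicewise A * slice_shift c = slice_shift c * slicewise A"
proof -
  have "app A (app c f) = app c (app A f)" for f using assms by (metis app_ring(6))
  then show ?thesis using char_pos by (intro endo_slices_eqI) (simp add: slice_ops)
qed

text \<open>The Weyl relation survives the rule \<open>X^p = c\<close>, because the derivative of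
  \<open>X^p\<close> has the factor \<open>p\<close> and is zero, just like that of the coefficient
  \<open>c\<close>.\<close>

lemma slice_deriv_shift:
  fixes c :: "(nat \<Rightarrow> 'f) endo"
  shows "slice_deriv * slice_shift c = slice_shift c * slice_deriv + 1"
proof (rule endo_slices_eqI)
  fix k and f :: "nat \<Rightarrow> 'f" assume k: "k < CHAR('f)"
  have *: "slice k (app (slice_deriv * slice_shift c) f) = app (of_nat (Suc k)) (slice k f)"
  proof (cases "Suc k < CHAR('f)")
    case True
    then show ?thesis using k by (simp add: slice_ops del: of_nat_Suc)
  next
    case False
    then have "Suc k = CHAR('f)" "k = CHAR('f) - 1" using k by simp_all
    then show ?thesis using slice_slice_deriv_last by (simp add: of_nat_CHAR_endo del: of_nat_Suc)
  qed
  show "slice k (app (slice_deriv * slice_shift c) f) = slice k (app (slice_shift c * slice_deriv + 1) f)"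
    unfolding * using k
    by (cases k) (simp_all add: slice_slice_shift slice_slice_deriv slice_slice_deriv_last of_nat_CHAR_endo add.commute)
qed

text \<open>Test on constant polynomials, here \<open>emb v\<close>: the derivative kills them,
  \<open>A\<close> acts in slice 0 and \<open>X\<close> moves them to slice 1. These slices are
  different because the characteristic is at least 2.\<close>

lemma slice_faithful:
  fixes A B c :: "(nat \<Rightarrow> 'f) endo"
  assumes p: "CHAR('f) \<ge> 2"
    and zero: "seq_scalar a * slice_shift c + slicewise A + slicewise B * slice_deriv = 0"
  shows "A = 0 \<and> a = 0"
proof -
  define emb :: "(nat \<Rightarrow> 'f) \<Rightarrow> nat \<Rightarrow> 'f" where
    "emb v = (\<lambda>n. if n mod CHAR('f) = 0 then v (n div CHAR('f)) else 0)" for v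
  have emb: "slice k (emb v) = (if k = 0 then v else 0)" if "k < CHAR('f)" for k v
    using that char_pos by (auto simp: slice_def emb_def fun_eq_iff)
  have der: "slice k (app slice_deriv (emb v)) = 0" if "k < CHAR('f)" for k v
  proof (cases "Suc k < CHAR('f)")
    case True
    then show ?thesis using that by (simp add: slice_slice_deriv emb)
  next
    case False
    then have "k = CHAR('f) - 1" using that by simp
    then show ?thesis using slice_slice_deriv_last by simp
  qed
  have eq: "app (seq_scalar a) (slice k (app (slice_shift c) (emb v))) + app A (slice k (emb v)) = 0"
    if "k < CHAR('f)" for k v
  proof -
    have "slice k (app (seq_scalar a * slice_shift c + slicewise A + slicewise B * slice_deriv) (emb v)) = 0"
      unfolding zero by simp
    then show ?thesis using that by (simp add: slice_slicewise slice_seq_scalar der del: app_seq_scalar)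
  qed
  have "app A v = 0" for v
    using eq[of 0 v] p by (simp add: slice_slice_shift emb fun_eq_iff)
  moreover have "a * v n = 0" for v :: "nat \<Rightarrow> 'f" and n
    using eq[of 1 v] p by (auto simp: slice_slice_shift emb fun_eq_iff)
  from this[of "\<lambda>_. 1"] have "a = 0" by simp
  ultimately show ?thesis by (simp add: endo_eqI)
qed

end

section \<open>A faithful representation in nilpotency class two\<close>

lemma power_mult_commuting: "x * y = y * x \<Longrightarrow> (x * y) ^ n = x ^ n * y ^ n" for x y :: "'r::monoid_mult"
proof (induction n)
  case (Suc n)
  have "y * x ^ n = x ^ n * y" using Suc.prems by (intro power_commuting_commutes[symmetric]) simp
  then have "x * (y * (x ^ n * y ^ n)) = x * (x ^ n * (y * y ^ n))" by (metis mult.assoc)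
  moreover have "(x * y) ^ Suc n = (x * y) * (x ^ n * y ^ n)"
    using Suc.IH[OF Suc.prems] by (simp only: power_Suc)
  ultimately show ?case by (simp only: power_Suc mult.assoc)
qed simp

lemma mult_left_commute_of: "u * v = v * u \<Longrightarrow> u * (v * t) = v * (u * t)" for u v t :: "'r::semigroup_mult"
  by (metis mult.assoc)

text \<open>In the application \<open>a\<close> and \<open>a'\<close> are scalars, \<open>A\<close>
  and \<open>A'\<close> come from elements of the subalgebra, \<open>B\<close> and \<open>B'\<close>
  from their brackets with the new element. By class two the only commutators left are that of
  \<open>A\<close> with \<open>A'\<close> and that of \<open>d\<close> with
  \<open>X\<close>.\<close>

lemma weyl_commutator:
  fixes a a' X A A' B B' d :: "'r::ring_1"
  assumes a: "X * a = a * X" "A' * a = a * A'" "B' * a = a * B'" "d * a = a * d" "a' * a = a * a'"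
    and a': "X * a' = a' * X" "A * a' = a' * A" "B * a' = a' * B" "d * a' = a' * d"
    and X: "X * A = A * X" "X * A' = A' * X" "X * B = B * X" "X * B' = B' * X"
    and d: "d * A = A * d" "d * A' = A' * d" "d * B = B * d" "d * B' = B' * d"
    and B: "A * B' = B' * A" "A' * B = B * A'" "B' * B = B * B'"
    and weyl: "d * X = X * d + 1"
  shows "(a * X + A + B * d) * (a' * X + A' + B' * d) - (a' * X + A' + B' * d) * (a * X + A + B * d)
     = (A * A' - A' * A) + a' * B - a * B'"
proof -
  note comm = a a' X d B
  have weyl': "d * (X * t) = X * (d * t) + t" for t
    using weyl by (metis distrib_right mult.assoc mult_1_left)
  show ?thesis
    by (simp add: distrib_left distrib_right mult.assoc comm comm[THEN mult_left_commute_of] weyl weyl')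
qed

section \<open>Induction from a restricted ideal of codimension one\<close>

context lie_algebra
begin

lemma ad_linear_const:
  assumes "\<And>x. bracket x 0 = 0"
  shows "ad_linear x y [:v:] = [:bracket y v, bracket x v:]"
  using assms by (simp add: ad_linear_def map_poly_pCons)

end

text \<open>The assumptions on \<open>x\<close> make \<open>S\<close> a restricted ideal of
  codimension one in \<open>span (insert x S)\<close>, and the faithful representation of
  \<open>S\<close> is to be extended to that span.\<close>

locale class_two_extension = restricted_lie_algebra scale bracket pmap
  for scale :: "'f::field \<Rightarrow> 'l::ab_group_add \<Rightarrow> 'l" and bracket pmap +
  fixes S :: "'l set" and \<rho> :: "'l \<Rightarrow> (nat \<Rightarrow> 'f) endo" and x :: 'l
  assumes class_two: "bracket (bracket u v) w = 0"
    and S: "restricted_subalgebra S"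
    and rho_add: "u \<in> S \<Longrightarrow> v \<in> S \<Longrightarrow> \<rho> (u + v) = \<rho> u + \<rho> v"
    and rho_scale: "u \<in> S \<Longrightarrow> \<rho> (scale a u) = seq_scalar a * \<rho> u"
    and rho_scalar: "u \<in> S \<Longrightarrow> seq_scalar a * \<rho> u = \<rho> u * seq_scalar a"
    and rho_bracket: "u \<in> S \<Longrightarrow> v \<in> S \<Longrightarrow> \<rho> (bracket u v) = \<rho> u * \<rho> v - \<rho> v * \<rho> u"
    and rho_pmap: "u \<in> S \<Longrightarrow> \<rho> (pmap u) = \<rho> u ^ CHAR('f)"
    and rho_faithful: "u \<in> S \<Longrightarrow> \<rho> u = 0 \<Longrightarrow> u = 0"
    and x_notin: "x \<notin> S"
    and x_bracket: "s \<in> S \<Longrightarrow> bracket s x \<in> S"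
    and x_pmap: "pmap x \<in> S"
begin

lemma class_two': "bracket w (bracket u v) = 0"
  using bracket_anticomm[of w "bracket u v"] class_two by simp

lemma prime_CHAR: "prime CHAR('f)"
  using prime_CHAR_semidom char_pos by blast

lemma pmap_central: "bracket (pmap u) v = 0"
proof -
  obtain n where n: "CHAR('f) = Suc (Suc n)"
    using prime_ge_2_nat[OF prime_CHAR] by (metis add_2_eq_Suc le_Suc_ex)
  show ?thesis unfolding pmap_ad n by (simp add: class_two')
qed

lemma S_subspace: "subspace S"
  and S_bracket: "u \<in> S \<Longrightarrow> v \<in> S \<Longrightarrow> bracket u v \<in> S"
  and S_pmap: "u \<in> S \<Longrightarrow> pmap u \<in> S"
  using S by (auto simp: restricted_subalgebra_def)

lemmas S_closed = subspace_0[OF S_subspace] subspace_add[OF S_subspace]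
  subspace_scale[OF S_subspace] subspace_diff[OF S_subspace] S_bracket S_pmap x_bracket x_pmap

lemma rho_zero [simp]: "\<rho> 0 = 0"
  using rho_scale[of 0 0] S_closed(1) by simp

lemma rho_diff: "u \<in> S \<Longrightarrow> v \<in> S \<Longrightarrow> \<rho> (u - v) = \<rho> u - \<rho> v"
  using rho_add[of "u - v" v] S_closed(4)[of u v] by simp

lemma rho_commute: "u \<in> S \<Longrightarrow> v \<in> S \<Longrightarrow> bracket u v = 0 \<Longrightarrow> \<rho> u * \<rho> v = \<rho> v * \<rho> u"
  using rho_bracket[of u v] by simp

text \<open>In Jacobson's formula the first application of \<open>ad (t u + v)\<close> to
  \<open>u\<close> gives \<open>bracket v u\<close>, and a second one gives zero by class two. Since
  \<open>p - 1\<close> applications occur, a term remains only for \<open>p = 2\<close>.\<close>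

lemma pmap_add_class_two:
  "pmap (u + v) = pmap u + pmap v + (if CHAR('f) = 2 then bracket v u else 0)"
proof -
  have 1: "ad_linear u v [:u:] = [:bracket v u:]"
    by (simp add: ad_linear_const bracket_self)
  have 2: "ad_linear u v [:bracket v u:] = 0"
    by (simp add: ad_linear_const class_two')
  have 0: "(ad_linear u v ^^ n) 0 = 0" for n
    by (induction n) (simp_all add: ad_linear_def)
  have "jacobson_s i u v = 0" if "CHAR('f) \<noteq> 2" for i
  proof -
    have "CHAR('f) \<ge> 3" using that prime_ge_2_nat[OF prime_CHAR] by linarith
    then obtain n where n: "CHAR('f) - 1 = n + 2" using that[of "CHAR('f) - 3"] by simp
    have "(ad_linear u v ^^ (n + 2)) [:u:] = (ad_linear u v ^^ n) (ad_linear u v (ad_linear u v [:u:]))"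
      unfolding funpow_add numeral_2_eq_2 by simp
    then show ?thesis by (simp only: jacobson_s_def n 1 2 0) simp
  qed
  moreover have "jacobson_s 1 u v = bracket v u" if "CHAR('f) = 2"
    using 1 that by (simp add: jacobson_s_def)
  moreover have "{1..<2} = {1 :: nat}" by auto
  ultimately show ?thesis by (auto simp: pmap_add simp del: One_nat_def)
qed

definition coef :: "'l \<Rightarrow> 'f" where
  "coef y = (SOME a. y - scale a x \<in> S)"

definition part :: "'l \<Rightarrow> 'l" where
  "part y = y - scale (coef y) x"

abbreviation S' :: "'l set" where "S' \<equiv> span (insert x S)"

lemma coef_eqI:
  assumes "y - scale a x \<in> S"
  shows "coef y = a"
proof (rule ccontr)
  let ?b = "coef y"
  assume ne: "?b \<noteq> a"
  have "y - scale ?b x \<in> S" unfolding coef_def using assms by (rule someI)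
  then have "(y - scale ?b x) - (y - scale a x) \<in> S" using assms by (rule S_closed(4))
  moreover have "(y - scale ?b x) - (y - scale a x) = scale (a - ?b) x"
    by (simp add: scale_left_diff_distrib)
  ultimately have "scale (a - ?b) x \<in> S" by metis
  then have "scale (inverse (a - ?b)) (scale (a - ?b) x) \<in> S" by (rule S_closed(3))
  moreover have "scale (inverse (a - ?b)) (scale (a - ?b) x) = x"
    unfolding scale_scale using ne by simp
  ultimately show False using x_notin by metis
qed

lemma coef_partI:
  assumes "s \<in> S" "y = scale a x + s"
  shows "coef y = a" "part y = s"
proof -
  show "coef y = a" using assms by (intro coef_eqI) simp
  then show "part y = s" using assms by (simp add: part_def)
qed

lemma part_closed: "y \<in> S' \<Longrightarrow> part y \<in> S"
proof -
  assume "y \<in> S'"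
  then obtain a where "y - scale a x \<in> S"
    by (auto simp: span_insert span_eq_iff[THEN iffD2, OF S_subspace])
  then show "part y \<in> S" using coef_eqI[of y a] by (simp add: part_def)
qed

lemma decompose: "y = scale (coef y) x + part y"
  by (simp add: part_def)

lemma coef_part_S: "s \<in> S \<Longrightarrow> coef s = 0" "s \<in> S \<Longrightarrow> part s = s"
  using coef_partI[of s s 0] by simp_all

lemma coef_part_add:
  assumes "y \<in> S'" "z \<in> S'"
  shows "coef (y + z) = coef y + coef z" "part (y + z) = part y + part z"
proof -
  have "part y + part z \<in> S" using assms part_closed S_closed(2) by blast
  moreover have "y + z = scale (coef y + coef z) x + (part y + part z)"
    by (simp add: part_def scale_left_distrib)
  ultimately show "coef (y + z) = coef y + coef z" "part (y + z) = part y + part z"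
    using coef_partI by blast+
qed

lemma coef_part_scale:
  assumes "y \<in> S'"
  shows "coef (scale a y) = a * coef y" "part (scale a y) = scale a (part y)"
proof -
  have "scale a (part y) \<in> S" using assms part_closed S_closed(3) by blast
  moreover have "scale a y = scale (a * coef y) x + scale a (part y)"
    using decompose[of y] by (metis scale_right_distrib scale_scale)
  ultimately show "coef (scale a y) = a * coef y" "part (scale a y) = scale a (part y)"
    using coef_partI by blast+
qed

lemma bracket_decompose:
  "bracket y z = bracket (part y) (part z)
     + (scale (coef z) (bracket (part y) x) - scale (coef y) (bracket (part z) x))"
proof -
  have *: "bracket (scale a x + u) (scale b x + v)
      = bracket u v + (scale b (bracket u x) - scale a (bracket v x))" for a b u v
  proof -
    have "bracket (scale a x + u) (scale b x + v) = scale a (bracket x v) + (scale b (bracket u x) + bracket u v)"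
      by (simp add: bracket_add_left bracket_add_right bracket_scale_left bracket_scale_right bracket_self)
    also have "bracket x v = - bracket v x" by (rule bracket_anticomm)
    finally show ?thesis by simp
  qed
  show ?thesis using *[of "coef y" "part y" "coef z" "part z"] by (simp only: decompose[symmetric])
qed

lemma bracket_S'_closed:
  assumes "y \<in> S'" "z \<in> S'"
  shows "bracket y z \<in> S"
  unfolding bracket_decompose[of y z] using assms part_closed by (simp add: S_closed)

lemma pmap_decompose:
  "pmap y = scale (coef y ^ CHAR('f)) (pmap x) + pmap (part y)
    + (if CHAR('f) = 2 then scale (coef y) (bracket (part y) x) else 0)"
proof -
  have "pmap y = pmap (scale (coef y) x + part y)" by (simp add: part_def)
  then show ?thesis by (simp add: pmap_add_class_two pmap_scale bracket_scale_right)
qed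

lemma pmap_S'_closed: "y \<in> S' \<Longrightarrow> pmap y \<in> S"
  unfolding pmap_decompose[of y] using part_closed by (simp add: S_closed)

lemma S_subset: "S \<subseteq> S'"
  using span_superset by blast

lemma restricted_subalgebra_S': "restricted_subalgebra S'"
  unfolding restricted_subalgebra_def
  using bracket_S'_closed pmap_S'_closed S_subset by (auto simp: subspace_span)

abbreviation X :: "(nat \<Rightarrow> 'f) endo" where "X \<equiv> slice_shift (\<rho> (pmap x))"
abbreviation d :: "(nat \<Rightarrow> 'f) endo" where "d \<equiv> slice_deriv"
abbreviation \<sigma> :: "'f \<Rightarrow> (nat \<Rightarrow> 'f) endo" where "\<sigma> \<equiv> seq_scalar"
abbreviation \<Delta> :: "'l \<Rightarrow> (nat \<Rightarrow> 'f) endo" where "\<Delta> u \<equiv> slicewise (\<rho> u)"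

text \<open>This is the induced module. By class two,
  \<open>s X^k = X^k s + k X^(k-1) [s, x]\<close> for \<open>s\<close> in \<open>S\<close>, which
  explains the derivative with coefficient \<open>bracket s x\<close>; the element \<open>x\<close>
  multiplies by \<open>X\<close>, subject to \<open>X^p = pmap x\<close>.\<close>

definition act :: "'l \<Rightarrow> (nat \<Rightarrow> 'f) endo" where
  "act y = \<sigma> (coef y) * X + \<Delta> (part y) + \<Delta> (bracket (part y) x) * d"

lemmas slicewise_hom = slicewise_ring_hom[OF char_pos]

lemma commute_rules:
  shows "X * \<sigma> a = \<sigma> a * X" "d * \<sigma> a = \<sigma> a * d" "\<sigma> a * \<sigma> b = \<sigma> b * \<sigma> a"
    and "u \<in> S \<Longrightarrow> \<Delta> u * \<sigma> a = \<sigma> a * \<Delta> u"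
    and "u \<in> S \<Longrightarrow> X * \<Delta> u = \<Delta> u * X"
    and "d * \<Delta> u = \<Delta> u * d"
    and "u \<in> S \<Longrightarrow> v \<in> S \<Longrightarrow> bracket u v = 0 \<Longrightarrow> \<Delta> u * \<Delta> v = \<Delta> v * \<Delta> u"
proof -
  show "X * \<sigma> a = \<sigma> a * X"
    using slice_shift_slicewise[OF char_pos rho_scalar[OF x_pmap, of a]] by (simp only: slicewise_hom)
  show "d * \<sigma> a = \<sigma> a * d" by (rule slice_deriv_scalar[OF char_pos])
  show "\<sigma> a * \<sigma> b = \<sigma> b * \<sigma> a" by (simp add: mult.commute flip: seq_scalar_mult)
  show "u \<in> S \<Longrightarrow> \<Delta> u * \<sigma> a = \<sigma> a * \<Delta> u"
    using arg_cong[OF rho_scalar[of u a], of slicewise] by (simp only: slicewise_hom)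
  \<comment> \<open>The wrap-around in \<open>X\<close> applies \<open>\<rho> (pmap x)\<close>, so
    \<open>\<rho> u\<close> has to commute with it; it does because \<open>pmap x\<close> is
    central.\<close>
  show "u \<in> S \<Longrightarrow> X * \<Delta> u = \<Delta> u * X"
    using slice_shift_slicewise[OF char_pos rho_commute[OF _ x_pmap]]
      bracket_anticomm[of u "pmap x"] pmap_central by simp
  show "d * \<Delta> u = \<Delta> u * d" by (rule slice_deriv_slicewise[OF char_pos])
  show "u \<in> S \<Longrightarrow> v \<in> S \<Longrightarrow> bracket u v = 0 \<Longrightarrow> \<Delta> u * \<Delta> v = \<Delta> v * \<Delta> u"
    using arg_cong[OF rho_commute[of u v], of slicewise] by (simp only: slicewise_hom)
qed

lemma act_S: "s \<in> S \<Longrightarrow> act s = \<Delta> s + \<Delta> (bracket s x) * d"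
  by (simp add: act_def coef_part_S)

lemma act_add:
  assumes "y \<in> S'" "z \<in> S'"
  shows "act (y + z) = act y + act z"
  using assms part_closed S_closed
  by (simp add: act_def coef_part_add seq_scalar_add rho_add bracket_add_left slicewise_hom distrib_right)

lemma act_scale:
  assumes "y \<in> S'"
  shows "act (scale a y) = \<sigma> a * act y"
  using assms part_closed S_closed
  by (simp add: act_def coef_part_scale seq_scalar_mult rho_scale bracket_scale_left slicewise_hom
      distrib_left mult.assoc)

lemma act_scalar:
  assumes "y \<in> S'"
  shows "\<sigma> a * act y = act y * \<sigma> a"
proof -
  have u: "part y \<in> S" "bracket (part y) x \<in> S" using assms part_closed S_closed by auto
  note r = commute_rules(1,2) commute_rules(4)[OF u(1)] commute_rules(4)[OF u(2)]
  have "act y * \<sigma> a = \<sigma> (coef y) * \<sigma> a * X + \<sigma> a * \<Delta> (part y) + \<sigma> a * (\<Delta> (bracket (part y) x) * d)"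
    by (simp add: act_def distrib_right mult.assoc r r[THEN mult_left_commute_of])
  then show ?thesis
    by (simp add: act_def distrib_left commute_rules(3)[of "coef y" a] mult.assoc)
qed

lemma act_bracket:
  assumes "y \<in> S'" "z \<in> S'"
  shows "act (bracket y z) = act y * act z - act z * act y"
proof -
  let ?u = "part y" and ?v = "part z"
  have uv: "?u \<in> S" "?v \<in> S" "bracket ?u x \<in> S" "bracket ?v x \<in> S"
    using assms part_closed S_closed by auto
  have "act y * act z - act z * act y = (\<Delta> ?u * \<Delta> ?v - \<Delta> ?v * \<Delta> ?u)
     + \<sigma> (coef z) * \<Delta> (bracket ?u x) - \<sigma> (coef y) * \<Delta> (bracket ?v x)"
    unfolding act_def
    by (rule weyl_commutator)
      (intro commute_rules uv class_two class_two' slice_deriv_shift[OF char_pos])+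
  also have "\<dots> = \<Delta> (bracket y z)"
    unfolding bracket_decompose[of y z]
    using uv by (simp add: rho_add rho_diff rho_bracket rho_scale S_closed slicewise_hom del: scale_eq_0_iff)
  also have "\<dots> = act (bracket y z)"
    using bracket_S'_closed[OF assms] by (simp add: act_S class_two slicewise_hom)
  finally show ?thesis by simp
qed

text \<open>Write the action as \<open>T + V\<close> with \<open>T\<close> the multiple of
  \<open>X\<close>. The commutator \<open>e\<close> of \<open>V\<close> and \<open>T\<close>
  commutes with both, so \<open>p\<close>-th powers add for odd \<open>p\<close>; for
  \<open>p = 2\<close> exactly \<open>e\<close> is left over, matching the extra term of the p-map.
  In \<open>V^p\<close> the part with the derivative disappears.\<close>

lemma act_pmap:
  assumes "y \<in> S'"
  shows "act (pmap y) = act y ^ CHAR('f)"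
proof -
  let ?p = "CHAR('f)" and ?u = "part y"
  define T where "T = \<sigma> (coef y) * X"
  define V where "V = \<Delta> ?u + \<Delta> (bracket ?u x) * d"
  define e where "e = \<sigma> (coef y) * \<Delta> (bracket ?u x)"
  have u: "?u \<in> S" "bracket ?u x \<in> S" "pmap ?u \<in> S" using assms part_closed S_closed by auto
  have char: "of_nat ?p = (0 :: (nat \<Rightarrow> 'f) endo)" by (rule of_nat_CHAR_endo)
  note r = commute_rules(1,2) commute_rules(4)[OF u(1)] commute_rules(4)[OF u(2)]
    commute_rules(5)[OF u(1)] commute_rules(5)[OF u(2)] commute_rules(6)
    commute_rules(7)[OF u(1,2) class_two']
  have weyl: "d * X = X * d + 1" by (rule slice_deriv_shift[OF char_pos])
  have "V ^ ?p = \<Delta> ?u ^ ?p + (\<Delta> (bracket ?u x) * d) ^ ?p"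
    unfolding V_def
    by (intro power_add_prime_commuting prime_CHAR char)
      (simp add: mult.assoc r r[THEN mult_left_commute_of])
  also have "(\<Delta> (bracket ?u x) * d) ^ ?p = 0"
    by (simp add: power_mult_commuting commute_rules(6) slice_deriv_power_CHAR[OF char_pos])
  finally have V: "V ^ ?p = \<Delta> (pmap ?u)"
    by (simp add: rho_pmap u slicewise_power[OF char_pos])
  have "T ^ ?p = \<sigma> (coef y) ^ ?p * X ^ ?p"
    unfolding T_def by (rule power_mult_commuting) (simp add: commute_rules)
  then have T: "T ^ ?p = \<Delta> (scale (coef y ^ ?p) (pmap x))"
    by (simp add: slice_shift_power_CHAR[OF char_pos] rho_scale x_pmap slicewise_hom slicewise_power[OF char_pos] seq_scalar_power)
  have VT: "V * T = T * V + e"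
    unfolding V_def T_def e_def
    by (simp add: distrib_left distrib_right mult.assoc r r[THEN mult_left_commute_of] weyl)
  have eT: "e * T = T * e" and eV: "e * V = V * e"
    unfolding V_def T_def e_def
    by (simp_all add: distrib_left distrib_right mult.assoc r r[THEN mult_left_commute_of])
  have act: "act y = T + V" by (simp add: act_def T_def V_def add.assoc)
  have "act y ^ ?p = T ^ ?p + V ^ ?p + (if ?p = 2 then e else 0)"
  proof (cases "?p = 2")
    case True
    have two: "(2 :: (nat \<Rightarrow> 'f) endo) = 0" using char True by simp
    have "T * V + T * V = 0" using two by (metis mult_2 mult_zero_left)
    moreover have "(T + V) ^ 2 = T ^ 2 + V ^ 2 + (T * V + T * V) + e"
      by (simp add: power2_eq_square distrib_left distrib_right VT add_ac)
    ultimately show ?thesis unfolding act True by simp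
  next
    case False
    then show ?thesis unfolding act
      using power_add_prime_odd[OF prime_CHAR False char VT eT eV] by simp
  qed
  also have "\<dots> = \<Delta> (pmap y)"
    unfolding pmap_decompose[of y] T V e_def using u x_pmap
    by (simp add: rho_add rho_scale S_closed slicewise_hom)
  also have "\<dots> = act (pmap y)"
    using pmap_S'_closed[OF assms] by (simp add: act_S pmap_central slicewise_hom)
  finally show ?thesis by simp
qed

lemma act_faithful:
  assumes "y \<in> S'" "act y = 0"
  shows "y = 0"
proof -
  have "\<rho> (part y) = 0 \<and> coef y = 0"
    using assms(2) prime_ge_2_nat[OF prime_CHAR] unfolding act_def
    by (intro slice_faithful[OF char_pos]) auto
  moreover have "part y = 0" using calculation by (blast intro: rho_faithful part_closed[OF assms(1)])
  moreover have "y = scale (coef y) x + part y" by (rule decompose)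
  ultimately show ?thesis by (metis add_0 scale_zero_left)
qed

end

section \<open>The faithful representation by induction on dimension\<close>

context restricted_lie_algebra
begin

definition faithful_rep_on :: "'l set \<Rightarrow> ('l \<Rightarrow> (nat \<Rightarrow> 'f) endo) \<Rightarrow> bool" where
  "faithful_rep_on S \<rho> \<longleftrightarrow> restricted_subalgebra S \<and>
    (\<forall>u\<in>S. \<forall>v\<in>S. \<rho> (u + v) = \<rho> u + \<rho> v \<and> \<rho> (bracket u v) = \<rho> u * \<rho> v - \<rho> v * \<rho> u) \<and>
    (\<forall>u\<in>S. \<forall>a. \<rho> (scale a u) = seq_scalar a * \<rho> u \<and> seq_scalar a * \<rho> u = \<rho> u * seq_scalar a) \<and>
    (\<forall>u\<in>S. \<rho> (pmap u) = \<rho> u ^ CHAR('f) \<and> (\<rho> u = 0 \<longrightarrow> u = 0))"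

lemma faithful_rep_extend:
  assumes "\<And>u v w. bracket (bracket u v) w = 0" "faithful_rep_on S \<rho>"
    and "x \<notin> S" "\<And>s. s \<in> S \<Longrightarrow> bracket s x \<in> S" "pmap x \<in> S"
  shows "\<exists>\<rho>'. faithful_rep_on (span (insert x S)) \<rho>'"
proof -
  interpret class_two_extension scale bracket pmap S \<rho> x
    using assms unfolding faithful_rep_on_def by unfold_locales blast+
  have "faithful_rep_on S' act"
    unfolding faithful_rep_on_def
    using restricted_subalgebra_S' act_add act_bracket act_scale act_scalar act_pmap act_faithful by blast
  then show ?thesis by blast
qed

lemma pmap_zero [simp]: "pmap 0 = 0"
  using pmap_scale[of 0 0] char_pos by (simp add: power_0_left)

end

context p_nilpotent_lie_algebra
begin

text \<open>Everything rests on the choice of \<open>x\<close>. If the center lies in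
  \<open>S\<close>, then so do all brackets and all p-map values, and any \<open>x\<close> outside
  \<open>S\<close> will do. Otherwise take a central element outside \<open>S\<close> and apply the
  p-map until just before it enters \<open>S\<close>, which happens by p-nilpotency.\<close>

lemma class_two_faithful_rep:
  assumes class_two: "\<And>u v w. bracket (bracket u v) w = 0"
  shows "\<exists>\<rho>. faithful_rep_on UNIV \<rho>"
proof (rule subspace_induct)
  show "subspace {0}" by (simp add: subspace_def)
  show "\<exists>\<rho>. faithful_rep_on {0} \<rho>"
    using char_pos by (intro exI[of _ "\<lambda>_. 0"])
      (simp add: faithful_rep_on_def restricted_subalgebra_def subspace_def power_0_left)
next
  fix S assume S: "subspace S" "\<exists>\<rho>. faithful_rep_on S \<rho>" "S \<noteq> UNIV"
  have class_two': "bracket w (bracket u v) = 0" for u v w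
    using bracket_anticomm[of w "bracket u v"] class_two by simp
  define Z where "Z = {z. \<forall>y. bracket z y = 0}"
  have pmap_Z: "pmap u \<in> Z" for u
  proof -
    have "CHAR('f) \<ge> 2" using prime_CHAR_semidom char_pos prime_ge_2_nat by blast
    then obtain n where n: "CHAR('f) = Suc (Suc n)" by (metis add_2_eq_Suc le_Suc_ex)
    have "bracket (pmap u) y = 0" for y unfolding pmap_ad n by (simp add: class_two')
    then show ?thesis by (simp add: Z_def)
  qed
  have "\<exists>x. x \<notin> S \<and> (\<forall>s\<in>S. bracket s x \<in> S) \<and> pmap x \<in> S"
  proof (cases "Z \<subseteq> S")
    case True
    obtain x where "x \<notin> S" using S(3) by blast
    moreover have "bracket s x \<in> S" for s using class_two True by (auto simp: Z_def)
    ultimately show ?thesis using pmap_Z True by blast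
  next
    case False
    then obtain z where z: "z \<in> Z" "z \<notin> S" by blast
    obtain n where "(pmap ^^ n) z = 0" using nilpotent by (auto simp: p_nilpotent_def)
    then have n: "(pmap ^^ n) z \<in> S" using subspace_0[OF S(1)] by simp
    define m where "m = (LEAST n. (pmap ^^ n) z \<in> S)"
    have m: "(pmap ^^ m) z \<in> S" unfolding m_def using n by (rule LeastI)
    then obtain k where k: "m = Suc k" using z(2) by (cases m) auto
    have notin: "(pmap ^^ k) z \<notin> S" using not_less_Least[of k "\<lambda>n. (pmap ^^ n) z \<in> S"] k m_def by auto
    have "(pmap ^^ k) z \<in> Z" using z(1) pmap_Z by (cases k) auto
    then have "bracket s ((pmap ^^ k) z) = 0" for s
      using bracket_anticomm[of s "(pmap ^^ k) z"] by (simp add: Z_def)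
    then show ?thesis using notin m k subspace_0[OF S(1)] by (intro exI[of _ "(pmap ^^ k) z"]) auto
  qed
  then show "\<exists>x. x \<notin> S \<and> (\<exists>\<rho>. faithful_rep_on (span (insert x S)) \<rho>)"
    using faithful_rep_extend[OF class_two] S(2) by blast
qed

text \<open>The adjoint representation reduces the claim to nilpotency class two.\<close>

lemma commutative_imp_abelian:
  assumes comm: "\<And>u v. gen u * gen v - gen v * gen u \<in> ker"
  shows "bracket u v = 0"
proof -
  have class_two: "bracket (bracket u v) w = 0" for u v w
  proof -
    interpret ad: restricted_evaluation scale bracket pmap ad_scalar ad_rep
      by (rule restricted_evaluation_ad)
    have "ad_rep (bracket u v) = 0" using ad.eval_ker[OF comm[of u v]] by (simp add: ad.rep_bracket)
    then show ?thesis using app_ad_rep[of "bracket u v" w 0] by (simp add: zero_prod_def)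
  qed
  obtain \<rho> where \<rho>: "faithful_rep_on UNIV \<rho>" using class_two_faithful_rep[OF class_two] by blast
  interpret rep: restricted_evaluation scale bracket pmap seq_scalar \<rho>
    using \<rho> by unfold_locales (auto simp: faithful_rep_on_def seq_scalar_add seq_scalar_mult)
  have "\<rho> (bracket u v) = 0" using rep.eval_ker[OF comm[of u v]] by (simp add: rep.rep_bracket)
  then show ?thesis using \<rho> by (simp add: faithful_rep_on_def)
qed

end

section \<open>The radical of the restricted enveloping algebra\<close>

context restricted_lie_algebra
begin

lemma restricted_evaluation_augmentation:
  "restricted_evaluation scale bracket pmap (\<lambda>a :: 'f. a) (\<lambda>_. 0 :: 'f)"
  by unfold_locales (use char_pos in \<open>auto simp: algebra_simps power_0_left\<close>)

definition aug :: "('l, 'f) free_alg \<Rightarrow> 'f" where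
  "aug = evaluation.eval (\<lambda>a. a) (\<lambda>_. 0)"

lemma evaluation_augmentation: "evaluation (\<lambda>a :: 'f. a) (\<lambda>_ :: 'l. 0 :: 'f)"
  using restricted_evaluation_augmentation by (simp add: restricted_evaluation_def)

lemma aug_simps [simp]:
  "aug 0 = 0" "aug 1 = 1" "aug (s + t) = aug s + aug t" "aug (- t) = - aug t"
  "aug (s - t) = aug s - aug t" "aug (s * t) = aug s * aug t" "aug (scl c) = c" "aug (gen x) = 0"
proof -
  interpret aug: evaluation "\<lambda>a :: 'f. a" "\<lambda>_ :: 'l. 0 :: 'f" by (rule evaluation_augmentation)
  show "aug 0 = 0" "aug 1 = 1" "aug (s + t) = aug s + aug t" "aug (- t) = - aug t"
    "aug (s - t) = aug s - aug t" "aug (s * t) = aug s * aug t" "aug (scl c) = c" "aug (gen x) = 0"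
    by (simp_all add: aug_def)
qed

lemma aug_ker: "t \<in> ker \<Longrightarrow> aug t = 0"
  using restricted_evaluation.eval_ker[OF restricted_evaluation_augmentation] by (simp add: aug_def)

definition omega :: "('l, 'f) free_alg set" where
  "omega = {t. aug t = 0}"

lemma proj_omega_iff: "proj t \<in> proj ` omega \<longleftrightarrow> t \<in> omega"
proof
  assume "proj t \<in> proj ` omega"
  then obtain s where "t - s \<in> ker" "s \<in> omega" by (auto simp: proj_eq_iff)
  then show "t \<in> omega" using aug_ker[of "t - s"] by (simp add: omega_def)
qed simp

section \<open>Powers of the augmentation ideal and word ideals\<close>

lemma ker_scl: "t \<in> ker \<Longrightarrow> scl c * t \<in> ker"
  by (rule ker_mult_left)

lemma word_ideal_scl: "t \<in> word_ideal S m \<Longrightarrow> scl c * t \<in> word_ideal S m"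
proof (induction rule: word_ideal.induct)
  case (word ss t)
  have "scl c * (word ss * t) = word ss * (scl c * t)"
    by (metis mult.assoc scl_commute)
  then show ?case using word_ideal.word[OF word] by simp
qed (auto intro: word_ideal.ker word_ideal.add ker_mult_left simp: distrib_left)

lemma word_ideal_UNIV_word: "t \<in> word_ideal UNIV m \<Longrightarrow> word xs * t \<in> word_ideal UNIV m"
  by (induction xs) (auto simp: word_Nil word_Cons mult.assoc intro: word_ideal_mono word_ideal_gen)

text \<open>Elements of \<open>omega\<close> are combinations of nonempty words modulo
  \<open>ker\<close>. The induction runs over arbitrary \<open>t\<close> with the scalar part
  subtracted, since partial sums of an element of \<open>omega\<close> may leave
  \<open>omega\<close>.\<close>

lemma word_ideal_omega:
  assumes u: "u \<in> word_ideal UNIV m" and t: "t \<in> omega"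
  shows "t * u \<in> word_ideal UNIV (Suc m)"
proof -
  have "t * u - scl (aug t) * u \<in> word_ideal UNIV (Suc m)" for t
  proof (induction t rule: free_alg_induct)
    case (add c xs t)
    have "scl c * word xs * u - scl (aug (scl c * word xs)) * u \<in> word_ideal UNIV (Suc m)"
    proof (cases xs)
      case Nil
      then show ?thesis by (simp add: word_Nil word_ideal.ker)
    next
      case (Cons y ys)
      have "word xs * u \<in> word_ideal UNIV (Suc m)"
        unfolding Cons word_Cons mult.assoc by (intro word_ideal_gen word_ideal_UNIV_word u) simp
      then show ?thesis using word_ideal_scl by (simp add: Cons word_Cons mult.assoc)
    qed
    from word_ideal.add[OF this add] show ?case by (simp add: algebra_simps single_add)
  qed (simp add: word_ideal.ker)
  from this[of t] t show ?thesis by (simp add: omega_def)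
qed

lemma word_ideal_prod_omega: "set ts \<subseteq> omega \<Longrightarrow> prod_list ts * u \<in> word_ideal UNIV (length ts)"
proof (induction ts)
  case Nil
  show ?case using word_ideal.word[of "[]" UNIV 0 u] by (simp add: word_Nil)
next
  case (Cons t ts)
  then show ?case using word_ideal_omega[of "prod_list ts * u"] by (simp add: mult.assoc)
qed

section \<open>Left ideals of the restricted enveloping algebra\<close>

abbreviation U :: "('f, ('l, 'f) free_alg set set) module" where
  "U \<equiv> restricted_enveloping_algebra"

lemma left_ideal_proj:
  assumes "0 \<in> A" "\<And>s t. s \<in> A \<Longrightarrow> t \<in> A \<Longrightarrow> s + t \<in> A" "\<And>s t. t \<in> A \<Longrightarrow> s * t \<in> A"
  shows "left_ideal (proj ` A) U"
proof -
  interpret U: ring U by (rule ring_U)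
  have "subgroup (proj ` A) (add_monoid U)"
  proof (rule group.subgroupI[OF abelian_group.a_group[OF U.is_abelian_group]])
    fix a assume "a \<in> proj ` A"
    then obtain t where t: "a = proj t" "t \<in> A" by blast
    have "- t \<in> A" using assms(3)[OF t(2), of "- 1"] by simp
    then show "inv\<^bsub>add_monoid U\<^esub> a \<in> proj ` A"
      using t(1) proj_minus[of t] by (auto simp: a_inv_def)
  next
    fix a b assume "a \<in> proj ` A" "b \<in> proj ` A"
    then obtain s t where st: "a = proj s" "s \<in> A" "b = proj t" "t \<in> A" by blast
    then have "proj (s + t) \<in> proj ` A" using assms(2) by blast
    then show "a \<otimes>\<^bsub>add_monoid U\<^esub> b \<in> proj ` A" using st by (simp add: proj_add)
  qed (use assms(1) in \<open>auto simp: proj_closed\<close>)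
  moreover have "a \<otimes>\<^bsub>U\<^esub> b \<in> proj ` A" if ab: "a \<in> carrier U" "b \<in> proj ` A" for a b
  proof -
    obtain s t where "a = proj s" "b = proj t" "t \<in> A" using ab by (auto simp: carrier_U)
    moreover from this have "proj (s * t) \<in> proj ` A" using assms(3) by blast
    ultimately show ?thesis by (simp add: proj_mult)
  qed
  ultimately show ?thesis by (auto simp: left_ideal_def intro: additive_subgroup.intro)
qed

lemma left_idealD:
  assumes "left_ideal J U"
  shows "proj 0 \<in> J" "proj s \<in> J \<Longrightarrow> proj t \<in> J \<Longrightarrow> proj (s + t) \<in> J"
    "proj t \<in> J \<Longrightarrow> proj (s * t) \<in> J" "J \<subseteq> range proj"
proof -
  interpret J: additive_subgroup J U using assms by (simp add: left_ideal_def)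
  show "proj 0 \<in> J" using J.zero_closed by (simp add: proj_zero)
  show "proj s \<in> J \<Longrightarrow> proj t \<in> J \<Longrightarrow> proj (s + t) \<in> J" by (simp add: proj_add)
  show "proj t \<in> J \<Longrightarrow> proj (s * t) \<in> J"
    using assms by (simp add: left_ideal_def proj_mult proj_closed)
  show "J \<subseteq> range proj" using J.a_subset by (simp add: carrier_U)
qed

lemma left_ideal_one:
  assumes "left_ideal J U" "proj 1 \<in> J"
  shows "J = carrier U"
proof -
  have "proj s \<in> J" for s using left_idealD(3)[OF assms(1,2), of s] by simp
  then show ?thesis using left_idealD(4)[OF assms(1)] by (auto simp: carrier_U)
qed

lemma left_ideal_omega: "left_ideal (proj ` omega) U"
  by (rule left_ideal_proj) (auto simp: omega_def)

text \<open>The augmentation ideal has codimension one: a larger left ideal contains some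
  \<open>t\<close> with \<open>aug t\<close> nonzero, hence this scalar and its inverse multiple
  \<open>1\<close>.\<close>

lemma maximal_left_ideal_omega: "maximal_left_ideal (proj ` omega) U"
  unfolding maximal_left_ideal_def
proof (intro conjI allI impI left_ideal_omega)
  have "proj 1 \<notin> proj ` omega" unfolding proj_omega_iff by (simp add: omega_def)
  then show "proj ` omega \<noteq> carrier U" using proj_closed by metis
next
  fix J assume J: "left_ideal J U \<and> proj ` omega \<subseteq> J"
  show "J = proj ` omega \<or> J = carrier U"
  proof (cases "J \<subseteq> proj ` omega")
    case False
    then obtain v where v: "v \<in> J" "v \<notin> proj ` omega" by blast
    then obtain t where "v = proj t" using left_idealD(4)[of J] J by blast
    then have t: "proj t \<in> J" "t \<notin> omega" using v by blast+
    have "scl (aug t) - t \<in> omega" by (simp add: omega_def)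
    then have "proj (scl (aug t) - t) \<in> J" using J by blast
    then have "proj (scl (aug t)) \<in> J" using left_idealD(2)[of J "scl (aug t) - t" t] J t by simp
    then have "proj (scl (inverse (aug t)) * scl (aug t)) \<in> J" using left_idealD(3) J by blast
    then have "proj 1 \<in> J" using t(2) by (simp add: omega_def flip: scl_mult)
    then show ?thesis using left_ideal_one J by blast
  qed (use J in blast)
qed

end

lemma sum_power_mult_one_diff: "(\<Sum>i<k. w ^ i) * (1 - w) = 1 - w ^ k" for w :: "'r::ring_1"
proof (induction k)
  case (Suc k)
  have "(\<Sum>i<Suc k. w ^ i) * (1 - w) = (\<Sum>i<k. w ^ i) * (1 - w) + w ^ k * (1 - w)"
    by (simp add: distrib_right)
  also have "\<dots> = 1 - w ^ Suc k"
    unfolding Suc by (simp add: right_diff_distrib power_commutes)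
  finally show ?case .
qed simp

context p_nilpotent_lie_algebra
begin

lemma omega_nilpotent:
  "\<exists>k. \<forall>ts. set ts \<subseteq> omega \<and> length ts = k \<longrightarrow> prod_list ts \<in> ker"
proof -
  obtain k where k: "\<And>xs. length xs = k \<Longrightarrow> word xs \<in> ker" using words_nilpotent by blast
  have "prod_list ts \<in> ker" if "set ts \<subseteq> omega" "length ts = k" for ts
    using word_ideal_prod_omega[OF that(1), of 1] that(2) k
    by (intro word_ideal_subset_ker[of UNIV k "prod_list ts"]) auto
  then show ?thesis by blast
qed

text \<open>If \<open>t\<close> were outside \<open>M\<close>, then \<open>M + U t\<close> would be
  everything, so \<open>1 - s t\<close> would be in \<open>M\<close> for some \<open>s\<close>. As
  \<open>s t\<close> is nilpotent, the geometric sum is a left inverse of \<open>1 - s t\<close>,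
  which puts \<open>1\<close> into \<open>M\<close>.\<close>

lemma omega_subset_maximal_left_ideal:
  assumes "maximal_left_ideal M U"
  shows "proj ` omega \<subseteq> M"
proof (rule ccontr)
  assume "\<not> proj ` omega \<subseteq> M"
  then obtain t where t: "t \<in> omega" "proj t \<notin> M" by blast
  have M: "left_ideal M U" "M \<noteq> carrier U"
    and max: "\<And>J. left_ideal J U \<Longrightarrow> M \<subseteq> J \<Longrightarrow> J = M \<or> J = carrier U"
    using assms by (auto simp: maximal_left_ideal_def)
  define A where "A = {m + s * t | m s. proj m \<in> M}"
  have "left_ideal (proj ` A) U"
  proof (rule left_ideal_proj)
    show "0 \<in> A" unfolding A_def using left_idealD(1)[OF M(1)]
      by (auto intro!: exI[of _ 0])
  next
    fix a b assume "a \<in> A" "b \<in> A"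
    then obtain m s m' s' where *: "a = m + s * t" "b = m' + s' * t" "proj m \<in> M" "proj m' \<in> M"
      unfolding A_def by blast
    then have "a + b = (m + m') + (s + s') * t" by (simp add: algebra_simps)
    then show "a + b \<in> A" unfolding A_def using left_idealD(2)[OF M(1)] * by blast
  next
    fix a b assume "b \<in> A"
    then obtain m s where *: "b = m + s * t" "proj m \<in> M" unfolding A_def by blast
    then have "a * b = a * m + (a * s) * t" by (simp add: algebra_simps)
    then show "a * b \<in> A" unfolding A_def using left_idealD(3)[OF M(1)] * by blast
  qed
  moreover have "M \<subseteq> proj ` A"
  proof
    fix v assume v: "v \<in> M"
    then obtain m where "v = proj m" using left_idealD(4)[OF M(1)] by blast
    moreover have "m + 0 * t \<in> A" unfolding A_def using v calculation by blast
    ultimately show "v \<in> proj ` A" by simp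
  qed
  moreover have "proj t \<in> proj ` A"
  proof -
    have "0 + 1 * t \<in> A" unfolding A_def using left_idealD(1)[OF M(1)] by blast
    then show ?thesis by simp
  qed
  ultimately have "proj ` A = carrier U" using max t(2) by blast
  then have "proj 1 \<in> proj ` A" using proj_closed by metis
  then obtain m s where ms: "proj 1 = proj (m + s * t)" "proj m \<in> M" unfolding A_def by blast
  define w where "w = s * t"
  have "1 - (m + w) \<in> ker" using ms(1) by (simp add: proj_eq_iff w_def)
  moreover have "1 - w - m = 1 - (m + w)" by simp
  ultimately have "proj (1 - w) = proj m" unfolding proj_eq_iff by metis
  obtain k where k: "\<And>ts. set ts \<subseteq> omega \<Longrightarrow> length ts = k \<Longrightarrow> prod_list ts \<in> ker"
    using omega_nilpotent by blast
  have "w \<in> omega" using t(1) by (simp add: w_def omega_def)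
  then have "prod_list (replicate k w) \<in> ker" by (intro k) auto
  then have wk: "w ^ k \<in> ker" by simp
  have "proj ((\<Sum>i<k. w ^ i) * m) = proj ((\<Sum>i<k. w ^ i) * (1 - w))"
    using \<open>proj (1 - w) = proj m\<close> by (simp add: proj_mult)
  also have "\<dots> = proj 1" unfolding sum_power_mult_one_diff using wk ker_minus by (simp add: proj_eq_iff)
  finally have "proj 1 \<in> M" using left_idealD(3)[OF M(1) ms(2)] by metis
  then show False using left_ideal_one[OF M(1)] M(2) by blast
qed

theorem jacobson_radical_U: "jacobson_radical U = proj ` omega"
proof
  show "jacobson_radical U \<subseteq> proj ` omega"
    unfolding jacobson_radical_def using maximal_left_ideal_omega by blast
  show "proj ` omega \<subseteq> jacobson_radical U"
    unfolding jacobson_radical_def using omega_subset_maximal_left_ideal by (auto simp: carrier_U)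
qed

end

section \<open>Coordinates with respect to a filtered multiplicative basis\<close>

locale fm_basis_lie_algebra = p_nilpotent_lie_algebra scale bracket pmap Basis
  for scale :: "'f::field \<Rightarrow> 'l::ab_group_add \<Rightarrow> 'l" and bracket pmap Basis +
  fixes B
  assumes fm_basis: "filtered_multiplicative_basis (class_ring :: 'f ring) U B"
begin

lemma vectorspace_U: "vectorspace (class_ring :: 'f ring) U"
  using assoc_U by (simp add: assoc_algebra_def)

lemma submodule_omega: "submodule (class_ring :: 'f ring) (proj ` omega) U"
proof -
  interpret U: vectorspace "class_ring :: 'f ring" U by (rule vectorspace_U)
  show ?thesis
  proof
    fix v w assume "v \<in> proj ` omega" "w \<in> proj ` omega"
    then obtain s t where st: "v = proj s" "w = proj t" "s \<in> omega" "t \<in> omega" by blast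
    then have "proj (s + t) \<in> proj ` omega" by (simp add: omega_def)
    then show "v \<oplus>\<^bsub>U\<^esub> w \<in> proj ` omega" using st by (simp add: proj_add)
  next
    fix c :: 'f and v assume "v \<in> proj ` omega"
    then obtain t where t: "v = proj t" "t \<in> omega" by blast
    then have "proj (scl c * t) \<in> proj ` omega" by (simp add: omega_def)
    then show "c \<odot>\<^bsub>U\<^esub> v \<in> proj ` omega" using t by (simp add: proj_scl)
  next
    have "proj 0 \<in> proj ` omega" by (simp add: omega_def)
    then show "\<zero>\<^bsub>U\<^esub> \<in> proj ` omega" by (simp add: proj_zero)
  qed (auto simp: proj_closed)
qed

lemma B_closed: "B \<subseteq> carrier U"
  and B_mult: "v \<in> B \<Longrightarrow> w \<in> B \<Longrightarrow> v \<otimes>\<^bsub>U\<^esub> w = \<zero>\<^bsub>U\<^esub> \<or> v \<otimes>\<^bsub>U\<^esub> w \<in> B"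
  and B_lin_indpt: "\<not> LinearCombinations.module.lin_dep (class_ring :: 'f ring) U B"
  and B_span: "LinearCombinations.module.span (class_ring :: 'f ring) U B = carrier U"
  and B_omega_span: "LinearCombinations.module.span (class_ring :: 'f ring) U (B \<inter> proj ` omega) = proj ` omega"
proof -
  interpret U: vectorspace "class_ring :: 'f ring" U by (rule vectorspace_U)
  have basis: "U.basis B"
    and rad: "vectorspace.basis class_ring (U\<lparr>carrier := jacobson_radical U\<rparr>) (B \<inter> jacobson_radical U)"
    using fm_basis by (simp_all add: filtered_multiplicative_basis_def)
  show "B \<subseteq> carrier U" "\<not> U.lin_dep B" "U.span B = carrier U"
    using basis by (simp_all add: U.basis_def)
  show "v \<in> B \<Longrightarrow> w \<in> B \<Longrightarrow> v \<otimes>\<^bsub>U\<^esub> w = \<zero>\<^bsub>U\<^esub> \<or> v \<otimes>\<^bsub>U\<^esub> w \<in> B"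
    using fm_basis by (simp add: filtered_multiplicative_basis_def)
  have "Module.module (class_ring :: 'f ring) (U\<lparr>carrier := proj ` omega\<rparr>)"
    by (rule U.submodule_is_module[OF submodule_omega])
  then interpret W: vectorspace "class_ring :: 'f ring" "U\<lparr>carrier := proj ` omega\<rparr>"
    by (rule vectorspace.intro) (rule class_field.field_axioms)
  have "W.span (B \<inter> proj ` omega) = proj ` omega"
    using rad unfolding jacobson_radical_U W.basis_def by simp
  then show "U.span (B \<inter> proj ` omega) = proj ` omega"
    using U.span_li_not_depend(1)[OF _ submodule_omega, of "B \<inter> proj ` omega"] by simp
qed

definition lift :: "('l, 'f) free_alg set set \<Rightarrow> ('l, 'f) free_alg" where
  "lift v = (SOME t. proj t = v)"

lemma proj_lift:
  assumes "v \<in> B"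
  shows "proj (lift v) = v"
proof -
  obtain t where "proj t = v" using assms B_closed unfolding carrier_U by blast
  then show ?thesis unfolding lift_def by (rule someI)
qed

lemma lincomb_proj:
  assumes "finite A" "A \<subseteq> B"
  shows "LinearCombinations.module.lincomb U a A = proj (\<Sum>v\<in>A. scl (a v) * lift v)"
  using assms
proof (induction A rule: finite_induct)
  case empty
  interpret U: vectorspace "class_ring :: 'f ring" U by (rule vectorspace_U)
  show ?case by (simp add: U.lincomb_def proj_zero)
next
  case (insert v A)
  interpret U: vectorspace "class_ring :: 'f ring" U by (rule vectorspace_U)
  have "a v \<odot>\<^bsub>U\<^esub> v = proj (scl (a v) * lift v)"
    using insert by (simp add: proj_scl proj_lift)
  moreover have "A \<subseteq> carrier U" "v \<in> carrier U" using insert B_closed by auto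
  moreover have "a u \<odot>\<^bsub>U\<^esub> u \<in> carrier U" if "u \<in> carrier U" for u
    by (rule U.smult_closed[OF _ that]) simp
  ultimately have "(\<Oplus>\<^bsub>U\<^esub>u\<in>insert v A. a u \<odot>\<^bsub>U\<^esub> u) = a v \<odot>\<^bsub>U\<^esub> v \<oplus>\<^bsub>U\<^esub> (\<Oplus>\<^bsub>U\<^esub>u\<in>A. a u \<odot>\<^bsub>U\<^esub> u)"
    using insert.hyps by (intro U.M.finsum_insert) (auto simp: proj_closed)
  moreover have "(\<Oplus>\<^bsub>U\<^esub>u\<in>A. a u \<odot>\<^bsub>U\<^esub> u) = proj (\<Sum>v\<in>A. scl (a v) * lift v)"
    using insert.IH insert.prems by (simp add: U.lincomb_def)
  ultimately show ?case
    using insert.hyps \<open>a v \<odot>\<^bsub>U\<^esub> v = proj (scl (a v) * lift v)\<close> by (simp add: U.lincomb_def proj_add)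
qed

lemma lin_indpt_lift:
  assumes "finite A" "A \<subseteq> B" "(\<Sum>v\<in>A. scl (a v) * lift v) \<in> ker" "v \<in> A"
  shows "a v = 0"
proof (rule ccontr)
  interpret U: vectorspace "class_ring :: 'f ring" U by (rule vectorspace_U)
  assume "a v \<noteq> 0"
  moreover have "U.lincomb a A = \<zero>\<^bsub>U\<^esub>"
    using lincomb_proj[OF assms(1,2)] assms(3) by (simp add: ker_def)
  ultimately have "U.lin_dep B"
    unfolding U.lin_dep_def using assms by (intro exI[of _ A] exI[of _ a] exI[of _ v]) auto
  then show False using B_lin_indpt by simp
qed

lemma span_lift:
  assumes "proj t \<in> LinearCombinations.module.span (class_ring :: 'f ring) U C" "C \<subseteq> B"
  shows "\<exists>A a. finite A \<and> A \<subseteq> C \<and> t - (\<Sum>v\<in>A. scl (a v) * lift v) \<in> ker"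
proof -
  interpret U: vectorspace "class_ring :: 'f ring" U by (rule vectorspace_U)
  obtain A a where "finite A" "A \<subseteq> C" "proj t = U.lincomb a A"
    using assms(1) unfolding U.span_def by blast
  moreover have "U.lincomb a A = proj (\<Sum>v\<in>A. scl (a v) * lift v)"
    using calculation assms(2) by (intro lincomb_proj) auto
  ultimately show ?thesis by (auto simp: proj_eq_iff)
qed

lemma B_generates: "\<exists>A a. finite A \<and> A \<subseteq> B \<and> t - (\<Sum>v\<in>A. scl (a v) * lift v) \<in> ker"
  using span_lift[of t B] B_span proj_closed by simp

definition Bo :: "('l, 'f) free_alg set set set" where
  "Bo = B \<inter> proj ` omega"

lemma Bo_subset: "Bo \<subseteq> B"
  by (simp add: Bo_def)

lemma Bo_generates:
  "t \<in> omega \<Longrightarrow> \<exists>A a. finite A \<and> A \<subseteq> Bo \<and> t - (\<Sum>v\<in>A. scl (a v) * lift v) \<in> ker"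
  using span_lift[of t Bo] B_omega_span Bo_subset by (simp add: Bo_def)

lemma lift_omega: "v \<in> Bo \<Longrightarrow> lift v \<in> omega"
  using proj_lift[of v] proj_omega_iff[of "lift v"] by (simp add: Bo_def)

lemma lift_mult:
  assumes "v \<in> Bo" "w \<in> Bo"
  shows "lift v * lift w \<in> ker \<or> (\<exists>u\<in>Bo. lift v * lift w - lift u \<in> ker)"
proof -
  have vw: "proj (lift v * lift w) = v \<otimes>\<^bsub>U\<^esub> w"
    using proj_lift[of v] proj_lift[of w] assms Bo_subset by (simp add: proj_mult subset_iff)
  have "lift v * lift w \<in> omega" using lift_omega[OF assms(1)] by (simp add: omega_def)
  then have om: "v \<otimes>\<^bsub>U\<^esub> w \<in> proj ` omega" using vw by (metis imageI)
  consider "v \<otimes>\<^bsub>U\<^esub> w = \<zero>\<^bsub>U\<^esub>" | "v \<otimes>\<^bsub>U\<^esub> w \<in> B" using assms Bo_subset B_mult by blast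
  then show ?thesis
  proof cases
    case 1
    then show ?thesis using vw by (simp add: ker_def)
  next
    case 2
    then have "v \<otimes>\<^bsub>U\<^esub> w \<in> Bo" using om by (simp add: Bo_def)
    moreover have "lift v * lift w - lift (v \<otimes>\<^bsub>U\<^esub> w) \<in> ker"
      using 2 vw by (simp add: proj_lift flip: proj_eq_iff)
    ultimately show ?thesis by blast
  qed
qed

section \<open>Coordinate functionals\<close>

definition coordinates :: "('l, 'f) free_alg \<Rightarrow> (('l, 'f) free_alg set set \<Rightarrow> 'f) \<Rightarrow> bool" where
  "coordinates t a \<longleftrightarrow> (\<exists>A. finite A \<and> A \<subseteq> B \<and> (\<forall>v. v \<notin> A \<longrightarrow> a v = 0) \<and>
     t - (\<Sum>v\<in>A. scl (a v) * lift v) \<in> ker)"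

lemma coordinates_superset:
  assumes "finite A" "A \<subseteq> A'" "finite A'" "\<forall>v. v \<notin> A \<longrightarrow> a v = 0"
  shows "(\<Sum>v\<in>A. scl (a v) * lift v) = (\<Sum>v\<in>A'. scl (a v) * lift v)"
  using assms by (intro sum.mono_neutral_left) auto

lemma coordinates_add:
  assumes "coordinates s a" "coordinates t b"
  shows "coordinates (s + t) (\<lambda>v. a v + b v)"
proof -
  obtain A A' where A: "finite A" "A \<subseteq> B" "\<forall>v. v \<notin> A \<longrightarrow> a v = 0" "s - (\<Sum>v\<in>A. scl (a v) * lift v) \<in> ker"
    and A': "finite A'" "A' \<subseteq> B" "\<forall>v. v \<notin> A' \<longrightarrow> b v = 0" "t - (\<Sum>v\<in>A'. scl (b v) * lift v) \<in> ker"
    using assms unfolding coordinates_def by blast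
  have "(\<Sum>v\<in>A. scl (a v) * lift v) = (\<Sum>v\<in>A \<union> A'. scl (a v) * lift v)"
    "(\<Sum>v\<in>A'. scl (b v) * lift v) = (\<Sum>v\<in>A \<union> A'. scl (b v) * lift v)"
    using A A' by (auto intro!: coordinates_superset)
  then have "(s + t) - (\<Sum>v\<in>A \<union> A'. scl (a v + b v) * lift v) \<in> ker"
    using ker_add[OF A(4) A'(4)] by (simp add: single_add distrib_right sum.distrib algebra_simps)
  then show ?thesis unfolding coordinates_def using A A' by (intro exI[of _ "A \<union> A'"]) auto
qed

lemma coordinates_scl:
  assumes "coordinates t a"
  shows "coordinates (scl c * t) (\<lambda>v. c * a v)"
proof -
  obtain A where A: "finite A" "A \<subseteq> B" "\<forall>v. v \<notin> A \<longrightarrow> a v = 0" "t - (\<Sum>v\<in>A. scl (a v) * lift v) \<in> ker"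
    using assms unfolding coordinates_def by blast
  have "scl c * t - (\<Sum>v\<in>A. scl (c * a v) * lift v) = scl c * (t - (\<Sum>v\<in>A. scl (a v) * lift v))"
    by (simp add: scl_mult right_diff_distrib sum_distrib_left mult.assoc)
  then show ?thesis unfolding coordinates_def using A ker_scl by (intro exI[of _ A]) auto
qed

lemma coordinates_zero:
  assumes "coordinates t a" "t \<in> ker"
  shows "a v = 0"
proof -
  obtain A where A: "finite A" "A \<subseteq> B" "\<forall>v. v \<notin> A \<longrightarrow> a v = 0" "t - (\<Sum>v\<in>A. scl (a v) * lift v) \<in> ker"
    using assms unfolding coordinates_def by blast
  have "(\<Sum>v\<in>A. scl (a v) * lift v) \<in> ker" using ker_diff[OF assms(2) A(4)] by simp
  then show ?thesis using lin_indpt_lift A by blast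
qed

lemma coordinates_unique:
  assumes "coordinates t a" "coordinates t b"
  shows "a = b"
proof
  fix v
  have "coordinates (t + scl (- 1) * t) (\<lambda>v. a v + (- 1) * b v)"
    by (intro coordinates_add coordinates_scl assms)
  moreover have "t + scl (- 1) * t = 0" by (simp add: single_uminus)
  ultimately show "a v = b v" using coordinates_zero[of 0 _ v] by fastforce
qed

definition coord :: "('l, 'f) free_alg set set \<Rightarrow> ('l, 'f) free_alg \<Rightarrow> 'f" where
  "coord v t = (THE a. coordinates t a) v"

lemma coord_eqI: "coordinates t a \<Longrightarrow> coord v t = a v"
  unfolding coord_def using coordinates_unique the_equality by metis

lemma coordinates_coord: "coordinates t (\<lambda>v. coord v t)"
proof -
  obtain A a where A: "finite A" "A \<subseteq> B" "t - (\<Sum>v\<in>A. scl (a v) * lift v) \<in> ker"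
    using B_generates by blast
  let ?a = "\<lambda>v. if v \<in> A then a v else 0"
  have "(\<Sum>v\<in>A. scl (?a v) * lift v) = (\<Sum>v\<in>A. scl (a v) * lift v)" by (intro sum.cong) auto
  then have "coordinates t ?a" unfolding coordinates_def using A by (intro exI[of _ A]) auto
  moreover from this have "(\<lambda>v. coord v t) = ?a" by (intro ext coord_eqI)
  ultimately show ?thesis by (simp only:)
qed

lemma coord_add: "coord v (s + t) = coord v s + coord v t"
  using coord_eqI[OF coordinates_add[OF coordinates_coord coordinates_coord]] .

lemma coord_scl: "coord v (scl c * t) = c * coord v t"
  using coord_eqI[OF coordinates_scl[OF coordinates_coord]] .

lemma coord_ker: "t \<in> ker \<Longrightarrow> coord v t = 0"
  using coordinates_zero[OF coordinates_coord] .

lemma coord_minus: "coord v (- t) = - coord v t"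
  using coord_add[of v t "- t"] coord_ker[of 0] by (simp add: eq_neg_iff_add_eq_0 add.commute)

lemma coord_diff: "coord v (s - t) = coord v s - coord v t"
  using coord_add[of v s "- t"] by (simp add: coord_minus)

lemma coord_cong: "s - t \<in> ker \<Longrightarrow> coord v s = coord v t"
  using coord_diff[of v s t] coord_ker by simp

lemma coord_lift: "w \<in> B \<Longrightarrow> coord v (lift w) = (if v = w then 1 else 0)"
proof (rule coord_eqI)
  assume "w \<in> B"
  then show "coordinates (lift w) (\<lambda>v. if v = w then 1 else 0)"
    unfolding coordinates_def by (intro exI[of _ "{w}"]) auto
qed

lemma lift_notin_ker: "v \<in> B \<Longrightarrow> lift v \<notin> ker"
  using coord_ker[of "lift v" v] coord_lift[of v v] by auto

end

section \<open>The filtration by products of basis elements\<close>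

context fm_basis_lie_algebra
begin

abbreviation lifts :: "('l, 'f) free_alg set set list \<Rightarrow> ('l, 'f) free_alg" where
  "lifts vs \<equiv> prod_list (map lift vs)"

text \<open>The preimage of the \<open>n\<close>-th power of the augmentation ideal. Using products
  of basis elements as its generators lets coordinates be read off.\<close>

inductive_set filt :: "nat \<Rightarrow> ('l, 'f) free_alg set" for n where
  ker: "t \<in> ker \<Longrightarrow> t \<in> filt n"
| prod: "set vs \<subseteq> Bo \<Longrightarrow> n \<le> length vs \<Longrightarrow> scl c * lifts vs \<in> filt n"
| add: "s \<in> filt n \<Longrightarrow> t \<in> filt n \<Longrightarrow> s + t \<in> filt n"

lemma filt_antimono: "t \<in> filt n \<Longrightarrow> m \<le> n \<Longrightarrow> t \<in> filt m"
  by (induction rule: filt.induct) (auto intro: filt.intros)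

lemma filt_scl: "t \<in> filt n \<Longrightarrow> scl c * t \<in> filt n"
proof (induction rule: filt.induct)
  case (prod vs d)
  then show ?case using filt.prod[of vs n "c * d"] by (simp add: scl_mult mult.assoc)
qed (auto intro: filt.ker filt.add ker_scl simp: distrib_left)

lemma filt_minus: "t \<in> filt n \<Longrightarrow> - t \<in> filt n"
  using filt_scl[of t n "- 1"] by (simp add: single_uminus)

lemma filt_diff: "s \<in> filt n \<Longrightarrow> t \<in> filt n \<Longrightarrow> s - t \<in> filt n"
  using filt.add[of s n "- t"] by (simp add: filt_minus)

lemma filt_cong: "s - t \<in> ker \<Longrightarrow> t \<in> filt n \<Longrightarrow> s \<in> filt n"
  using filt.add[OF filt.ker[of "s - t" n], of t] by simp

lemma filt_mult: "s \<in> filt m \<Longrightarrow> t \<in> filt n \<Longrightarrow> s * t \<in> filt (m + n)"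
proof (induction rule: filt.induct)
  case (prod vs c)
  from prod(3) show ?case
  proof (induction rule: filt.induct)
    case (prod ws d)
    have "scl c * lifts vs * (scl d * lifts ws) = scl c * (lifts vs * scl d) * lifts ws"
      by (simp only: mult.assoc)
    also have "lifts vs * scl d = scl d * lifts vs" by (rule scl_commute[symmetric])
    finally have "scl c * lifts vs * (scl d * lifts ws) = scl (c * d) * lifts (vs @ ws)"
      by (simp only: scl_mult mult.assoc map_append prod_list.append)
    then show ?case using prod \<open>set vs \<subseteq> Bo\<close> \<open>m \<le> length vs\<close> filt.prod[of "vs @ ws" "m + n" "c * d"] by simp
  qed (auto intro: filt.ker filt.add ker_mult_left simp: distrib_left)
qed (auto intro: filt.ker filt.add ker_mult_right simp: distrib_right)

lemma filt_sum: "finite A \<Longrightarrow> (\<And>v. v \<in> A \<Longrightarrow> f v \<in> filt n) \<Longrightarrow> sum f A \<in> filt n"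
  by (induction A rule: finite_induct) (auto intro: filt.ker filt.add)

lemma lift_filt: "v \<in> Bo \<Longrightarrow> lift v \<in> filt 1"
  using filt.prod[of "[v]" 1 1] by simp

lemma omega_filt: "t \<in> omega \<Longrightarrow> t \<in> filt 1"
proof -
  assume "t \<in> omega"
  then obtain A a where A: "finite A" "A \<subseteq> Bo" "t - (\<Sum>v\<in>A. scl (a v) * lift v) \<in> ker"
    using Bo_generates by blast
  show "t \<in> filt 1"
    by (rule filt_cong[OF A(3)], intro filt_sum filt_scl lift_filt A(1)) (use A(2) in blast)
qed

lemma gen_filt: "gen x \<in> filt 1"
  by (rule omega_filt) (simp add: omega_def)

lemma word_filt: "word xs \<in> filt (length xs)"
proof (induction xs)
  case Nil
  show ?case using filt.prod[of "[]" 0 1] by (simp add: word_Nil)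
next
  case (Cons x xs)
  then show ?case using filt_mult[OF gen_filt[of x] Cons.IH] by (simp add: word_Cons)
qed

lemma power_filt: "t \<in> filt m \<Longrightarrow> t ^ n \<in> filt (m * n)"
proof (induction n)
  case 0
  show ?case using filt.prod[of "[]" 0 1] by simp
next
  case (Suc n)
  then show ?case using filt_mult[of t m "t ^ n" "m * n"] by simp
qed

lemma filt_nilpotent: "\<exists>k. filt k \<subseteq> ker"
proof -
  obtain k where k: "\<And>ts. set ts \<subseteq> omega \<Longrightarrow> length ts = k \<Longrightarrow> prod_list ts \<in> ker"
    using omega_nilpotent by blast
  have "t \<in> ker" if "t \<in> filt k" for t
    using that
  proof (induction rule: filt.induct)
    case (prod vs c)
    have "prod_list (take k (map lift vs)) \<in> ker"
      using prod lift_omega by (intro k) (auto simp: take_map dest: in_set_takeD)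
    then have "lifts vs \<in> ker"
      using ker_mult_right by (metis append_take_drop_id prod_list.append)
    then show ?case by (rule ker_scl)
  qed (auto intro: ker_add)
  then show ?thesis by blast
qed

text \<open>Multiplicativity of the basis passes to longer products. The empty product is excluded
  because it is \<open>1\<close>, which lies outside \<open>omega\<close>.\<close>

lemma lifts_cases:
  assumes "set vs \<subseteq> Bo" "vs \<noteq> []"
  shows "lifts vs \<in> ker \<or> (\<exists>u\<in>Bo. lifts vs - lift u \<in> ker)"
  using assms(2,1)
proof (induction vs rule: list_nonempty_induct)
  case (single v)
  then show ?case by (auto intro!: bexI[of _ v])
next
  case (cons v vs)
  have v: "v \<in> Bo" using cons.prems by simp
  consider "lifts vs \<in> ker" | u where "u \<in> Bo" "lifts vs - lift u \<in> ker" using cons by auto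
  then show ?case
  proof cases
    case 1
    then show ?thesis using ker_mult_left by simp
  next
    case 2
    have eq: "lift v * lifts vs - lift v * lift u \<in> ker"
      using ker_mult_left[OF 2(2), of "lift v"] by (simp add: right_diff_distrib)
    from lift_mult[OF v 2(1)] show ?thesis
    proof
      assume "lift v * lift u \<in> ker"
      then show ?thesis using ker_add[OF eq] by fastforce
    next
      assume "\<exists>w\<in>Bo. lift v * lift u - lift w \<in> ker"
      then show ?thesis using ker_add[OF eq] by fastforce
    qed
  qed
qed

text \<open>Products of basis elements are, modulo \<open>ker\<close>, zero or basis elements, so a basis element
  that occurs in an element of \<open>filt n\<close> is itself a product of \<open>n\<close> basis elements.\<close>

lemma filt_coord:
  assumes "t \<in> filt n" "n \<ge> 1" "u \<in> B" "coord u t \<noteq> 0"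
  shows "\<exists>vs. set vs \<subseteq> Bo \<and> n \<le> length vs \<and> lift u - lifts vs \<in> ker"
  using assms(1,4)
proof (induction rule: filt.induct)
  case (ker t)
  then show ?case by (simp add: coord_ker)
next
  case (prod vs c)
  have "vs \<noteq> []" using prod assms(2) by auto
  have nz: "coord u (lifts vs) \<noteq> 0" using prod(3) by (simp add: coord_scl)
  then have "lifts vs \<notin> ker" using coord_ker by blast
  then obtain w where w: "w \<in> Bo" "lifts vs - lift w \<in> ker" using lifts_cases prod(1) \<open>vs \<noteq> []\<close> by blast
  then have "coord u (lift w) \<noteq> 0" using nz coord_cong by metis
  then have "u = w" using coord_lift[of w u] w(1) Bo_subset by (auto split: if_splits)
  then have "lift u - lifts vs \<in> ker" using ker_minus[OF w(2)] by simp
  then show ?case using prod by blast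
next
  case (add s t)
  then show ?case by (cases "coord u s = 0") (auto simp: coord_add)
qed

text \<open>Consequently \<open>filt n\<close> is spanned modulo \<open>ker\<close> by the basis
  elements it contains, and coordinates at other basis elements vanish on it.\<close>

lemma filt_coord_lift:
  assumes "t \<in> filt n" "n \<ge> 1" "u \<in> B" "coord u t \<noteq> 0"
  shows "lift u \<in> filt n"
proof -
  obtain vs where vs: "set vs \<subseteq> Bo" "n \<le> length vs" "lift u - lifts vs \<in> ker"
    using filt_coord[OF assms] by blast
  then show ?thesis using filt_cong[OF vs(3)] filt.prod[OF vs(1,2), of 1] by simp
qed

text \<open>\<open>L\<close> maps onto the augmentation ideal modulo its square: longer words lie in
  \<open>filt 2\<close>, and sums and multiples of generators are again generators modulo
  \<open>ker\<close>. As before, the scalar part is split off to make the induction work.\<close>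

lemma omega_gen_filt: "t \<in> omega \<Longrightarrow> \<exists>x. t - gen x \<in> filt 2"
proof -
  have "\<exists>x. t - scl (aug t) - gen x \<in> filt 2" for t
  proof (induction t rule: free_alg_induct)
    case zero
    show ?case using gen_zero_ker ker_minus by (intro exI[of _ 0]) (simp add: filt.ker)
  next
    case (add c xs t)
    then obtain x where x: "t - scl (aug t) - gen x \<in> filt 2" by blast
    let ?w = "scl c * word xs"
    have "\<exists>y. ?w - scl (aug ?w) - gen y \<in> filt 2"
    proof (cases xs)
      case Nil
      then show ?thesis using gen_zero_ker ker_minus
        by (intro exI[of _ 0]) (simp add: word_Nil filt.ker)
    next
      case (Cons z zs)
      show ?thesis
      proof (cases zs)
        case Nil
        then show ?thesis using Cons ker_minus[OF gen_scale_ker[of c z]]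
          by (intro exI[of _ "scale c z"]) (simp add: word_Cons word_Nil filt.ker)
      next
        case (Cons z' zs')
        have "?w \<in> filt 2"
          using filt_scl[OF filt_antimono[OF word_filt[of xs], of 2], of c] \<open>xs = z # zs\<close> Cons by simp
        moreover have "gen 0 \<in> filt 2" using gen_zero_ker by (rule filt.ker)
        ultimately have "?w - gen 0 \<in> filt 2" by (rule filt_diff)
        then show ?thesis using \<open>xs = z # zs\<close> by (intro exI[of _ 0]) (simp add: word_Cons)
      qed
    qed
    then obtain y where y: "?w - scl (aug ?w) - gen y \<in> filt 2" by blast
    have "?w + t - scl (aug (?w + t)) - gen (y + x)
      = (?w - scl (aug ?w) - gen y) + (t - scl (aug t) - gen x) - (gen (y + x) - (gen y + gen x))"
      by (simp add: single_add algebra_simps)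
    then have "?w + t - scl (aug (?w + t)) - gen (y + x) \<in> filt 2"
      using filt_diff[OF filt.add[OF y x] filt.ker[OF gen_add_ker[of y x]]] by metis
    then show ?case by blast
  qed
  from this[of t] show "t \<in> omega \<Longrightarrow> \<exists>x. t - gen x \<in> filt 2" by (simp add: omega_def)
qed

lemma gen_pmap_filt: "gen (pmap x) \<in> filt CHAR('f)"
  using filt_cong[OF _ power_filt[OF gen_filt[of x], of "CHAR('f)"]] ker_minus[OF gen_pmap_ker[of x]] by simp

end

section \<open>A four-dimensional test representation\<close>

locale quadratic_test = restricted_lie_algebra scale bracket pmap
  for scale :: "'f::field \<Rightarrow> 'l::ab_group_add \<Rightarrow> 'l" and bracket pmap +
  fixes f g :: "'l \<Rightarrow> 'f"
  assumes f_add: "f (x + y) = f x + f y" and g_add: "g (x + y) = g x + g y"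
    and f_scale: "f (scale c x) = c * f x" and g_scale: "g (scale c x) = c * g x"
    and f_bracket: "f (bracket x y) = 0" and g_bracket: "g (bracket x y) = 0"
    and f_pmap: "f (pmap x) = 0" and g_pmap: "g (pmap x) = 0"
begin

text \<open>The regular representation of \<open>F[s, t]/(s\<^sup>2, t\<^sup>2)\<close> in the basis \<open>1, s, t, st\<close>, with
  \<open>x\<close> acting as \<open>f x s + g x t\<close>.\<close>

definition test_rep :: "'l \<Rightarrow> ('f \<times> 'f \<times> 'f \<times> 'f) endo" where
  "test_rep x = Endo (\<lambda>(a, b, c, d). (0, f x * a, g x * a, g x * b + f x * c))"

definition test_scalar :: "'f \<Rightarrow> ('f \<times> 'f \<times> 'f \<times> 'f) endo" where
  "test_scalar e = Endo (\<lambda>(a, b, c, d). (e * a, e * b, e * c, e * d))"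

lemma app_test_rep: "app (test_rep x) (a, b, c, d) = (0, f x * a, g x * a, g x * b + f x * c)"
  unfolding test_rep_def by (subst app_Endo) (auto simp: algebra_simps)

lemma app_test_scalar: "app (test_scalar e) (a, b, c, d) = (e * a, e * b, e * c, e * d)"
  unfolding test_scalar_def by (subst app_Endo) (auto simp: algebra_simps)

text \<open>The square of \<open>f x s + g x t\<close> is \<open>2 (f x) (g x) s t\<close>, which is
  zero for \<open>p = 2\<close>; for larger \<open>p\<close> the degree is at least three. This
  makes the p-map act as zero, as required.\<close>

lemma test_rep_power: "test_rep x ^ CHAR('f) = 0"
proof (rule endo_eqI)
  fix v :: "'f \<times> 'f \<times> 'f \<times> 'f"
  obtain a b c d where v: "v = (a, b, c, d)" by (cases v)
  have p: "CHAR('f) \<ge> 2" using prime_CHAR_semidom char_pos prime_ge_2_nat by blast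
  show "app (test_rep x ^ CHAR('f)) v = app 0 v"
  proof (cases "CHAR('f) = 2")
    case True
    have "of_nat CHAR('f) * (f x * g x * a) = (0 :: 'f)" by simp
    then have "g x * (f x * a) + f x * (g x * a) = 0"
      unfolding True by (simp add: algebra_simps mult_2)
    then show ?thesis unfolding True v
      by (simp add: power2_eq_square app_test_rep zero_prod_def)
  next
    case False
    then obtain n where n: "CHAR('f) = n + 3" using p by (metis add.commute le_Suc_ex le_neq_implies_less
      Suc_leI eval_nat_numeral(3))
    show ?thesis unfolding n power_add v
      by (simp add: power3_eq_cube app_test_rep flip: zero_prod_def)
  qed
qed

lemma restricted_evaluation_test: "restricted_evaluation scale bracket pmap test_scalar test_rep"
proof
  fix a b c :: 'f and x y :: 'l
  show "test_scalar 1 = 1" by (rule endo_eqI) (auto simp: app_test_scalar)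
  show "test_scalar (a + b) = test_scalar a + test_scalar b"
    by (rule endo_eqI) (auto simp: app_test_scalar algebra_simps)
  show "test_scalar (a * b) = test_scalar a * test_scalar b"
    by (rule endo_eqI) (auto simp: app_test_scalar)
  show "test_scalar a * test_rep x = test_rep x * test_scalar a"
    by (rule endo_eqI) (auto simp: app_test_scalar app_test_rep algebra_simps)
  show "test_rep (x + y) = test_rep x + test_rep y"
    by (rule endo_eqI) (auto simp: app_test_rep f_add g_add algebra_simps)
  show "test_rep (scale c x) = test_scalar c * test_rep x"
    by (rule endo_eqI) (auto simp: app_test_rep app_test_scalar f_scale g_scale algebra_simps)
  show "test_rep (bracket x y) = test_rep x * test_rep y - test_rep y * test_rep x"
    by (rule endo_eqI) (auto simp: app_test_rep f_bracket g_bracket algebra_simps zero_prod_def)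
  show "test_rep (pmap x) = test_rep x ^ CHAR('f)"
    unfolding test_rep_power by (rule endo_eqI) (auto simp: app_test_rep f_pmap g_pmap zero_prod_def)
qed

definition test :: "('l, 'f) free_alg \<Rightarrow> 'f \<times> 'f \<times> 'f \<times> 'f \<Rightarrow> 'f \<times> 'f \<times> 'f \<times> 'f" where
  "test t = app (evaluation.eval test_scalar test_rep t)"

lemma test_simps [simp]:
  "test (s + t) v = test s v + test t v" "test (s - t) v = test s v - test t v"
  "test (s * t) v = test s (test t v)" "test (scl c) v = app (test_scalar c) v"
  "test (gen x) v = app (test_rep x) v" "test 0 v = 0" "test 1 v = v"
  "test t (v + w) = test t v + test t w" "test t 0 = 0"
proof -
  interpret restricted_evaluation scale bracket pmap test_scalar test_rep
    by (rule restricted_evaluation_test)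
  show "test (s + t) v = test s v + test t v" "test (s - t) v = test s v - test t v"
    "test (s * t) v = test s (test t v)" "test (scl c) v = app (test_scalar c) v"
    "test (gen x) v = app (test_rep x) v" "test 0 v = 0" "test 1 v = v"
    "test t (v + w) = test t v + test t w" "test t 0 = 0"
    by (simp_all add: test_def)
qed

lemma test_ker: "t \<in> ker \<Longrightarrow> test t v = 0"
  using restricted_evaluation.eval_ker[OF restricted_evaluation_test] by (simp add: test_def)

text \<open>The powers of the ideal \<open>(s, t)\<close>; the cube is zero because
  \<open>st\<close> spans the highest degree.\<close>

fun level :: "nat \<Rightarrow> ('f \<times> 'f \<times> 'f \<times> 'f) set" where
  "level 0 = UNIV"
| "level (Suc 0) = {(a, b, c, d). a = 0}"
| "level (Suc (Suc 0)) = {(a, b, c, d). a = 0 \<and> b = 0 \<and> c = 0}"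
| "level (Suc (Suc (Suc n))) = {0}"

lemma level_zero [simp]: "0 \<in> level n"
  by (cases n rule: level.cases) (auto simp: zero_prod_def)

lemma level_add: "v \<in> level n \<Longrightarrow> w \<in> level n \<Longrightarrow> v + w \<in> level n"
  by (cases n rule: level.cases) (auto simp: zero_prod_def)

lemma level_mono: "v \<in> level (Suc n) \<Longrightarrow> v \<in> level n"
  by (cases n rule: level.cases) (auto simp: zero_prod_def)

lemma level_antimono: "v \<in> level n \<Longrightarrow> m \<le> n \<Longrightarrow> v \<in> level m"
  by (induction n) (auto simp: le_Suc_eq dest: level_mono)

lemma level_scalar: "v \<in> level n \<Longrightarrow> app (test_scalar c) v \<in> level n"
  by (cases n rule: level.cases) (auto simp: app_test_scalar zero_prod_def)

lemma level_test_rep: "v \<in> level n \<Longrightarrow> app (test_rep x) v \<in> level (Suc n)"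
  by (cases v; cases n rule: level.cases) (auto simp: app_test_rep zero_prod_def)

lemma level_word: "v \<in> level n \<Longrightarrow> test (word xs) v \<in> level n"
  by (induction xs) (auto simp: word_Nil word_Cons intro: level_mono level_test_rep)

lemma level_omega:
  assumes t: "t \<in> omega" and v: "v \<in> level n"
  shows "test t v \<in> level (Suc n)"
proof -
  have *: "test (t - scl (aug t)) v \<in> level (Suc n)" for t
  proof (induction t rule: free_alg_induct)
    case (add c xs t)
    have "test (scl c * word xs - scl (aug (scl c * word xs))) v \<in> level (Suc n)"
    proof (cases xs)
      case Nil
      then show ?thesis by (simp add: word_Nil)
    next
      case (Cons y ys)
      have "test (scl c * word xs) v \<in> level (Suc n)"
        unfolding Cons using v by (simp add: word_Cons level_scalar level_test_rep level_word)
      then show ?thesis by (simp add: Cons word_Cons)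
    qed
    from level_add[OF this add]
    have "test ((scl c * word xs - scl (aug (scl c * word xs))) + (t - scl (aug t))) v \<in> level (Suc n)"
      by (simp only: test_simps(1))
    moreover have "(scl c * word xs - scl (aug (scl c * word xs))) + (t - scl (aug t))
      = (scl c * word xs + t) - scl (aug (scl c * word xs + t))"
      by (simp add: single_add)
    ultimately show ?case by metis
  qed simp
  have "t - scl (aug t) = t" using t by (simp add: omega_def)
  then show ?thesis using *[of t] by (simp only:)
qed

end

section \<open>Commutativity of the basis\<close>

context fm_basis_lie_algebra
begin

section \<open>Consequences of powerfulness\<close>

lemma restricted_subalgebra_filt: "restricted_subalgebra {x. gen x \<in> filt 3}"
  unfolding restricted_subalgebra_def subspace_def
proof (intro conjI ballI allI impI)
  show "0 \<in> {x. gen x \<in> filt 3}" using gen_zero_ker by (simp add: filt.ker)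
next
  fix x y assume *: "x \<in> {x. gen x \<in> filt 3}" "y \<in> {x. gen x \<in> filt 3}"
  then show "x + y \<in> {x. gen x \<in> filt 3}"
    using filt_cong[OF gen_add_ker[of x y] filt.add] by blast
  have "gen x * gen y - gen y * gen x \<in> filt 3"
    using * filt_mult[of "gen x" 3 "gen y" 3] filt_mult[of "gen y" 3 "gen x" 3]
    by (auto intro!: filt_diff intro: filt_antimono)
  then show "bracket x y \<in> {x. gen x \<in> filt 3}"
    using filt_diff[OF _ filt.ker[OF gen_bracket_ker[of x y]]] by fastforce
next
  fix x c assume "x \<in> {x. gen x \<in> filt 3}"
  then show "scale c x \<in> {x. gen x \<in> filt 3}"
    using filt_cong[OF gen_scale_ker[of c x] filt_scl] by blast
next
  fix x assume "x \<in> {x. gen x \<in> filt 3}"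
  then have "gen x ^ CHAR('f) \<in> filt (3 * CHAR('f))" using power_filt by blast
  then have "gen x ^ CHAR('f) \<in> filt 3" using char_pos by (auto intro: filt_antimono)
  then show "pmap x \<in> {x. gen x \<in> filt 3}"
    using filt_cong[of "gen (pmap x)" "gen x ^ CHAR('f)" 3] ker_minus[OF gen_pmap_ker[of x]] by simp
qed

text \<open>The bound 3 explains the two cases of \<open>powerful\<close>: the iterate
  \<open>i = 1\<close> reaches it for odd \<open>p\<close>, whereas \<open>p = 2\<close> needs
  \<open>i = 2\<close>.\<close>

lemma pmap_subalgebra_filt:
  assumes "CHAR('f) ^ i \<ge> 3"
  shows "pmap_subalgebra i \<subseteq> {x. gen x \<in> filt 3}"
  unfolding pmap_subalgebra_def
proof (rule hull_minimal)
  show "range (pmap ^^ i) \<subseteq> {x. gen x \<in> filt 3}"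
  proof clarify
    fix x
    have "gen x ^ (CHAR('f) ^ i) \<in> filt 3"
      using power_filt[OF gen_filt[of x], of "CHAR('f) ^ i"] assms by (auto intro: filt_antimono)
    then show "gen ((pmap ^^ i) x) \<in> filt 3"
      using filt_cong[of "gen ((pmap ^^ i) x)" "gen x ^ (CHAR('f) ^ i)" 3]
        ker_minus[OF gen_power_ker[of x i]] by simp
  qed
qed (rule restricted_subalgebra_filt)

lemma gen_bracket_filt:
  assumes powerful
  shows "gen (bracket x y) \<in> filt 3"
proof -
  have xy: "bracket x y \<in> derived_subalgebra"
    unfolding derived_subalgebra_def by (intro span_base) blast
  from assms consider "CHAR('f) = 2" "derived_subalgebra \<subseteq> pmap_subalgebra 2"
    | "CHAR('f) > 2" "derived_subalgebra \<subseteq> pmap_subalgebra 1"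
    unfolding powerful_def by blast
  then show ?thesis
  proof cases
    case 1
    then show ?thesis using xy pmap_subalgebra_filt[of 2] by auto
  next
    case 2
    then show ?thesis using xy pmap_subalgebra_filt[of 1] by auto
  qed
qed

lemma commutator_filt:
  assumes powerful "s \<in> omega" "t \<in> omega"
  shows "s * t - t * s \<in> filt 3"
proof -
  obtain x y where xy: "s - gen x \<in> filt 2" "t - gen y \<in> filt 2" using omega_gen_filt assms by blast
  define a b where "a = s - gen x" and "b = t - gen y"
  have ab: "a \<in> filt 2" "b \<in> filt 2" "s \<in> filt 1" using xy assms omega_filt by (auto simp: a_def b_def)
  \<comment> \<open>Only the commutator of the generators depends on powerfulness; each remaining
    product has a factor in \<open>filt 2\<close> and another in \<open>filt 1\<close>.\<close>
  have "s * t - t * s = (gen x * gen y - gen y * gen x) + (a * gen y - gen y * a) + (s * b - b * s)"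
    unfolding a_def b_def by (simp add: algebra_simps)
  moreover have "gen x * gen y - gen y * gen x \<in> filt 3"
    using filt_cong[OF gen_bracket_ker gen_bracket_filt[OF assms(1)]] .
  moreover have "a * gen y - gen y * a \<in> filt 3" "s * b - b * s \<in> filt 3"
    using filt_mult[OF ab(1) gen_filt[of y]] filt_mult[OF gen_filt[of y] ab(1)]
      filt_mult[OF ab(3,2)] filt_mult[OF ab(2,3)]
    by (auto intro!: filt_diff simp: numeral_3_eq_3)
  ultimately show ?thesis by (simp only: filt.add)
qed

text \<open>The coordinate functionals of \<open>u\<close> and \<open>v\<close> vanish on
  \<open>filt 2\<close>, hence on brackets and on p-map values, so they define a test
  representation. It kills \<open>filt 3\<close>, while \<open>lift u * lift v\<close> sends
  \<open>1\<close> to \<open>st\<close>.\<close>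

lemma mult_generators_notin_filt:
  assumes powerful and u: "u \<in> Bo" "lift u \<notin> filt 2" and v: "v \<in> Bo" "lift v \<notin> filt 2" and uv: "u \<noteq> v"
  shows "lift u * lift v \<notin> filt 3"
proof
  assume prod: "lift u * lift v \<in> filt 3"
  have uB: "u \<in> B" "v \<in> B" using u v Bo_subset by auto
  have coord_filt: "coord u t = 0" "coord v t = 0" if "t \<in> filt 2" for t
    using filt_coord_lift[OF that] u v uB by auto
  have p: "CHAR('f) \<ge> 2" using prime_CHAR_semidom char_pos prime_ge_2_nat by blast
  interpret quadratic_test scale bracket pmap "\<lambda>x. coord u (gen x)" "\<lambda>x. coord v (gen x)"
  proof
    fix x y c
    show "coord u (gen (x + y)) = coord u (gen x) + coord u (gen y)"
      "coord v (gen (x + y)) = coord v (gen x) + coord v (gen y)"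
      using coord_cong[OF gen_add_ker[of x y]] by (simp_all add: coord_add)
    show "coord u (gen (scale c x)) = c * coord u (gen x)"
      "coord v (gen (scale c x)) = c * coord v (gen x)"
      using coord_cong[OF gen_scale_ker[of c x]] by (simp_all add: coord_scl)
    show "coord u (gen (bracket x y)) = 0" "coord v (gen (bracket x y)) = 0"
      using coord_filt filt_antimono[OF gen_bracket_filt[OF assms(1)], of 2] by auto
    show "coord u (gen (pmap x)) = 0" "coord v (gen (pmap x)) = 0"
      using coord_filt filt_antimono[OF gen_pmap_filt p] by auto
  qed
  have level_filt: "test t w \<in> level (n + m)" if "t \<in> filt n" "w \<in> level m" for t n w m
    using that
  proof (induction rule: filt.induct)
    case (prod vs c)
    have "test (lifts vs) w \<in> level (length vs + m)" if "set vs \<subseteq> Bo" for vs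
      using that by (induction vs) (use prod(3) in \<open>auto intro!: level_omega lift_omega\<close>)
    then have 1: "test (lifts vs) w \<in> level (length vs + m)" using prod(1) by blast
    have "test (lifts vs) w \<in> level (n + m)" by (rule level_antimono[OF 1]) (use prod(2) in simp)
    then show ?case by (simp add: level_scalar)
  qed (auto simp: test_ker intro: level_add)
  obtain x where x: "lift u - gen x \<in> filt 2" using omega_gen_filt[OF lift_omega[OF u(1)]] by blast
  obtain y where y: "lift v - gen y \<in> filt 2" using omega_gen_filt[OF lift_omega[OF v(1)]] by blast
  have fx: "coord u (gen x) = 1"
    using coord_filt(1)[OF x] coord_lift[OF uB(1), of u] by (simp add: coord_diff)
  have fy: "coord u (gen y) = 0" "coord v (gen y) = 1"
    using coord_filt[OF y] coord_lift[OF uB(2)] uv by (simp_all add: coord_diff)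
  have "test (lift v - gen y) (1, 0, 0, 0) \<in> level 2" using level_filt[OF y, of _ 0] by simp
  \<comment> \<open>The coefficient \<open>d\<close> of \<open>st\<close> remains unknown; it does
    no harm, since the next factor from \<open>omega\<close> annihilates \<open>st\<close>.\<close>
  then obtain d where d: "test (lift v - gen y) (1, 0, 0, 0) = (0, 0, 0, d)"
    by (auto simp: numeral_2_eq_2)
  have "test (lift v) (1, 0, 0, 0) = test (lift v - gen y) (1, 0, 0, 0) + test (gen y) (1, 0, 0, 0)"
    by simp
  also have "\<dots> = (0, 0, 1, d)" unfolding d by (simp add: app_test_rep fy)
  finally have v1: "test (lift v) (1, 0, 0, 0) = (0, 0, 1, d)" .
  have "test (lift u - gen x) (0, 0, 1, d) \<in> level 3"
    using level_filt[OF x, of "(0, 0, 1, d)" 1] by (simp add: numeral_3_eq_3)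
  then have d': "test (lift u - gen x) (0, 0, 1, d) = 0" by (simp add: numeral_3_eq_3)
  have "test (lift u) (0, 0, 1, d) = test (lift u - gen x) (0, 0, 1, d) + test (gen x) (0, 0, 1, d)"
    by simp
  also have "\<dots> = (0, 0, 0, 1)" unfolding d' by (simp add: app_test_rep fx)
  finally have "test (lift u * lift v) (1, 0, 0, 0) = (0, 0, 0, 1)" using v1 by simp
  moreover have "test (lift u * lift v) (1, 0, 0, 0) = 0"
    using level_filt[OF prod, of "(1, 0, 0, 0)" 0] by (simp add: numeral_3_eq_3)
  ultimately show False by (simp add: zero_prod_def)
qed

lemma generators_commute:
  assumes powerful and u: "u \<in> Bo" "lift u \<notin> filt 2" and v: "v \<in> Bo" "lift v \<notin> filt 2"
  shows "lift u * lift v - lift v * lift u \<in> ker"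
proof (rule ccontr)
  assume nc: "lift u * lift v - lift v * lift u \<notin> ker"
  let ?P = "lift u * lift v" and ?Q = "lift v * lift u"
  have uv: "u \<noteq> v" using nc by auto
  have PQ: "?P - ?Q \<in> filt 3" by (intro commutator_filt assms lift_omega)
  \<comment> \<open>If \<open>?P\<close> is nonzero, it is a basis element different from
    \<open>?Q\<close>, so it occurs in \<open>?P - ?Q\<close> with coordinate 1 and lies in
    \<open>filt 3\<close>. A vanishing \<open>?P\<close> is in \<open>filt 3\<close> anyway and
    leads to the same contradiction.\<close>
  have "?P \<in> filt 3"
  proof (cases "?P \<in> ker")
    case False
    then obtain w where w: "w \<in> Bo" "?P - lift w \<in> ker" using lift_mult u(1) v(1) by blast
    have wB: "w \<in> B" using w Bo_subset by blast
    have "coord w ?P = 1" using coord_cong[OF w(2)] coord_lift[OF wB, of w] by simp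
    moreover have "coord w ?Q = 0"
    proof (cases "?Q \<in> ker")
      case False
      then obtain w' where w': "w' \<in> Bo" "?Q - lift w' \<in> ker" using lift_mult u(1) v(1) by blast
      have "w' \<noteq> w"
      proof
        assume "w' = w"
        then have "?P - ?Q \<in> ker" using ker_diff[OF w(2)] w'(2) by fastforce
        then show False using nc by simp
      qed
      moreover have "w' \<in> B" using w' Bo_subset by blast
      ultimately show ?thesis using coord_cong[OF w'(2)] coord_lift[of w' w] by simp
    qed (rule coord_ker)
    ultimately have "coord w (?P - ?Q) \<noteq> 0" by (simp add: coord_diff)
    then have "lift w \<in> filt 3" using filt_coord_lift[OF PQ _ wB] by simp
    then show ?thesis using filt_cong[OF w(2)] by blast
  qed (rule filt.ker)
  then show False using mult_generators_notin_filt[OF assms uv] by blast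
qed

text \<open>Among the factorizations of \<open>u\<close> into basis elements take a longest one;
  nilpotency bounds the length. A factor in \<open>filt 2\<close> could be split into at least two
  basis elements, giving a longer factorization.\<close>

lemma basis_product_of_generators:
  assumes "u \<in> Bo"
  shows "\<exists>vs. set vs \<subseteq> {v \<in> Bo. lift v \<notin> filt 2} \<and> lift u - lifts vs \<in> ker"
proof -
  let ?P = "\<lambda>vs. set vs \<subseteq> Bo \<and> lift u - lifts vs \<in> ker"
  obtain k where k: "filt k \<subseteq> ker" using filt_nilpotent by blast
  have bound: "length vs < k" if "?P vs" for vs
  proof (rule ccontr)
    assume "\<not> length vs < k"
    then have "lifts vs \<in> filt k" using that filt.prod[of vs k 1] by simp
    then have "lift u \<in> ker" using filt_cong that filt.ker k ker_add by fastforce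
    then show False using lift_notin_ker assms Bo_subset by blast
  qed
  have "?P [u]" using assms by simp
  then obtain vs where vs: "?P vs" and max: "\<And>ws. ?P ws \<Longrightarrow> length ws \<le> length vs"
    using ex_has_greatest_nat[of ?P "[u]" length k] bound by blast
  have "lift v \<notin> filt 2" if v: "v \<in> set vs" for v
  proof
    assume v2: "lift v \<in> filt 2"
    have vB: "v \<in> B" using v vs Bo_subset by blast
    then obtain ws where ws: "set ws \<subseteq> Bo" "2 \<le> length ws" "lift v - lifts ws \<in> ker"
      using filt_coord[OF v2 _ vB] coord_lift[OF vB, of v] by auto
    obtain xs ys where xy: "vs = xs @ v # ys" using v by (meson split_list)
    have "lifts xs * (lift v - lifts ws) * lifts ys \<in> ker"
      by (intro ker_mult_left ker_mult_right ws)
    moreover have "lift u - lifts (xs @ ws @ ys) = (lift u - lifts vs) + lifts xs * (lift v - lifts ws) * lifts ys"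
      unfolding xy by (simp add: algebra_simps)
    ultimately have "lift u - lifts (xs @ ws @ ys) \<in> ker" using vs ker_add by metis
    moreover have "set (xs @ ws @ ys) \<subseteq> Bo" using vs ws xy by auto
    ultimately have "length (xs @ ws @ ys) \<le> length vs" by (intro max) simp
    then show False using ws(2) xy by simp
  qed
  then show ?thesis using vs by blast
qed

section \<open>From commuting generators to a commutative augmentation ideal\<close>

lemma commute_mult_left:
  assumes "a * c - c * a \<in> ker" "b * c - c * b \<in> ker"
  shows "(a * b) * c - c * (a * b) \<in> ker"
proof -
  have "(a * b) * c - c * (a * b) = a * (b * c - c * b) + (a * c - c * a) * b"
    by (simp add: algebra_simps)
  then show ?thesis using ker_add[OF ker_mult_left[OF assms(2)] ker_mult_right[OF assms(1)]] by metis
qed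

lemma commute_sym: "a * b - b * a \<in> ker \<Longrightarrow> b * a - a * b \<in> ker"
  using ker_minus[of "a * b - b * a"] by simp

lemma commute_cong:
  assumes "a - a' \<in> ker" "a' * b - b * a' \<in> ker"
  shows "a * b - b * a \<in> ker"
proof -
  have "a * b - b * a = (a' * b - b * a') + ((a - a') * b - b * (a - a'))"
    by (simp add: algebra_simps)
  then show ?thesis
    using ker_add[OF assms(2) ker_diff[OF ker_mult_right[OF assms(1)] ker_mult_left[OF assms(1)]]] by metis
qed

lemma commute_lifts:
  "(\<And>v. v \<in> set vs \<Longrightarrow> lift v * c - c * lift v \<in> ker) \<Longrightarrow> lifts vs * c - c * lifts vs \<in> ker"
  by (induction vs) (auto intro!: commute_mult_left)

lemma basis_commute:
  assumes powerful "u \<in> Bo" "v \<in> Bo"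
  shows "lift u * lift v - lift v * lift u \<in> ker"
proof -
  let ?G = "{v \<in> Bo. lift v \<notin> filt 2}"
  obtain us where us: "set us \<subseteq> ?G" "lift u - lifts us \<in> ker"
    using basis_product_of_generators assms(2) by blast
  obtain vs where vs: "set vs \<subseteq> ?G" "lift v - lifts vs \<in> ker"
    using basis_product_of_generators assms(3) by blast
  have 1: "lifts vs * lift w - lift w * lifts vs \<in> ker" if "w \<in> ?G" for w
    by (rule commute_lifts) (use that vs(1) generators_commute[OF assms(1)] in blast)
  have 2: "lifts us * lifts vs - lifts vs * lifts us \<in> ker"
    by (rule commute_lifts, rule commute_sym, rule 1) (use us(1) in blast)
  show ?thesis
    by (rule commute_cong[OF us(2)], rule commute_sym, rule commute_cong[OF vs(2)], rule commute_sym, rule 2)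
qed

lemma omega_commute:
  assumes powerful "s \<in> omega" "t \<in> omega"
  shows "s * t - t * s \<in> ker"
proof -
  \<comment> \<open>One-sided linear extension from the basis, with arbitrary \<open>c\<close>, so
    that it can be applied once in each argument.\<close>
  have 1: "s * c - c * s \<in> ker" if c: "\<And>v. v \<in> Bo \<Longrightarrow> lift v * c - c * lift v \<in> ker" and s: "s \<in> omega" for s c
  proof -
    obtain A a where A: "finite A" "A \<subseteq> Bo" "s - (\<Sum>v\<in>A. scl (a v) * lift v) \<in> ker"
      using Bo_generates s by blast
    have "(\<Sum>v\<in>A. scl (a v) * lift v) * c - c * (\<Sum>v\<in>A. scl (a v) * lift v) \<in> ker"
      using A(1,2)
    proof (induction A rule: finite_induct)
      case (insert v A)
      let ?S = "\<Sum>v\<in>A. scl (a v) * lift v"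
      have "c * (scl (a v) * lift v) = scl (a v) * (c * lift v)"
        by (simp only: mult.assoc[symmetric] scl_commute[of "a v" c])
      then have "(\<Sum>v\<in>insert v A. scl (a v) * lift v) * c - c * (\<Sum>v\<in>insert v A. scl (a v) * lift v)
         = scl (a v) * (lift v * c - c * lift v) + (?S * c - c * ?S)"
        using insert.hyps by (simp add: algebra_simps)
      moreover have "scl (a v) * (lift v * c - c * lift v) \<in> ker" using insert c by (intro ker_scl) auto
      moreover have "?S * c - c * ?S \<in> ker" using insert by blast
      ultimately show ?case by (simp only: ker_add)
    qed simp
    then show ?thesis by (rule commute_cong[OF A(3)])
  qed
  have "lift v * t - t * lift v \<in> ker" if "v \<in> Bo" for v
    using 1[of "lift v" t] basis_commute[OF assms(1) _ that] assms(3) commute_sym by blast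
  then show ?thesis using 1[of t s] assms(2) by blast
qed

lemma powerful_imp_abelian:
  assumes powerful
  shows "bracket x y = 0"
  by (rule commutative_imp_abelian, rule omega_commute[OF assms]) (simp_all add: omega_def)

end

theorem theorem2:
  fixes scale :: "'f::field \<Rightarrow> 'l::ab_group_add \<Rightarrow> 'l"
    and bracket :: "'l \<Rightarrow> 'l \<Rightarrow> 'l"
    and pmap :: "'l \<Rightarrow> 'l"
  assumes "CHAR('f) > 0"
    and "restricted_lie_algebra scale bracket pmap"
    and "\<exists>Basis. finite_dimensional_vector_space scale Basis"
    and "restricted_lie_algebra.p_nilpotent pmap"
    and "\<not> lie_algebra.abelian bracket"
    and "restricted_lie_algebra.powerful scale bracket pmap"
  shows "\<nexists>B. filtered_multiplicative_basis (class_ring :: 'f ring)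
    (restricted_lie_algebra.restricted_enveloping_algebra scale bracket pmap) B"
proof
  assume "\<exists>B. filtered_multiplicative_basis (class_ring :: 'f ring)
    (restricted_lie_algebra.restricted_enveloping_algebra scale bracket pmap) B"
  then obtain B where B: "filtered_multiplicative_basis (class_ring :: 'f ring)
    (restricted_lie_algebra.restricted_enveloping_algebra scale bracket pmap) B" by blast
  obtain Basis where Basis: "finite_dimensional_vector_space scale Basis" using assms(3) by blast
  interpret restricted_lie_algebra scale bracket pmap by (rule assms(2))
  interpret fm_basis_lie_algebra scale bracket pmap Basis B
    by (intro fm_basis_lie_algebra.intro p_nilpotent_lie_algebra.intro
        p_nilpotent_lie_algebra_axioms.intro fm_basis_lie_algebra_axioms.intro assms(2,4) Basis B)
  have "bracket x y = 0" for x y by (rule powerful_imp_abelian[OF assms(6)])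
  then show False using assms(5) by (simp add: abelian_def)
qed

end
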